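(* Let $(M^8,g,\rho)$ be a $\mathrm{PSU}(3)$-structure with characteristic forms $T^c,F^c$. Let $T\in\Lambda^3_8\oplus\Lambda^3_{20}\oplus\Lambda^3_{27}$ be a 3-form and $F\in\ast\Lambda^4_8\oplus\ast\Lambda^4_{27}$ a 4-form on $M^8$. The metric connection $\nabla$ determined by $$g(\nabla_XY,Z)=g(\nabla^g_XY,Z)+\tfrac12\,T(X,Y,Z)+\big((X\lrcorner\rho)\lrcorner F\big)(Y,Z)$$ preserves the $\mathrm{PSU}(3)$-structure (i.e. $\nabla\rho=0$) if and only if $(M^8,g,\rho)$ is of type $\mathcal{W}_1\oplus\mathcal{W}_2\oplus\mathcal{W}_3\oplus\mathcal{W}_4\oplus\mathcal{W}_5$ and $$T=T^c,\qquad F=F^c .$$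
   Context: Algebraic setting. $\mathbb{R}^8$ is oriented Euclidean space, identified with its dual; $(e_1,\dots,e_8)$ is an oriented orthonormal basis, $e_{i_1\dots i_j}=e_{i_1}\wedge\dots\wedge e_{i_j}$, $\Lambda^k$ the space of $k$-forms. For $\alpha\in\Lambda^k,\beta\in\Lambda^l$ put $\sigma_0(\alpha,\beta)=\alpha\wedge\beta$ and $\sigma_j(\alpha,\beta)=\sum_{i_1<\dots<i_j}(e_{i_1}\lrcorner\cdots\lrcorner e_{i_j}\lrcorner\alpha)\wedge(e_{i_1}\lrcorner\cdots\lrcorner e_{i_j}\lrcorner\beta)$. For $k\le l$ the contraction is $\alpha\lrcorner\beta=\sigma_k(\alpha,\beta)$; $\ast$ is the Hodge operator. Let $$(\star)\quad\rho=e_{246}-e_{235}-e_{145}-e_{136}+(e_{12}+e_{34}-2e_{56})\wedge e_7+\sqrt3\,(e_{12}-e_{34})\wedge e_8 ,$$ $\mathrm{PSU}(3)\subset\mathrm{SO}(8)$ its isotropy group, $\sigma_+(\alpha)=\sigma_1(\rho,\alpha)$, $\sigma_-(\alpha)=\sigma_2(\rho,\alpha)$. Modules: $\Lambda^2_8=\sigma_+(\Lambda^1)$, $\Lambda^2_{20}=\{\omega\in\Lambda^2\mid\omega\wedge\ast\rho=0\}$, $\Lambda^3_8=\{\ast(\omega\wedge\rho)\mid\omega\in\Lambda^2_8\}$, $\Lambda^3_{20}=\sigma_+(\Lambda^2_{20})$, $\Lambda^3_{27}=\{T\in\Lambda^3\mid T\wedge\rho=0,\ T\wedge\ast\rho=0\}$,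 $\Lambda^4_8=\sigma_+(\Lambda^3_8)$, $\Lambda^4_{27}=\sigma_+(\Lambda^3_{27})$. With $\mathfrak{so}(8)=\Lambda^2$ one has $\mathfrak{psu}(3)=\Lambda^2_8$; let $\mathfrak m=\Lambda^2_{20}$ be its orthogonal complement and $\mathrm{pr}_{\mathfrak m}$ the projection. Maps: $\Phi_1(X\otimes\omega)=X\wedge\omega$ and $\Phi_2(X\otimes\omega)=(X\lrcorner\rho)\wedge\omega$ on $\mathbb{R}^8\otimes\mathfrak m$; $\Theta_1(T)=-\frac12\sum_i e_i\otimes\mathrm{pr}_{\mathfrak m}(e_i\lrcorner T)$ for $T\in\Lambda^3$; $\Theta_2(F)=-\sum_i e_i\otimes\mathrm{pr}_{\mathfrak m}((e_i\lrcorner\rho)\lrcorner F)$ for $F\in\Lambda^4$. Put $\mathcal{W}_1=\Theta_1(\Lambda^3_8)$, $\mathcal{W}_2=\Theta_1(\Lambda^3_{20})$, $\mathcal{W}_3=\Theta_1(\Lambda^3_{27})$, $\mathcal{W}_4=\Theta_2(\ast\Lambda^4_8)$, $\mathcal{W}_5=\Theta_2(\ast\Lambda^4_{27})$, $\mathcal{W}_6=\mathrm{Ker}(\Phi_1)\cap\mathrm{Ker}(\Phi_2)$; then $\mathbb{R}^8\otimes\mathfrak m=\mathcal{W}_1\oplus\dots\oplus\mathcal{W}_6$, and $\Theta_1$ is injective on $\Lambda^3_8\oplus\Lambda^3_{20}\oplus\Lambda^3_{27}$, $\Theta_2$ on $\ast\Lambda^4_8\oplus\ast\Lambda^4_{27}$.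 Geometric setting. A $\mathrm{PSU}(3)$-structure $(M^8,g,\rho)$ is an (oriented) Riemannian 8-manifold with a 3-form $\rho$ such that at every point there is an oriented orthonormal frame (an adapted frame) realizing $(\star)$; the operators $\sigma_j,\sigma_+,\sigma_-,\ast$, the modules $\Lambda^k_i$ and $\mathfrak m$, the maps $\Phi_1,\Phi_2,\Theta_1,\Theta_2$ and the spaces $\mathcal{W}_1,\dots,\mathcal{W}_6$ are applied pointwise in adapted frames. Let $\omega^g_{ij}=g(\nabla^g e_i,e_j)$ be the connection forms of the Levi-Civita connection $\nabla^g$ in an adapted frame and $\Omega^g=(\omega^g_{ij})$. The intrinsic torsion is $\Gamma=\mathrm{pr}_{\mathfrak m}(\Omega^g)=\Gamma_1+\dots+\Gamma_6$, $\Gamma_i\in\mathcal{W}_i$. The structure is of type $\mathcal{W}_{i_1}\oplus\dots\oplus\mathcal{W}_{i_j}$ if $\Gamma\in\mathcal{W}_{i_1}\oplus\dots\oplus\mathcal{W}_{i_j}$. The characteristic forms are the 3-form $T^c\in\Lambda^3_8\oplus\Lambda^3_{20}\oplus\Lambda^3_{27}$ with $\Theta_1(T^c)=\Gamma_1+\Gamma_2+\Gamma_3$ and the 4-form $F^c\in\ast\Lambda^4_8\oplus\ast\Lambda^4_{27}$ with $\Theta_2(F^c)=\Gamma_4+\Gamma_5$. *)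

theory Defs
  imports "HOL-Analysis.Analysis" "HOL-Library.Set_Algebras"
begin

section \<open>The exterior algebra of oriented Euclidean 8-space\<close>

text \<open>
  A form is the family of its coefficients with respect to the basis $e_I$,
  \<open>I\<close> a set of indices; the inner product of \<open>real ^ (8 set)\<close> makes this basis orthonormal.
  In the index type \<open>8\<close> the numeral \<open>8\<close> coincides with \<open>0\<close>, so the order of the indices
  $1 < 2 < \dots < 8$ is not the order of the type but that of \<open>pos\<close>.
\<close>

type_synonym form = "real ^ (8 set)"

definition pos :: "8 \<Rightarrow> nat" where
  "pos i = (THE n. n \<in> {1..8} \<and> of_nat n = i)"

definition ilist :: "8 set \<Rightarrow> 8 list" where
  "ilist I = filter (\<lambda>i. i \<in> I) [1, 2, 3, 4, 5, 6, 7, 8]"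

text \<open>The sign of the permutation that sorts the concatenation of \<open>I\<close> and \<open>J\<close>.\<close>

definition shuffle_sign :: "8 set \<Rightarrow> 8 set \<Rightarrow> real" where
  "shuffle_sign I J = (- 1) ^ card {(i, j). i \<in> I \<and> j \<in> J \<and> pos j < pos i}"

definition Lam :: "nat \<Rightarrow> form set" where
  "Lam k = {\<alpha>. \<forall>I. card I \<noteq> k \<longrightarrow> \<alpha> $ I = 0}"

definition wedge :: "form \<Rightarrow> form \<Rightarrow> form" where
  "wedge \<alpha> \<beta> = (\<chi> K. \<Sum>I\<in>Pow K. shuffle_sign I (K - I) * \<alpha> $ I * \<beta> $ (K - I))"

definition star :: "form \<Rightarrow> form" where
  "star \<alpha> = (\<chi> K. shuffle_sign (- K) K * \<alpha> $ (- K))"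

text \<open>\<open>ee [i, \<dots>, j]\<close> is $e_i \wedge \dots \wedge e_j$.\<close>

definition ee :: "8 list \<Rightarrow> form" where
  "ee is = foldr (\<lambda>i. wedge (axis {i} 1)) is (axis {} 1)"

definition hook :: "8 \<Rightarrow> form \<Rightarrow> form" where
  "hook i \<alpha> = (\<chi> I. if i \<in> I then 0 else shuffle_sign {i} I * \<alpha> $ insert i I)"

definition interior_prod :: "real ^ 8 \<Rightarrow> form \<Rightarrow> form" where
  "interior_prod x \<alpha> = (\<Sum>i\<in>UNIV. x $ i *\<^sub>R hook i \<alpha>)"

text \<open>For a \<open>k\<close>-form \<open>\<alpha>\<close>, \<open>form_app \<alpha> [x\<^sub>1, \<dots>, x\<^sub>k]\<close> is the number $\alpha(x_1, \dots, x_k)$.\<close>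

definition form_app :: "form \<Rightarrow> (real ^ 8) list \<Rightarrow> real" where
  "form_app \<alpha> xs = fold interior_prod xs \<alpha> $ {}"

definition sigma :: "nat \<Rightarrow> form \<Rightarrow> form \<Rightarrow> form" where
  "sigma j \<alpha> \<beta> =
     (\<Sum>I | card I = j. wedge (foldr hook (ilist I) \<alpha>) (foldr hook (ilist I) \<beta>))"

text \<open>The contraction of a \<open>k\<close>-form with an \<open>l\<close>-form, \<open>k \<le> l\<close>.\<close>

abbreviation contract :: "nat \<Rightarrow> form \<Rightarrow> form \<Rightarrow> form" where
  "contract k \<alpha> \<beta> \<equiv> sigma k \<alpha> \<beta>"


section \<open>The algebra of the model form\<close>

definition rho0 :: form where
  "rho0 = ee [2, 4, 6] - ee [2, 3, 5] - ee [1, 4, 5] - ee [1, 3, 6]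
     + wedge (ee [1, 2] + ee [3, 4] - 2 *\<^sub>R ee [5, 6]) (ee [7])
     + sqrt 3 *\<^sub>R wedge (ee [1, 2] - ee [3, 4]) (ee [8])"

definition sigma_plus :: "form \<Rightarrow> form" where
  "sigma_plus \<alpha> = sigma 1 rho0 \<alpha>"

definition Lam2_8 :: "form set" where
  "Lam2_8 = sigma_plus ` Lam 1"

definition Lam2_20 :: "form set" where
  "Lam2_20 = {\<omega> \<in> Lam 2. wedge \<omega> (star rho0) = 0}"

definition Lam3_8 :: "form set" where
  "Lam3_8 = {star (wedge \<omega> rho0) | \<omega>. \<omega> \<in> Lam2_8}"

definition Lam3_20 :: "form set" where
  "Lam3_20 = sigma_plus ` Lam2_20"

definition Lam3_27 :: "form set" where
  "Lam3_27 = {T \<in> Lam 3. wedge T rho0 = 0 \<and> wedge T (star rho0) = 0}"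

definition Lam4_8 :: "form set" where
  "Lam4_8 = sigma_plus ` Lam3_8"

definition Lam4_27 :: "form set" where
  "Lam4_27 = sigma_plus ` Lam3_27"

text \<open>Orthogonal projection onto $\mathfrak m = \Lambda^2_{20}$.\<close>

definition pr_m :: "form \<Rightarrow> form" where
  "pr_m \<omega> = (THE \<eta>. \<eta> \<in> Lam2_20 \<and> (\<forall>\<zeta>\<in>Lam2_20. orthogonal (\<omega> - \<eta>) \<zeta>))"

text \<open>
  Elements of $\mathbb R^8 \otimes \Lambda^*$ are families of forms:
  $\sum_i e_i \otimes \omega_i$ is the family with components $\omega_i$.
\<close>

type_synonym tensor = "form ^ 8"

definition tensor_m :: "tensor set" where
  "tensor_m = {G. \<forall>i. G $ i \<in> Lam2_20}"

definition Phi1 :: "tensor \<Rightarrow> form" where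
  "Phi1 G = (\<Sum>i\<in>UNIV. wedge (ee [i]) (G $ i))"

definition Phi2 :: "tensor \<Rightarrow> form" where
  "Phi2 G = (\<Sum>i\<in>UNIV. wedge (hook i rho0) (G $ i))"

definition Theta1 :: "form \<Rightarrow> tensor" where
  "Theta1 T = (\<chi> i. - (1 / 2) *\<^sub>R pr_m (hook i T))"

definition Theta2 :: "form \<Rightarrow> tensor" where
  "Theta2 F = (\<chi> i. - pr_m (contract 2 (hook i rho0) F))"

definition W1 :: "tensor set" where "W1 = Theta1 ` Lam3_8"
definition W2 :: "tensor set" where "W2 = Theta1 ` Lam3_20"
definition W3 :: "tensor set" where "W3 = Theta1 ` Lam3_27"
definition W4 :: "tensor set" where "W4 = Theta2 ` star ` Lam4_8"
definition W5 :: "tensor set" where "W5 = Theta2 ` star ` Lam4_27"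
definition W6 :: "tensor set" where "W6 = {G \<in> tensor_m. Phi1 G = 0 \<and> Phi2 G = 0}"


section \<open>Smooth manifolds\<close>

text \<open>Only used for open \<open>S\<close>.\<close>

primrec Ck_on :: "nat \<Rightarrow> 'a::euclidean_space set \<Rightarrow> ('a \<Rightarrow> 'b::real_normed_vector) \<Rightarrow> bool" where
  "Ck_on 0 S f \<longleftrightarrow> continuous_on S f"
| "Ck_on (Suc k) S f \<longleftrightarrow> (\<forall>x\<in>S. f differentiable (at x)) \<and>
     (\<forall>v. Ck_on k S (\<lambda>x. frechet_derivative f (at x) v))"

definition smooth_on :: "'a::euclidean_space set \<Rightarrow> ('a \<Rightarrow> 'b::real_normed_vector) \<Rightarrow> bool" where
  "smooth_on S f \<longleftrightarrow> (\<forall>k. Ck_on k S f)"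

text \<open>The manifold is the whole type \<open>'m\<close>; Hausdorff and second countable are sort constraints.
  A chart is an open set with a coordinate map.\<close>

type_synonym 'm atlas = "('m set \<times> ('m \<Rightarrow> real ^ 8)) set"

definition oriented_smooth_atlas ::
    "'m::{t2_space, second_countable_topology} atlas \<Rightarrow> bool" where
  "oriented_smooth_atlas A \<longleftrightarrow>
     (\<Union>(U, \<phi>)\<in>A. U) = UNIV \<and>
     (\<forall>(U, \<phi>)\<in>A. open U \<and> open (\<phi> ` U) \<and> homeomorphism U (\<phi> ` U) \<phi> (inv_into U \<phi>)) \<and>
     (\<forall>(U, \<phi>)\<in>A. \<forall>(V, \<psi>)\<in>A.
        smooth_on (\<phi> ` (U \<inter> V)) (\<psi> \<circ> inv_into U \<phi>) \<and>
        (\<forall>x\<in>\<phi> ` (U \<inter> V). det (matrix (frechet_derivative (\<psi> \<circ> inv_into U \<phi>) (at x))) > 0))"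

definition smooth_fun :: "'m::topological_space atlas \<Rightarrow> 'm set \<Rightarrow> ('m \<Rightarrow> real) \<Rightarrow> bool" where
  "smooth_fun A U f \<longleftrightarrow> open U \<and>
     (\<forall>(V, \<phi>)\<in>A. smooth_on (\<phi> ` (U \<inter> V)) (f \<circ> inv_into V \<phi>))"

definition smooth_near :: "'m::topological_space atlas \<Rightarrow> 'm \<Rightarrow> ('m \<Rightarrow> real) \<Rightarrow> bool" where
  "smooth_near A p f \<longleftrightarrow> (\<exists>U. p \<in> U \<and> smooth_fun A U f)"

text \<open>
  A tangent vector at \<open>p\<close> is a derivation of the germs at \<open>p\<close> of smooth functions. It is
  represented by a functional on all functions, with value 0 on those not smooth near \<open>p\<close>.
\<close>

type_synonym 'm tvec = "('m \<Rightarrow> real) \<Rightarrow> real"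
type_synonym 'm vfield = "'m \<Rightarrow> 'm tvec"

definition tangent :: "'m::topological_space atlas \<Rightarrow> 'm \<Rightarrow> 'm tvec \<Rightarrow> bool" where
  "tangent A p v \<longleftrightarrow>
     (\<forall>f h a b. smooth_near A p f \<and> smooth_near A p h \<longrightarrow>
        v (\<lambda>q. a * f q + b * h q) = a * v f + b * v h) \<and>
     (\<forall>f h. smooth_near A p f \<and> smooth_near A p h \<longrightarrow>
        v (\<lambda>q. f q * h q) = f p * v h + h p * v f) \<and>
     (\<forall>f h. smooth_near A p f \<and> smooth_near A p h \<and> (\<forall>\<^sub>F q in nhds p. f q = h q) \<longrightarrow> v f = v h) \<and>
     (\<forall>f. \<not> smooth_near A p f \<longrightarrow> v f = 0)"

definition lincomb :: "real \<Rightarrow> 'm tvec \<Rightarrow> real \<Rightarrow> 'm tvec \<Rightarrow> 'm tvec" where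
  "lincomb a v b w = (\<lambda>f. a * v f + b * w f)"

definition smooth_vfield :: "'m::topological_space atlas \<Rightarrow> 'm set \<Rightarrow> 'm vfield \<Rightarrow> bool" where
  "smooth_vfield A U X \<longleftrightarrow> open U \<and> (\<forall>q\<in>U. tangent A q (X q)) \<and>
     (\<forall>V f. V \<subseteq> U \<and> smooth_fun A V f \<longrightarrow> smooth_fun A V (\<lambda>q. X q f))"

text \<open>A \<open>k\<close>-form takes lists of \<open>k\<close> tangent vectors; on all other lists its value is 0,
  so that equality of forms is equality of functions.\<close>

type_synonym 'm mform = "'m \<Rightarrow> 'm tvec list \<Rightarrow> real"

definition differential_form :: "'m::topological_space atlas \<Rightarrow> nat \<Rightarrow> 'm mform \<Rightarrow> bool" where
  "differential_form A k \<alpha> \<longleftrightarrow>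
     (\<forall>p xs. \<not> (length xs = k \<and> (\<forall>v\<in>set xs. tangent A p v)) \<longrightarrow> \<alpha> p xs = 0) \<and>
     (\<forall>p xs i v w a b. length xs = k \<and> (\<forall>u\<in>set xs. tangent A p u) \<and> i < k \<and>
        tangent A p v \<and> tangent A p w \<longrightarrow>
        \<alpha> p (xs[i := lincomb a v b w]) = a * \<alpha> p (xs[i := v]) + b * \<alpha> p (xs[i := w])) \<and>
     (\<forall>p xs i j. length xs = k \<and> i < k \<and> j < k \<and> i \<noteq> j \<and> xs ! i = xs ! j \<longrightarrow> \<alpha> p xs = 0) \<and>
     (\<forall>U Xs. open U \<and> length Xs = k \<and> (\<forall>X\<in>set Xs. smooth_vfield A U X) \<longrightarrow>
        smooth_fun A U (\<lambda>q. \<alpha> q (map (\<lambda>X. X q) Xs)))"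

type_synonym 'm metric = "'m \<Rightarrow> 'm tvec \<Rightarrow> 'm tvec \<Rightarrow> real"

definition riemannian_metric :: "'m::topological_space atlas \<Rightarrow> 'm metric \<Rightarrow> bool" where
  "riemannian_metric A g \<longleftrightarrow>
     (\<forall>p u v w a b. tangent A p u \<and> tangent A p v \<and> tangent A p w \<longrightarrow>
        g p (lincomb a u b v) w = a * g p u w + b * g p v w) \<and>
     (\<forall>p v w. tangent A p v \<and> tangent A p w \<longrightarrow> g p v w = g p w v) \<and>
     (\<forall>p v. tangent A p v \<and> v \<noteq> (\<lambda>f. 0) \<longrightarrow> g p v v > 0) \<and>
     (\<forall>U X Y. smooth_vfield A U X \<and> smooth_vfield A U Y \<longrightarrow>
        smooth_fun A U (\<lambda>q. g q (X q) (Y q)))"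


section \<open>Connections\<close>

text \<open>
  \<open>D p v Y\<close> is the covariant derivative at \<open>p\<close>, in the direction \<open>v\<close>, of a vector field \<open>Y\<close>
  that is defined and smooth near \<open>p\<close>.
\<close>

type_synonym 'm conn = "'m \<Rightarrow> 'm tvec \<Rightarrow> 'm vfield \<Rightarrow> 'm tvec"

definition connection :: "'m::topological_space atlas \<Rightarrow> 'm conn \<Rightarrow> bool" where
  "connection A D \<longleftrightarrow>
     (\<forall>U p v Y. p \<in> U \<and> tangent A p v \<and> smooth_vfield A U Y \<longrightarrow> tangent A p (D p v Y)) \<and>
     (\<forall>U p v w a b Y. p \<in> U \<and> tangent A p v \<and> tangent A p w \<and> smooth_vfield A U Y \<longrightarrow>
        D p (lincomb a v b w) Y = lincomb a (D p v Y) b (D p w Y)) \<and>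
     (\<forall>U p v Y Z. p \<in> U \<and> tangent A p v \<and> smooth_vfield A U Y \<and> smooth_vfield A U Z \<longrightarrow>
        D p v (\<lambda>q. lincomb 1 (Y q) 1 (Z q)) = lincomb 1 (D p v Y) 1 (D p v Z)) \<and>
     (\<forall>U p v f Y. p \<in> U \<and> tangent A p v \<and> smooth_fun A U f \<and> smooth_vfield A U Y \<longrightarrow>
        D p v (\<lambda>q h. f q * Y q h) = lincomb (v f) (Y p) (f p) (D p v Y)) \<and>
     (\<forall>U p v Y Z. p \<in> U \<and> tangent A p v \<and> smooth_vfield A U Y \<and> smooth_vfield A U Z \<and>
        (\<forall>q\<in>U. Y q = Z q) \<longrightarrow> D p v Y = D p v Z) \<and>
     (\<forall>U X Y. smooth_vfield A U X \<and> smooth_vfield A U Y \<longrightarrow>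
        smooth_vfield A U (\<lambda>q. D q (X q) Y))"

definition metric_connection ::
    "'m::topological_space atlas \<Rightarrow> 'm metric \<Rightarrow> 'm conn \<Rightarrow> bool" where
  "metric_connection A g D \<longleftrightarrow> connection A D \<and>
     (\<forall>U p v Y Z. p \<in> U \<and> tangent A p v \<and> smooth_vfield A U Y \<and> smooth_vfield A U Z \<longrightarrow>
        v (\<lambda>q. g q (Y q) (Z q)) = g p (D p v Y) (Z p) + g p (Y p) (D p v Z))"

definition levi_civita ::
    "'m::topological_space atlas \<Rightarrow> 'm metric \<Rightarrow> 'm conn \<Rightarrow> bool" where
  "levi_civita A g D \<longleftrightarrow> metric_connection A g D \<and>
     (\<forall>U p X Y f. p \<in> U \<and> smooth_vfield A U X \<and> smooth_vfield A U Y \<and> smooth_near A p f \<longrightarrow>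
        D p (X p) Y f - D p (Y p) X f = X p (\<lambda>q. Y q f) - Y p (\<lambda>q. X q f))"

definition parallel_form ::
    "'m::topological_space atlas \<Rightarrow> 'm conn \<Rightarrow> nat \<Rightarrow> 'm mform \<Rightarrow> bool" where
  "parallel_form A D k \<alpha> \<longleftrightarrow>
     (\<forall>U p v Ys. p \<in> U \<and> tangent A p v \<and> length Ys = k \<and> (\<forall>Y\<in>set Ys. smooth_vfield A U Y) \<longrightarrow>
        v (\<lambda>q. \<alpha> q (map (\<lambda>Y. Y q) Ys))
          - (\<Sum>i<k. \<alpha> p ((map (\<lambda>Y. Y p) Ys)[i := D p v (Ys ! i)])) = 0)"


section \<open>PSU(3)-structures\<close>

type_synonym 'm frame = "8 \<Rightarrow> 'm vfield"

text \<open>The coefficients of a differential form, and of a tangent vector, in an orthonormal frame.\<close>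

definition frame_form :: "'m frame \<Rightarrow> 'm \<Rightarrow> 'm mform \<Rightarrow> form" where
  "frame_form e p \<alpha> = (\<chi> I. \<alpha> p (map (\<lambda>i. e i p) (ilist I)))"

definition frame_vec :: "'m metric \<Rightarrow> 'm frame \<Rightarrow> 'm \<Rightarrow> 'm tvec \<Rightarrow> real ^ 8" where
  "frame_vec g e p v = (\<chi> i. g p v (e i p))"

text \<open>The index 8 is the element \<open>0\<close> of the type \<open>8\<close>, but permuting rows and columns of the
  square matrix of coordinates simultaneously does not change its determinant.\<close>

definition oriented_orthonormal_frame ::
    "'m::topological_space atlas \<Rightarrow> 'm metric \<Rightarrow> 'm set \<Rightarrow> 'm frame \<Rightarrow> bool" where
  "oriented_orthonormal_frame A g U e \<longleftrightarrow> open U \<and> (\<forall>i. smooth_vfield A U (e i)) \<and>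
     (\<forall>q\<in>U. (\<forall>i j. g q (e i q) (e j q) = (if i = j then 1 else 0)) \<and>
        (\<forall>v. tangent A q v \<longrightarrow> (\<exists>c. v = (\<lambda>f. \<Sum>i\<in>UNIV. c i * e i q f))) \<and>
        (\<forall>(V, \<phi>)\<in>A. q \<in> V \<longrightarrow> det (\<chi> i j. e i q (\<lambda>x. \<phi> x $ j)) > 0))"

text \<open>Adapted frames are local frame fields: their connection forms are taken below.\<close>

definition adapted_frame ::
    "'m::topological_space atlas \<Rightarrow> 'm metric \<Rightarrow> 'm mform \<Rightarrow> 'm set \<Rightarrow> 'm frame \<Rightarrow> bool" where
  "adapted_frame A g rho U e \<longleftrightarrow>
     oriented_orthonormal_frame A g U e \<and> (\<forall>q\<in>U. frame_form e q rho = rho0)"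

definition psu3_structure ::
    "'m::{t2_space, second_countable_topology} atlas \<Rightarrow> 'm metric \<Rightarrow> 'm mform \<Rightarrow> bool" where
  "psu3_structure A g rho \<longleftrightarrow>
     oriented_smooth_atlas A \<and> riemannian_metric A g \<and> differential_form A 3 rho \<and>
     (\<forall>p. \<exists>U e. p \<in> U \<and> adapted_frame A g rho U e)"

text \<open>The form \<open>\<alpha>\<close> is a section of the bundle associated with the submodule \<open>S\<close>.\<close>

definition section_of ::
    "'m::topological_space atlas \<Rightarrow> 'm metric \<Rightarrow> 'm mform \<Rightarrow> form set \<Rightarrow> 'm mform \<Rightarrow> bool" where
  "section_of A g rho S \<alpha> \<longleftrightarrow>
     (\<forall>U e p. adapted_frame A g rho U e \<and> p \<in> U \<longrightarrow> frame_form e p \<alpha> \<in> S)"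

text \<open>The matrix of connection forms $\omega_{ij} = g(\nabla e_i, e_j)$, with the skew matrix
  $(\omega_{ij})$ identified with the 2-form $\sum_{i<j} \omega_{ij}\, e_{ij}$.\<close>

definition connection_forms :: "'m metric \<Rightarrow> 'm conn \<Rightarrow> 'm frame \<Rightarrow> 'm \<Rightarrow> tensor" where
  "connection_forms g D e p =
     (\<chi> k. \<Sum>(i, j) | pos i < pos j. g p (D p (e k p) (e i)) (e j p) *\<^sub>R ee [i, j])"

definition intrinsic_torsion :: "'m metric \<Rightarrow> 'm conn \<Rightarrow> 'm frame \<Rightarrow> 'm \<Rightarrow> tensor" where
  "intrinsic_torsion g Dg e p = (\<chi> k. pr_m (connection_forms g Dg e p $ k))"

definition of_type ::
    "'m::topological_space atlas \<Rightarrow> 'm metric \<Rightarrow> 'm mform \<Rightarrow> 'm conn \<Rightarrow> tensor set \<Rightarrow> bool" where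
  "of_type A g rho Dg W \<longleftrightarrow>
     (\<forall>U e p. adapted_frame A g rho U e \<and> p \<in> U \<longrightarrow> intrinsic_torsion g Dg e p \<in> W)"

definition characteristic_forms ::
    "'m::topological_space atlas \<Rightarrow> 'm metric \<Rightarrow> 'm mform \<Rightarrow> 'm conn \<Rightarrow> 'm mform \<Rightarrow> 'm mform \<Rightarrow> bool"
    where
  "characteristic_forms A g rho Dg Tc Fc \<longleftrightarrow>
     differential_form A 3 Tc \<and> section_of A g rho (Lam3_8 + Lam3_20 + Lam3_27) Tc \<and>
     differential_form A 4 Fc \<and> section_of A g rho (star ` Lam4_8 + star ` Lam4_27) Fc \<and>
     (\<forall>U e p. adapted_frame A g rho U e \<and> p \<in> U \<longrightarrow>
        (\<exists>G1\<in>W1. \<exists>G2\<in>W2. \<exists>G3\<in>W3. \<exists>G4\<in>W4. \<exists>G5\<in>W5. \<exists>G6\<in>W6.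
           intrinsic_torsion g Dg e p = G1 + G2 + G3 + G4 + G5 + G6 \<and>
           Theta1 (frame_form e p Tc) = G1 + G2 + G3 \<and>
           Theta2 (frame_form e p Fc) = G4 + G5))"

end

(*
  In an adapted frame the components f_ijk of rho are the structure constants of su(3), sigma_plus
  is the Chevalley-Eilenberg differential d, and its adjoint delta is, up to sign, its conjugate by
  the Hodge operator. The connection is compatible with rho iff the m-part of its connection forms
  vanishes, because the stabilizer of rho is the space of inner derivations (Jacobi identity and
  Killing form), that is, iff the intrinsic torsion is Theta1 T + Theta2 F. Since W6 is the
  orthogonal complement of the images of Theta1 and Theta2, everything reduces to the injectivity of
  (T, F) |-> Theta1 T + Theta2 F for T orthogonal to rho and delta F = 0, a condition satisfied by
  *d(S) because d d = 0. If Theta1 T + Theta2 F = 0, there is a matrix A with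
  1/2 e_i _| T + (e_i _| rho) _| F = sum_j A_ij (e_j _| rho). Antisymmetrizing shows that A
  determines T, contracting with f shows that A is an eigenvector of sum_b ad_b A ad_b^T for the
  largest eigenvalue, hence commutes with the adjoint representation and is scalar, and T orthogonal
  to rho makes it zero. What remains is that no nonzero F satisfies (e_i _| rho) _| F = 0 for all i.
*)

theory Submission
  imports Defs
begin

lemma UNIV_8: "(UNIV :: 8 set) = {1, 2, 3, 4, 5, 6, 7, 8}"
  by (rule sym, rule card_subset_eq) simp_all

lemma exhaust_8:
  fixes i :: 8
  obtains "i = 1" | "i = 2" | "i = 3" | "i = 4" | "i = 5" | "i = 6" | "i = 7" | "i = 8"
proof -
  have "i \<in> {1, 2, 3, 4, 5, 6, 7, 8}"
    using UNIV_8 by blast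
  then show ?thesis
    using that by blast
qed

lemma sum_8: "(\<Sum>i\<in>(UNIV :: 8 set). f i) = f 1 + f 2 + f 3 + f 4 + f 5 + f 6 + f 7 + f 8"
  for f :: "8 \<Rightarrow> 'a::comm_monoid_add"
  unfolding UNIV_8 by (simp add: add.assoc)

lemma pos_eqI:
  assumes "n \<in> {1..8}" "of_nat n = (i::8)"
  shows "pos i = n"
  unfolding pos_def
proof (rule the_equality)
  fix m
  assume m: "m \<in> {1..8} \<and> of_nat m = i"
  have "{1..8} = {1, 2, 3, 4, 5, 6, 7, 8::nat}"
    by auto
  then have "m \<in> {1, 2, 3, 4, 5, 6, 7, 8}" "n \<in> {1, 2, 3, 4, 5, 6, 7, 8}"
    using m assms(1) by blast+
  moreover have "of_nat m = (of_nat n :: 8)"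
    using m assms(2) by simp
  ultimately show "m = n"
    by (elim insertE emptyE) simp_all
qed (use assms in simp)

lemma pos_simps [simp]:
  "pos 1 = 1" "pos 2 = 2" "pos 3 = 3" "pos 4 = 4" "pos 5 = 5" "pos 6 = 6" "pos 7 = 7" "pos 8 = 8"
  by (rule pos_eqI; simp)+

lemma pos_inject [simp]: "pos i = pos j \<longleftrightarrow> i = j"
proof -
  have "of_nat (pos i) = i" for i
    by (cases i rule: exhaust_8) simp_all
  then show ?thesis
    by metis
qed


section \<open>Creation and annihilation operators\<close>

lemma shuffle_sign_prod:
  "shuffle_sign I J = (\<Prod>i\<in>I. \<Prod>j\<in>J. if pos j < pos i then - 1 else 1)"
proof -
  have "(\<Prod>i\<in>I. \<Prod>j\<in>J. if pos j < pos i then - 1 else 1)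
      = (\<Prod>p\<in>I \<times> J. if pos (snd p) < pos (fst p) then - 1 else (1::real))"
    by (simp add: prod.cartesian_product case_prod_beta)
  also have "\<dots> = (- 1) ^ card ((I \<times> J) \<inter> {p. pos (snd p) < pos (fst p)})"
    by (simp add: prod.If_cases)
  also have "(I \<times> J) \<inter> {p. pos (snd p) < pos (fst p)} = {(i, j). i \<in> I \<and> j \<in> J \<and> pos j < pos i}"
    by auto
  finally show ?thesis
    by (simp add: shuffle_sign_def)
qed

lemma shuffle_sign_empty [simp]: "shuffle_sign {} J = 1" "shuffle_sign I {} = 1"
  by (simp_all add: shuffle_sign_prod)

lemma shuffle_sign_insert_left:
  "i \<notin> I \<Longrightarrow> shuffle_sign (insert i I) J = shuffle_sign {i} J * shuffle_sign I J"
  by (simp add: shuffle_sign_prod)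

lemma shuffle_sign_insert_right:
  "j \<notin> J \<Longrightarrow> shuffle_sign I (insert j J) = shuffle_sign I {j} * shuffle_sign I J"
  by (simp add: shuffle_sign_prod prod.distrib)

lemma shuffle_sign_square [simp]: "shuffle_sign I J * shuffle_sign I J = 1"
  by (simp add: shuffle_sign_def flip: power_add)

lemma shuffle_sign_nonzero [simp]: "shuffle_sign I J \<noteq> 0"
  by (simp add: shuffle_sign_def)

lemma shuffle_sign_square_left [simp]: "shuffle_sign I J * (shuffle_sign I J * x) = x"
  by (simp flip: mult.assoc)

lemma shuffle_sign_swap1: "i \<noteq> j \<Longrightarrow> shuffle_sign {i} {j} = - shuffle_sign {j} {i}"
  using pos_inject[of i j] by (auto simp: shuffle_sign_prod)

lemma shuffle_sign_swap:
  assumes "i \<notin> J"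
  shows "shuffle_sign J {i} = (- 1) ^ card J * shuffle_sign {i} J"
proof -
  have "finite J"
    by simp
  then show ?thesis
    using assms
  proof (induction J)
    case (insert j J)
    then show ?case
      using shuffle_sign_insert_left[of j J "{i}"] shuffle_sign_insert_right[of j J "{i}"]
        shuffle_sign_swap1[of i j] by auto
  qed simp
qed

abbreviation ext :: "8 \<Rightarrow> form \<Rightarrow> form" where
  "ext i \<equiv> wedge (axis {i} 1)"

lemma ext_nth: "ext i \<alpha> $ K = (if i \<in> K then shuffle_sign {i} (K - {i}) * \<alpha> $ (K - {i}) else 0)"
proof -
  have "ext i \<alpha> $ K =
      (\<Sum>I\<in>Pow K. if I = {i} then shuffle_sign {i} (K - {i}) * \<alpha> $ (K - {i}) else 0)"
    unfolding wedge_def vec_lambda_beta by (intro sum.cong) (auto simp: axis_def)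
  then show ?thesis
    by simp
qed

lemma hook_nth: "hook i \<alpha> $ I = (if i \<in> I then 0 else shuffle_sign {i} I * \<alpha> $ insert i I)"
  by (simp add: hook_def)

lemma star_nth: "star \<alpha> $ K = shuffle_sign (- K) K * \<alpha> $ (- K)"
  by (simp add: star_def)

lemma linear_hook: "linear (hook i)"
  by (intro linearI) (auto simp: vec_eq_iff hook_nth algebra_simps)

lemma linear_wedge: "linear (wedge \<alpha>)"
  by (intro linearI) (auto simp: vec_eq_iff wedge_def algebra_simps sum.distrib sum_distrib_left)

lemma linear_wedge_left: "linear (\<lambda>\<alpha>. wedge \<alpha> \<beta>)"
  by (intro linearI) (auto simp: vec_eq_iff wedge_def algebra_simps sum.distrib sum_distrib_left)

lemma linear_star: "linear star"
  by (intro linearI) (auto simp: vec_eq_iff star_nth algebra_simps)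

lemmas form_linear =
  linear_add[OF linear_hook] linear_diff[OF linear_hook] linear_neg[OF linear_hook]
  linear_cmul[OF linear_hook] linear_0[OF linear_hook] linear_sum[OF linear_hook]
  linear_add[OF linear_wedge] linear_diff[OF linear_wedge] linear_neg[OF linear_wedge]
  linear_cmul[OF linear_wedge] linear_0[OF linear_wedge] linear_sum[OF linear_wedge]
  linear_add[OF linear_wedge_left] linear_diff[OF linear_wedge_left] linear_neg[OF linear_wedge_left]
  linear_cmul[OF linear_wedge_left] linear_0[OF linear_wedge_left] linear_sum[OF linear_wedge_left]
  linear_add[OF linear_star] linear_diff[OF linear_star] linear_neg[OF linear_star]
  linear_cmul[OF linear_star] linear_0[OF linear_star] linear_sum[OF linear_star]

lemma hook_hook: "hook i (hook j \<alpha>) = - hook j (hook i \<alpha>)"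
proof (cases "i = j")
  case False
  show ?thesis
  proof (subst vec_eq_iff, intro allI)
    fix I
    show "hook i (hook j \<alpha>) $ I = (- hook j (hook i \<alpha>)) $ I"
      using False shuffle_sign_insert_right[of i I "{j}"] shuffle_sign_insert_right[of j I "{i}"]
      by (auto simp: hook_nth shuffle_sign_swap1[of i j] insert_commute)
  qed
qed (simp add: vec_eq_iff hook_nth)

lemma hook_hook_same [simp]: "hook i (hook i \<alpha>) = 0"
  by (simp add: vec_eq_iff hook_nth)

lemma shuffle_sign_remove:
  "j \<in> J \<Longrightarrow> shuffle_sign I J = shuffle_sign I {j} * shuffle_sign I (J - {j})"
  using shuffle_sign_insert_right[of j "J - {j}" I] by (simp only: insert_Diff) simp

lemma ext_ext: "ext i (ext j \<alpha>) = - ext j (ext i \<alpha>)"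
proof (cases "i = j")
  case False
  show ?thesis
  proof (subst vec_eq_iff, intro allI)
    fix K
    have "K - {i} - {j} = K - {j} - {i}"
      by auto
    then show "ext i (ext j \<alpha>) $ K = (- ext j (ext i \<alpha>)) $ K"
      using False shuffle_sign_remove[of i "K - {j}" "{j}"] shuffle_sign_remove[of j "K - {i}" "{i}"]
      by (auto simp: ext_nth shuffle_sign_swap1[of i j])
  qed
qed (auto simp: vec_eq_iff ext_nth)

lemma ext_ext_same [simp]: "ext i (ext i \<alpha>) = 0"
  by (simp add: vec_eq_iff ext_nth)

lemma hook_ext: "hook i (ext j \<alpha>) = (if i = j then \<alpha> else 0) - ext j (hook i \<alpha>)"
proof (subst vec_eq_iff, intro allI)
  fix I
  show "hook i (ext j \<alpha>) $ I = ((if i = j then \<alpha> else 0) - ext j (hook i \<alpha>)) $ I"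
  proof (cases "i = j")
    case True
    then show ?thesis
      by (cases "i \<in> I") (simp_all add: ext_nth hook_nth insert_absorb)
  next
    case False
    then have "j \<in> I \<Longrightarrow> insert i I - {j} = insert i (I - {j})"
      by auto
    then show ?thesis
      using shuffle_sign_insert_right[of i "I - {j}" "{j}"] shuffle_sign_remove[of j I "{i}"]
        shuffle_sign_swap1[OF False]
      by (cases "i \<in> I") (auto simp: ext_nth hook_nth)
  qed
qed

lemma inner_hook: "inner (hook i \<alpha>) \<beta> = inner \<alpha> (ext i \<beta>)"
proof -
  have "(\<Sum>I\<in>UNIV. hook i \<alpha> $ I * \<beta> $ I) = (\<Sum>I | i \<notin> I. hook i \<alpha> $ I * \<beta> $ I)"
    by (rule sum.mono_neutral_right) (auto simp: hook_nth)
  also have "\<dots> = (\<Sum>K | i \<in> K. \<alpha> $ K * ext i \<beta> $ K)"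
    by (rule sum.reindex_bij_witness[of _ "\<lambda>K. K - {i}" "insert i"])
      (auto simp: hook_nth ext_nth insert_absorb)
  also have "\<dots> = (\<Sum>K\<in>UNIV. \<alpha> $ K * ext i \<beta> $ K)"
    by (rule sum.mono_neutral_left) (auto simp: ext_nth)
  finally show ?thesis
    by (simp add: inner_vec_def)
qed


lemma subspace_Lam: "subspace (Lam k)"
  by (auto simp: Lam_def subspace_def)

lemma hook_Lam: "\<alpha> \<in> Lam (Suc k) \<Longrightarrow> hook i \<alpha> \<in> Lam k"
  by (auto simp: Lam_def hook_nth)

lemma ext_Lam:
  assumes "\<alpha> \<in> Lam k"
  shows "ext i \<alpha> \<in> Lam (Suc k)"
  unfolding Lam_def
proof (intro CollectI allI impI)
  fix K :: "8 set"
  assume "card K \<noteq> Suc k"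
  then have "i \<in> K \<Longrightarrow> card (K - {i}) \<noteq> k"
    using card_Suc_Diff1[of K i] by auto
  then show "ext i \<alpha> $ K = 0"
    using assms by (auto simp: ext_nth Lam_def)
qed

lemma star_Lam:
  assumes "\<alpha> \<in> Lam k" "k + l = 8"
  shows "star \<alpha> \<in> Lam l"
  unfolding Lam_def
proof (intro CollectI allI impI)
  fix K :: "8 set"
  assume "card K \<noteq> l"
  moreover have "card K \<le> 8"
    using card_mono[of UNIV K] by simp
  ultimately have "card (- K) \<noteq> k"
    using assms(2) by (simp add: Compl_eq_Diff_UNIV card_Diff_subset)
  then show "star \<alpha> $ K = 0"
    using assms(1) by (simp add: star_nth Lam_def)
qed

lemma star_eq_0_iff [simp]: "star \<alpha> = 0 \<longleftrightarrow> \<alpha> = 0"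
proof
  assume "star \<alpha> = 0"
  then have "shuffle_sign K (- K) * \<alpha> $ K = 0" for K
    by (metis star_nth zero_index double_complement)
  then show "\<alpha> = 0"
    by (simp add: vec_eq_iff)
qed (simp add: form_linear)

lemma hook_star:
  assumes "\<alpha> \<in> Lam k"
  shows "hook i (star \<alpha>) = (- 1) ^ k *\<^sub>R star (ext i \<alpha>)"
proof (subst vec_eq_iff, intro allI)
  fix I
  show "hook i (star \<alpha>) $ I = ((- 1) ^ k *\<^sub>R star (ext i \<alpha>)) $ I"
  proof (cases "i \<in> I")
    case False
    define J where "J = - insert i I"
    have J: "i \<notin> J" "- I = insert i J" "- insert i I = J"
      using False by (auto simp: J_def)
    have "\<alpha> $ J = 0 \<or> card J = k"
      using assms by (auto simp: Lam_def)
    then show ?thesis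
      using False J shuffle_sign_insert_right[of i I J] shuffle_sign_insert_left[of i J I]
      by (auto simp: hook_nth star_nth ext_nth shuffle_sign_swap[OF J(1)])
  qed (simp add: hook_nth star_nth ext_nth)
qed

lemma ext_star:
  assumes "\<alpha> \<in> Lam (Suc k)"
  shows "ext i (star \<alpha>) = (- 1) ^ k *\<^sub>R star (hook i \<alpha>)"
proof (subst vec_eq_iff, intro allI)
  fix I
  show "ext i (star \<alpha>) $ I = ((- 1) ^ k *\<^sub>R star (hook i \<alpha>)) $ I"
  proof (cases "i \<in> I")
    case True
    define J where "J = I - {i}"
    define M where "M = - I"
    have M: "i \<notin> M" "i \<notin> J" and sets: "I - {i} = J" "- I = M" "- J = insert i M"
      using True by (auto simp: J_def M_def)
    have "\<alpha> $ insert i M = 0 \<or> card M = k"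
      using assms M(1) by (auto simp: Lam_def)
    moreover have "star (hook i \<alpha>) $ I
        = shuffle_sign M {i} * shuffle_sign M J * (shuffle_sign {i} M * \<alpha> $ insert i M)"
      using M(1) shuffle_sign_remove[OF True, of M] by (simp add: star_nth hook_nth sets)
    moreover have "ext i (star \<alpha>) $ I = shuffle_sign M J * \<alpha> $ insert i M"
      using True shuffle_sign_insert_left[OF M(1), of J] by (simp add: star_nth ext_nth sets)
    ultimately show ?thesis
      by (auto simp: mult.assoc shuffle_sign_swap[OF M(1)])
  qed (simp add: hook_nth star_nth ext_nth)
qed

lemma euler: "\<alpha> \<in> Lam k \<Longrightarrow> (\<Sum>i\<in>UNIV. ext i (hook i \<alpha>)) = real k *\<^sub>R \<alpha>"
proof (subst vec_eq_iff, intro allI)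
  fix K
  assume "\<alpha> \<in> Lam k"
  then have "\<alpha> $ K = 0 \<or> card K = k"
    by (auto simp: Lam_def)
  moreover have "ext i (hook i \<alpha>) $ K = (if i \<in> K then \<alpha> $ K else 0)" for i
    by (simp add: ext_nth hook_nth insert_absorb)
  ultimately show "(\<Sum>i\<in>UNIV. ext i (hook i \<alpha>)) $ K = (real k *\<^sub>R \<alpha>) $ K"
    by (auto simp: sum.If_cases)
qed


section \<open>Components of a form\<close>

definition comps :: "form \<Rightarrow> 8 list \<Rightarrow> real" where
  "comps \<alpha> is = fold hook is \<alpha> $ {}"

lemma comps_Nil [simp]: "comps \<alpha> [] = \<alpha> $ {}"
  by (simp add: comps_def)

lemma comps_Cons: "comps \<alpha> (i # is) = comps (hook i \<alpha>) is"
  by (simp add: comps_def)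

lemma linear_comps: "linear (\<lambda>\<alpha>. comps \<alpha> is)"
proof -
  have "comps (\<alpha> + \<beta>) is = comps \<alpha> is + comps \<beta> is" for \<alpha> \<beta>
    by (induction "is" arbitrary: \<alpha> \<beta>) (simp_all add: comps_Cons form_linear)
  moreover have "comps (c *\<^sub>R \<alpha>) is = c * comps \<alpha> is" for c \<alpha>
    by (induction "is" arbitrary: \<alpha>) (simp_all add: comps_Cons form_linear)
  ultimately show ?thesis
    by (intro linearI) auto
qed

lemmas comps_linear =
  linear_add[OF linear_comps] linear_diff[OF linear_comps] linear_neg[OF linear_comps]
  linear_cmul[OF linear_comps, unfolded real_scaleR_def] linear_0[OF linear_comps]
  linear_sum[OF linear_comps]

lemma comps_swap: "comps \<alpha> (is @ i # j # js) = - comps \<alpha> (is @ j # i # js)"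
  by (induction "is" arbitrary: \<alpha>) (simp_all add: comps_Cons hook_hook[of j i] comps_linear)

abbreviation pos_sorted :: "8 list \<Rightarrow> bool" where
  "pos_sorted \<equiv> sorted_wrt (\<lambda>i j. pos i < pos j)"

lemma set_ilist [simp]: "set (ilist I) = I"
proof -
  have "set [1, 2, 3, 4, 5, 6, 7, 8] = (UNIV :: 8 set)"
    by (simp only: UNIV_8 list.set)
  then show ?thesis
    unfolding ilist_def set_filter by simp
qed

lemma pos_sorted_ilist: "pos_sorted (ilist I)"
  unfolding ilist_def by (rule sorted_wrt_filter) simp

lemma ilist_set:
  assumes "pos_sorted is"
  shows "ilist (set is) = is"
proof -
  have "sorted_wrt (<) (map pos js)" if "pos_sorted js" for js
    using that by (simp only: sorted_wrt_map)
  then have "map pos (ilist (set is)) = map pos is"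
    using assms pos_sorted_ilist by (intro strict_sorted_equal) auto
  then show ?thesis
    by (simp add: inj_map_eq_map inj_def)
qed

lemma distinct_ilist: "distinct (ilist I)"
  unfolding ilist_def by (rule distinct_filter) simp

lemma length_ilist [simp]: "length (ilist I) = card I"
  using distinct_card[OF distinct_ilist[of I]] by simp

lemma comps_sorted: "pos_sorted is \<Longrightarrow> comps \<alpha> is = \<alpha> $ set is"
proof (induction "is" arbitrary: \<alpha>)
  case (Cons i "is")
  have "shuffle_sign {i} (set is) = 1"
    using Cons.prems by (auto simp: shuffle_sign_prod intro!: prod.neutral)
  then show ?case
    using Cons by (auto simp: comps_Cons hook_nth)
qed simp

lemma comps_ilist: "comps \<alpha> (ilist I) = \<alpha> $ I"
  by (simp add: comps_sorted pos_sorted_ilist)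

text \<open>Insertion sort: sorting a list of indices changes an alternating function only by a sign.\<close>

lemma alternating_zero:
  fixes h :: "8 list \<Rightarrow> real"
  assumes swap: "\<And>is i j js. length is + length js + 2 = k \<Longrightarrow> h (is @ i # j # js) = - h (is @ j # i # js)"
    and zero: "\<And>I. card I = k \<Longrightarrow> h (ilist I) = 0"
    and "length is = k"
  shows "h is = 0"
proof -
  have ins: "h (pre @ i # js) = 0 \<longleftrightarrow> h (pre @ insort_key pos i js) = 0"
    if "length pre + length js + 1 = k" for pre i js
    using that
  proof (induction js arbitrary: pre)
    case (Cons j js)
    then show ?case
      using Cons.IH[of "pre @ [j]"] swap[of pre js i j] by (cases "pos i \<le> pos j") simp_all
  qed simp
  have srt: "h (pre @ js) = 0 \<longleftrightarrow> h (pre @ sort_key pos js) = 0"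
    if "length pre + length js = k" for pre js
    using that
  proof (induction js arbitrary: pre)
    case (Cons j js)
    then show ?case
      using ins[of pre "sort_key pos js" j] Cons.IH[of "pre @ [j]"] by simp
  qed simp
  define js where "js = sort_key pos is"
  have js: "sorted (map pos js)" "length js = k"
    using assms(3) by (simp_all add: js_def)
  have "h js = 0"
  proof (cases "distinct js")
    case True
    with js(1) have "pos_sorted js"
      unfolding sorted_wrt_map[symmetric] strict_sorted_iff by (simp add: distinct_map inj_on_def)
    moreover have "card (set js) = k"
      using True js(2) by (simp add: distinct_card)
    ultimately show ?thesis
      using zero[of "set js"] by (simp add: ilist_set)
  next
    case False
    have "\<exists>is i js'. js = is @ i # i # js'"
      using js(1) False
    proof (induction js)
      case (Cons i js)
      show ?case
      proof (cases "distinct js")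
        case True
        with Cons.prems obtain j js' where js: "js = j # js'" "i \<in> set js"
          by (cases js) auto
        with Cons.prems(1) have "pos i \<le> pos j \<and> (i = j \<or> pos j \<le> pos i)"
          by auto
        then have "i = j"
          using pos_inject[of i j] by linarith
        then show ?thesis
          using js by (intro exI[of _ "[]"]) auto
      next
        case False
        with Cons obtain "is" l js' where "js = is @ l # l # js'"
          by auto
        then have "i # js = (i # is) @ l # l # js'"
          by simp
        then show ?thesis
          by blast
      qed
    qed simp
    then obtain "is" i js' where "js = is @ i # i # js'"
      by blast
    with swap[of "is" js' i i] js(2) have "h js = - h js"
      by auto
    then show ?thesis
      by linarith
  qed
  then show ?thesis
    using srt[of "[]" "is"] assms(3) by (simp add: js_def)
qed

lemma alternating_eq:
  fixes h h' :: "8 list \<Rightarrow> real"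
  assumes "\<And>is i j js. length is + length js + 2 = k \<Longrightarrow> h (is @ i # j # js) = - h (is @ j # i # js)"
    and "\<And>is i j js. length is + length js + 2 = k \<Longrightarrow> h' (is @ i # j # js) = - h' (is @ j # i # js)"
    and "\<And>I. card I = k \<Longrightarrow> h (ilist I) = h' (ilist I)"
    and "length is = k"
  shows "h is = h' is"
proof -
  have "(\<lambda>is. h is - h' is) is = 0"
  proof (rule alternating_zero[OF _ _ assms(4)])
    fix "is" js :: "8 list" and i j
    assume "length is + length js + 2 = k"
    then show "h (is @ i # j # js) - h' (is @ i # j # js)
        = - (h (is @ j # i # js) - h' (is @ j # i # js))"
      using assms(1)[of "is" js i j] assms(2)[of "is" js i j] by linarith
  qed (simp add: assms(3))
  then show ?thesis
    by simp
qed

lemma form_eqI: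
  assumes "\<alpha> \<in> Lam k" "\<beta> \<in> Lam k" "\<And>is. length is = k \<Longrightarrow> comps \<alpha> is = comps \<beta> is"
  shows "\<alpha> = \<beta>"
proof (subst vec_eq_iff, intro allI)
  fix I
  show "\<alpha> $ I = \<beta> $ I"
    using assms(1,2) assms(3)[of "ilist I"] by (cases "card I = k") (auto simp: Lam_def comps_ilist)
qed

lemma ilist_eq_pairE:
  assumes "card I = 2"
  obtains i j where "ilist I = [i, j]" "pos i < pos j" "I = {i, j}"
proof -
  from assms have "length (ilist I) = 2"
    by simp
  then obtain i j where "ilist I = [i, j]"
    by (metis (no_types, opaque_lifting) One_nat_def Suc_1 length_0_conv length_Suc_conv)
  with pos_sorted_ilist[of I] set_ilist[of I] that show ?thesis
    by auto
qed

lemma sum_card_2: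
  "(\<Sum>I | card I = 2. G (ilist I)) = (\<Sum>(i, j) | pos i < pos j. G [i, j])"
proof (rule sum.reindex_bij_witness[of _ "\<lambda>(i, j). {i, j}" "\<lambda>I. (ilist I ! 0, ilist I ! 1)"])
  fix I :: "8 set"
  assume "I \<in> {I. card I = 2}"
  then have "card I = 2"
    by simp
  then obtain i j where "ilist I = [i, j]" "pos i < pos j" "I = {i, j}"
    by (rule ilist_eq_pairE)
  then show "(case (ilist I ! 0, ilist I ! 1) of (i, j) \<Rightarrow> {i, j}) = I"
    "(ilist I ! 0, ilist I ! 1) \<in> {(i, j). pos i < pos j}"
    "(case (ilist I ! 0, ilist I ! 1) of (i, j) \<Rightarrow> G [i, j]) = G (ilist I)"
    by auto
next
  fix b :: "8 \<times> 8"
  assume b: "b \<in> {(i, j). pos i < pos j}"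
  obtain i j where "b = (i, j)"
    by force
  moreover from this b have "ilist {i, j} = [i, j]" "i \<noteq> j"
    using ilist_set[of "[i, j]"] by auto
  ultimately show "(ilist (case b of (i, j) \<Rightarrow> {i, j}) ! 0, ilist (case b of (i, j) \<Rightarrow> {i, j}) ! 1) = b"
    "(case b of (i, j) \<Rightarrow> {i, j}) \<in> {I. card I = 2}"
    by auto
qed

lemma sum_ordered_pairs:
  fixes h :: "8 \<Rightarrow> 8 \<Rightarrow> 'a::real_vector"
  assumes "\<And>i j. h i j = h j i" "\<And>i. h i i = 0"
  shows "(\<Sum>(i, j) | pos i < pos j. h i j) = (1 / 2) *\<^sub>R (\<Sum>i\<in>UNIV. \<Sum>j\<in>UNIV. h i j)"
proof -
  have *: "(\<Sum>(i, j) | pos j < pos i. h i j) = (\<Sum>(i, j) | pos i < pos j. h i j)"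
    by (rule sum.reindex_bij_witness[of _ prod.swap prod.swap]) (auto simp: assms(1))
  have "(\<Sum>i\<in>UNIV. \<Sum>j\<in>UNIV. h i j) = (\<Sum>(i, j)\<in>UNIV. h i j)"
    by (simp add: sum.cartesian_product)
  also have "\<dots> = (\<Sum>(i, j)\<in>{(i, j). pos i < pos j} \<union> {(i, j). pos j < pos i}. h i j)"
  proof (rule sum.mono_neutral_right)
    show "\<forall>p\<in>UNIV - ({(i, j). pos i < pos j} \<union> {(i, j). pos j < pos i}). (case p of (i, j) \<Rightarrow> h i j) = 0"
      using assms(2) by (auto simp: not_less_iff_gr_or_eq)
  qed auto
  also have "\<dots> = (\<Sum>(i, j) | pos i < pos j. h i j) + (\<Sum>(i, j) | pos j < pos i. h i j)"
    by (rule sum.union_disjoint) auto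
  finally show ?thesis
    unfolding * by (simp flip: scaleR_2)
qed

lemma wedge_axis_pair:
  assumes "pos i < pos j"
  shows "wedge (axis {i, j} 1) \<alpha> = ext i (ext j \<alpha>)"
proof (subst vec_eq_iff, intro allI)
  fix K
  have ij: "i \<noteq> j" "shuffle_sign {i} {j} = 1"
    using assms by (auto simp: shuffle_sign_prod)
  have "wedge (axis {i, j} 1) \<alpha> $ K = (\<Sum>I\<in>Pow K. if I = {i, j} then
      shuffle_sign {i, j} (K - {i, j}) * \<alpha> $ (K - {i, j}) else 0)"
    unfolding wedge_def vec_lambda_beta by (intro sum.cong) (auto simp: axis_def)
  also have "\<dots> = (if {i, j} \<subseteq> K then shuffle_sign {i, j} (K - {i, j}) * \<alpha> $ (K - {i, j}) else 0)"
    by simp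
  also have "\<dots> = ext i (ext j \<alpha>) $ K"
  proof -
    have "K - {i} - {j} = K - {i, j}"
      by auto
    moreover have "shuffle_sign {i, j} (K - {i, j})
        = shuffle_sign {i} (K - {i, j}) * shuffle_sign {j} (K - {i, j})"
      using ij by (intro shuffle_sign_insert_left) auto
    moreover have "j \<in> K \<Longrightarrow> shuffle_sign {i} (K - {i}) = shuffle_sign {i} (K - {i} - {j})"
      using shuffle_sign_remove[of j "K - {i}" "{i}"] ij by auto
    ultimately show ?thesis
      using ij(1) by (auto simp: ext_nth)
  qed
  finally show "wedge (axis {i, j} 1) \<alpha> $ K = ext i (ext j \<alpha>) $ K" .
qed

lemma comps_2_swap: "comps \<alpha> [i, j] = - comps \<alpha> [j, i]"
  using comps_swap[of \<alpha> "[]" i j "[]"] by simp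

lemma comps_2_same [simp]: "comps \<alpha> [i, i] = 0"
  using comps_2_swap[of \<alpha> i i] by simp

lemma Lam_2_decomp:
  assumes "\<omega> \<in> Lam 2"
  shows "\<omega> = (\<Sum>I | card I = 2. \<omega> $ I *\<^sub>R axis I 1)"
proof (subst vec_eq_iff, intro allI)
  fix K
  have "(\<Sum>I | card I = 2. \<omega> $ I *\<^sub>R axis I 1) $ K = (\<Sum>I | card I = 2. if I = K then \<omega> $ K else 0)"
    unfolding sum_component by (intro sum.cong) (auto simp: axis_def)
  then show "\<omega> $ K = (\<Sum>I | card I = 2. \<omega> $ I *\<^sub>R axis I 1) $ K"
    using assms by (auto simp: Lam_def)
qed

lemma wedge_2:
  assumes "\<omega> \<in> Lam 2"
  shows "wedge \<omega> \<alpha> = (1 / 2) *\<^sub>R (\<Sum>i\<in>UNIV. \<Sum>j\<in>UNIV. comps \<omega> [i, j] *\<^sub>R ext i (ext j \<alpha>))"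
proof -
  have "wedge \<omega> \<alpha> = (\<Sum>I | card I = 2. \<omega> $ I *\<^sub>R wedge (axis I 1) \<alpha>)"
    by (subst Lam_2_decomp[OF assms]) (simp add: form_linear)
  also have "\<dots> = (\<Sum>I | card I = 2. comps \<omega> (ilist I) *\<^sub>R ext (ilist I ! 0) (ext (ilist I ! 1) \<alpha>))"
  proof (intro sum.cong refl)
    fix I :: "8 set"
    assume "I \<in> {I. card I = 2}"
    then have "card I = 2"
      by simp
    then show "\<omega> $ I *\<^sub>R wedge (axis I 1) \<alpha>
        = comps \<omega> (ilist I) *\<^sub>R ext (ilist I ! 0) (ext (ilist I ! 1) \<alpha>)"
      unfolding comps_ilist by (rule ilist_eq_pairE) (simp add: wedge_axis_pair)
  qed
  also have "\<dots> = (\<Sum>(i, j) | pos i < pos j. comps \<omega> [i, j] *\<^sub>R ext i (ext j \<alpha>))"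
    by (subst sum_card_2) simp
  also have "\<dots> = (1 / 2) *\<^sub>R (\<Sum>i\<in>UNIV. \<Sum>j\<in>UNIV. comps \<omega> [i, j] *\<^sub>R ext i (ext j \<alpha>))"
    by (rule sum_ordered_pairs) (subst comps_2_swap, subst ext_ext, simp_all)
  finally show ?thesis .
qed

lemma wedge_0:
  assumes "\<omega> \<in> Lam 0"
  shows "wedge \<omega> \<alpha> = \<omega> $ {} *\<^sub>R \<alpha>"
proof (subst vec_eq_iff, intro allI)
  fix K
  have "wedge \<omega> \<alpha> $ K = (\<Sum>I\<in>Pow K. if I = {} then \<omega> $ {} * \<alpha> $ K else 0)"
    unfolding wedge_def vec_lambda_beta using assms by (intro sum.cong) (auto simp: Lam_def)
  then show "wedge \<omega> \<alpha> $ K = (\<omega> $ {} *\<^sub>R \<alpha>) $ K"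
    by simp
qed

lemma contract_2:
  assumes "\<omega> \<in> Lam 2"
  shows "contract 2 \<omega> \<alpha> = (1 / 2) *\<^sub>R (\<Sum>i\<in>UNIV. \<Sum>j\<in>UNIV. comps \<omega> [i, j] *\<^sub>R hook j (hook i \<alpha>))"
proof -
  have *: "wedge (hook i (hook j \<omega>)) \<beta> = comps \<omega> [j, i] *\<^sub>R \<beta>" for i j \<beta>
  proof -
    have "hook i (hook j \<omega>) \<in> Lam 0"
      using assms by (intro hook_Lam) (simp add: numeral_2_eq_2)
    then show ?thesis
      by (simp add: wedge_0 comps_def)
  qed
  have "contract 2 \<omega> \<alpha> = (\<Sum>(i, j) | pos i < pos j. comps \<omega> [j, i] *\<^sub>R hook i (hook j \<alpha>))"
    unfolding sigma_def
    by (subst sum_card_2[of "\<lambda>is. wedge (foldr hook is \<omega>) (foldr hook is \<alpha>)"]) (simp add: *)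
  also have "\<dots> = (1 / 2) *\<^sub>R (\<Sum>i\<in>UNIV. \<Sum>j\<in>UNIV. comps \<omega> [j, i] *\<^sub>R hook i (hook j \<alpha>))"
    by (rule sum_ordered_pairs) (subst comps_2_swap, subst hook_hook, simp_all)
  also have "\<dots> = (1 / 2) *\<^sub>R (\<Sum>i\<in>UNIV. \<Sum>j\<in>UNIV. comps \<omega> [i, j] *\<^sub>R hook j (hook i \<alpha>))"
    by (subst sum.swap) simp
  finally show ?thesis .
qed

lemma inner_2:
  assumes "\<omega> \<in> Lam 2"
  shows "inner \<omega> \<eta> = 1 / 2 * (\<Sum>i\<in>UNIV. \<Sum>j\<in>UNIV. comps \<omega> [i, j] * comps \<eta> [i, j])"
proof -
  have "inner \<omega> \<eta> = (\<Sum>I | card I = 2. \<omega> $ I * \<eta> $ I)"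
    unfolding inner_vec_def inner_real_def using assms
    by (intro sum.mono_neutral_right) (auto simp: Lam_def)
  also have "\<dots> = (\<Sum>(i, j) | pos i < pos j. comps \<omega> [i, j] * comps \<eta> [i, j])"
    by (subst sum_card_2[of "\<lambda>is. comps \<omega> is * comps \<eta> is", symmetric]) (simp add: comps_ilist)
  also have "\<dots> = (1 / 2) *\<^sub>R (\<Sum>i\<in>UNIV. \<Sum>j\<in>UNIV. comps \<omega> [i, j] * comps \<eta> [i, j])"
    by (rule sum_ordered_pairs) (subst comps_2_swap[of \<omega>], subst comps_2_swap[of \<eta>], simp_all)
  finally show ?thesis
    by simp
qed

lemma sigma_1: "sigma 1 \<alpha> \<beta> = (\<Sum>i\<in>UNIV. wedge (hook i \<alpha>) (hook i \<beta>))"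
proof -
  have "(\<Sum>I | card I = 1. wedge (foldr hook (ilist I) \<alpha>) (foldr hook (ilist I) \<beta>))
      = (\<Sum>i\<in>UNIV. wedge (hook i \<alpha>) (hook i \<beta>))"
  proof (rule sum.reindex_bij_witness[of _ "\<lambda>i. {i}" the_elem])
    fix I :: "8 set"
    assume "I \<in> {I. card I = 1}"
    then obtain i where I: "I = {i}"
      by (auto simp: card_1_singleton_iff)
    with ilist_set[of "[i]"] show "wedge (hook (the_elem I) \<alpha>) (hook (the_elem I) \<beta>)
        = wedge (foldr hook (ilist I) \<alpha>) (foldr hook (ilist I) \<beta>)" "{the_elem I} = I"
      by simp_all
  qed simp_all
  then show ?thesis
    by (simp add: sigma_def)
qed

lemma wedge_star_UNIV: "wedge \<alpha> (star \<beta>) $ UNIV = inner \<alpha> \<beta>"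
proof -
  have "wedge \<alpha> (star \<beta>) $ UNIV
      = (\<Sum>I\<in>UNIV. shuffle_sign I (- I) * \<alpha> $ I * (shuffle_sign I (- I) * \<beta> $ I))"
    by (simp add: wedge_def star_nth flip: Compl_eq_Diff_UNIV)
  also have "\<dots> = (\<Sum>I\<in>UNIV. \<alpha> $ I * \<beta> $ I)"
    by (intro sum.cong refl) (metis (no_types, lifting) mult.assoc mult.commute shuffle_sign_square_left)
  finally show ?thesis
    by (simp add: inner_vec_def)
qed

lemma hook_ee_Cons: "hook i (ee (j # js)) = (if i = j then ee js else 0) - ext j (hook i (ee js))"
  by (simp add: ee_def hook_ext)

lemma hook_ee_Nil [simp]: "hook i (ee []) = 0"
  by (simp add: vec_eq_iff hook_nth ee_def axis_def)

lemma ext_ee: "ext i (ee is) = ee (i # is)"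
  by (simp add: ee_def)

lemma ee_Lam: "ee is \<in> Lam (length is)"
proof (induction "is")
  case Nil
  then show ?case
    by (simp add: ee_def Lam_def axis_def)
next
  case (Cons i "is")
  then show ?case
    using ext_Lam by (simp flip: ext_ee)
qed

lemma comps_ee_2: "comps (ee [i, j]) [k, l] = of_bool (i = k \<and> j = l) - of_bool (i = l \<and> j = k)"
proof -
  have "ee [] $ {} = 1"
    by (simp add: ee_def)
  then show ?thesis
    by (auto simp: comps_Cons hook_ee_Cons comps_linear form_linear ext_ee)
qed

lemma ee_2_Lam: "ee [i, j] \<in> Lam 2"
  using ee_Lam[of "[i, j]"] by (simp add: numeral_2_eq_2)

lemma sum_delta_pair:
  fixes c :: "'a::comm_monoid_add" and k l :: 8
  shows "(\<Sum>i\<in>UNIV. \<Sum>j\<in>UNIV. if i = k \<and> j = l then c else 0) = c"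
proof -
  have "(\<Sum>j\<in>UNIV. if i = k \<and> j = l then c else 0) = (if i = k then c else 0)" for i
    by (cases "i = k") simp_all
  then show ?thesis
    by (simp only: sum.delta finite UNIV_I if_True)
qed

lemma wedge_ee_pair: "wedge (ee [i, j]) \<alpha> = ext i (ext j \<alpha>)"
proof -
  have "(\<Sum>k\<in>UNIV. \<Sum>l\<in>UNIV. comps (ee [i, j]) [k, l] *\<^sub>R ext k (ext l \<alpha>))
      = (\<Sum>k\<in>UNIV. \<Sum>l\<in>UNIV. (if k = i \<and> l = j then ext i (ext j \<alpha>) else 0)
         - (if k = j \<and> l = i then ext j (ext i \<alpha>) else 0))"
    by (intro sum.cong refl) (cases "i = j"; force simp: comps_ee_2)
  also have "\<dots> = ext i (ext j \<alpha>) - ext j (ext i \<alpha>)"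
    by (simp only: sum_subtractf sum_delta_pair)
  also have "\<dots> = 2 *\<^sub>R ext i (ext j \<alpha>)"
    by (simp add: ext_ext[of j i] scaleR_2)
  finally show ?thesis
    by (simp add: wedge_2[OF ee_2_Lam])
qed


section \<open>The structure constants\<close>

text \<open>The components of $\rho$ are the structure constants of $\mathfrak{su}(3)$ in an
  orthonormal basis.\<close>

definition fc :: "8 \<Rightarrow> 8 \<Rightarrow> 8 \<Rightarrow> real" where
  "fc i j k = comps rho0 [i, j, k]"

lemma rho0_ee: "rho0 = ee [2, 4, 6] - ee [2, 3, 5] - ee [1, 4, 5] - ee [1, 3, 6]
    + ee [1, 2, 7] + ee [3, 4, 7] - 2 *\<^sub>R ee [5, 6, 7]
    + sqrt 3 *\<^sub>R ee [1, 2, 8] - sqrt 3 *\<^sub>R ee [3, 4, 8]"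
  by (simp add: rho0_def form_linear wedge_ee_pair ext_ee algebra_simps)

lemma hook_rho0:
  "hook 1 rho0 = ee [2, 7] - ee [4, 5] - ee [3, 6] + sqrt 3 *\<^sub>R ee [2, 8]"
  "hook 2 rho0 = ee [4, 6] - ee [3, 5] - ee [1, 7] - sqrt 3 *\<^sub>R ee [1, 8]"
  "hook 3 rho0 = ee [2, 5] + ee [1, 6] + ee [4, 7] - sqrt 3 *\<^sub>R ee [4, 8]"
  "hook 4 rho0 = ee [1, 5] - ee [2, 6] - ee [3, 7] + sqrt 3 *\<^sub>R ee [3, 8]"
  "hook 5 rho0 = - ee [2, 3] - ee [1, 4] - 2 *\<^sub>R ee [6, 7]"
  "hook 6 rho0 = ee [2, 4] - ee [1, 3] + 2 *\<^sub>R ee [5, 7]"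
  "hook 7 rho0 = ee [1, 2] + ee [3, 4] - 2 *\<^sub>R ee [5, 6]"
  "hook 8 rho0 = sqrt 3 *\<^sub>R ee [1, 2] - sqrt 3 *\<^sub>R ee [3, 4]"
  by (simp_all add: rho0_ee form_linear hook_ee_Cons ext_ee algebra_simps)

lemma fc_hook: "fc i j k = comps (hook i rho0) [j, k]"
  by (simp add: fc_def comps_Cons)

definition minor :: "8 \<Rightarrow> 8 \<Rightarrow> 8 \<Rightarrow> 8 \<Rightarrow> real" where
  "minor k l i j = of_bool (k = i) * of_bool (l = j) - of_bool (l = i) * of_bool (k = j)"

lemma comps_ee_minor: "comps (ee [k, l]) [i, j] = minor k l i j"
  by (simp add: minor_def comps_ee_2 of_bool_conj mult.commute)

lemma fc_minor:
  "fc 1 i j = minor 2 7 i j - minor 4 5 i j - minor 3 6 i j + sqrt 3 * minor 2 8 i j"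
  "fc 2 i j = minor 4 6 i j - minor 3 5 i j - minor 1 7 i j - sqrt 3 * minor 1 8 i j"
  "fc 3 i j = minor 2 5 i j + minor 1 6 i j + minor 4 7 i j - sqrt 3 * minor 4 8 i j"
  "fc 4 i j = minor 1 5 i j - minor 2 6 i j - minor 3 7 i j + sqrt 3 * minor 3 8 i j"
  "fc 5 i j = - minor 2 3 i j - minor 1 4 i j - 2 * minor 6 7 i j"
  "fc 6 i j = minor 2 4 i j - minor 1 3 i j + 2 * minor 5 7 i j"
  "fc 7 i j = minor 1 2 i j + minor 3 4 i j - 2 * minor 5 6 i j"
  "fc 8 i j = sqrt 3 * minor 1 2 i j - sqrt 3 * minor 3 4 i j"
  by (simp_all only: fc_hook hook_rho0 comps_linear comps_ee_minor)

lemma sum_minor: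
  "(\<Sum>i\<in>UNIV. \<Sum>j\<in>UNIV. minor k l i j * x i j) = x k l - x l k"
proof -
  have "(\<Sum>i\<in>UNIV. \<Sum>j\<in>UNIV. minor k l i j * x i j)
      = (\<Sum>i\<in>UNIV. \<Sum>j\<in>UNIV. (if i = k \<and> j = l then x k l else 0) - (if i = l \<and> j = k then x l k else 0))"
    by (intro sum.cong refl) (cases "k = l"; force simp: minor_def)
  then show ?thesis
    by (simp only: sum_subtractf sum_delta_pair)
qed

lemma sum_fc:
  fixes x :: "8 \<Rightarrow> 8 \<Rightarrow> real"
  defines "m k l \<equiv> x k l - x l k"
  shows
  "(\<Sum>i\<in>UNIV. \<Sum>j\<in>UNIV. fc 1 i j * x i j) = m 2 7 - m 4 5 - m 3 6 + sqrt 3 * m 2 8"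
  "(\<Sum>i\<in>UNIV. \<Sum>j\<in>UNIV. fc 2 i j * x i j) = m 4 6 - m 3 5 - m 1 7 - sqrt 3 * m 1 8"
  "(\<Sum>i\<in>UNIV. \<Sum>j\<in>UNIV. fc 3 i j * x i j) = m 2 5 + m 1 6 + m 4 7 - sqrt 3 * m 4 8"
  "(\<Sum>i\<in>UNIV. \<Sum>j\<in>UNIV. fc 4 i j * x i j) = m 1 5 - m 2 6 - m 3 7 + sqrt 3 * m 3 8"
  "(\<Sum>i\<in>UNIV. \<Sum>j\<in>UNIV. fc 5 i j * x i j) = - m 2 3 - m 1 4 - 2 * m 6 7"
  "(\<Sum>i\<in>UNIV. \<Sum>j\<in>UNIV. fc 6 i j * x i j) = m 2 4 - m 1 3 + 2 * m 5 7"
  "(\<Sum>i\<in>UNIV. \<Sum>j\<in>UNIV. fc 7 i j * x i j) = m 1 2 + m 3 4 - 2 * m 5 6"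
  "(\<Sum>i\<in>UNIV. \<Sum>j\<in>UNIV. fc 8 i j * x i j) = sqrt 3 * m 1 2 - sqrt 3 * m 3 4"
  unfolding fc_minor distrib_right left_diff_distrib mult_minus_left sum.distrib sum_subtractf
    sum_negf mult.assoc m_def
  by (simp_all add: sum_minor flip: sum_distrib_left)

lemma fc_killing: "(\<Sum>i\<in>UNIV. \<Sum>j\<in>UNIV. fc k i j * fc l i j) = (if k = l then 12 else 0)"
  by (cases k rule: exhaust_8; cases l rule: exhaust_8;
      simp only: sum_fc; simp add: fc_minor minor_def)

lemma fc_swap: "fc i j k = - fc j i k" "fc i j k = - fc i k j"
  using comps_swap[of rho0 "[]" i j "[k]"] comps_swap[of rho0 "[i]" j k "[]"]
  by (simp_all add: fc_def)

lemma fc_rotate: "fc i j k = fc j k i"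
  using fc_swap(1)[of i j k] fc_swap(2)[of j i k] by simp

lemma fc_same [simp]: "fc i i j = 0" "fc i j j = 0"
  using fc_swap(1)[of i i j] fc_swap(2)[of i j j] by simp_all

lemma fc_jacobi:
  "(\<Sum>i\<in>UNIV. fc i a b * fc i c d) + (\<Sum>i\<in>UNIV. fc i b c * fc i a d)
    + (\<Sum>i\<in>UNIV. fc i c a * fc i b d) = 0"
proof -
  define J where "J a b = (\<Sum>i\<in>UNIV. fc i a b * fc i c d) + (\<Sum>i\<in>UNIV. fc b i c * fc a i d)
    - (\<Sum>i\<in>UNIV. fc a i c * fc b i d)" for a b
  have sorted: "J a b = 0" if "pos a < pos b" for a b
    using that
    by (cases a rule: exhaust_8; cases b rule: exhaust_8; simp?;
      simp only: J_def sum_8 fc_minor minor_def; simp add: algebra_simps)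
  have swap: "J a b = - J b a" for a b
    unfolding J_def by (subst fc_swap(2)) (simp add: sum_negf)
  consider "pos a < pos b" | "pos b < pos a" | "a = b"
    using pos_inject[of a b] by linarith
  then have "J a b = 0"
    by cases (use sorted[of a b] sorted[of b a] swap[of a b] in \<open>simp_all add: J_def\<close>)
  moreover have "fc i b c * fc i a d = fc b i c * fc a i d"
    "fc i c a * fc i b d = - (fc a i c * fc b i d)" for i
    using fc_swap(1)[of i b c] fc_swap(1)[of i a d] fc_swap(1)[of i b d] fc_rotate[of a i c]
    by simp_all
  ultimately show ?thesis
    by (simp add: J_def sum_negf)
qed

lemma commutant_scalar:
  fixes A :: "8 \<Rightarrow> 8 \<Rightarrow> real"
  assumes H: "\<And>i j k. (\<Sum>a\<in>UNIV. fc i j a * A a k) = (\<Sum>a\<in>UNIV. A a j * fc i a k)"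
  shows "A i j = (if i = j then A 8 8 else 0)"
proof -
  have off1: "A 6 1 = 0 \<and> A 5 1 = 0 \<and> A 4 1 = 0 \<and> A 3 1 = 0 \<and> A 2 1 = 0 \<and>
     A 6 3 = 0 \<and> A 5 4 = 0 \<and> A 4 5 = 0 \<and> A 3 6 = 0 \<and> A 2 7 = 0 \<and>
     A 2 8 = 0 \<and> A 5 2 = 0 \<and> A 6 2 = 0 \<and> A 3 2 = 0 \<and> A 4 2 = 0 \<and>
     A 1 2 = 0 \<and> A 5 3 = 0 \<and> A 6 4 = 0 \<and> A 3 5 = 0 \<and> A 4 6 = 0 \<and>
     A 1 7 = 0 \<and> A 1 8 = 0 \<and> A 2 3 = 0 \<and> A 1 3 = 0 \<and> A 4 3 = 0 \<and>
     A 2 5 = 0 \<and> A 1 6 = 0 \<and> A 4 7 = 0 \<and> A 4 8 = 0 \<and> A 1 4 = 0 \<and>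
     A 2 4 = 0 \<and> A 3 4 = 0 \<and> A 1 5 = 0 \<and> A 2 6 = 0 \<and> A 3 7 = 0 \<and>
     A 3 8 = 0 \<and> A 7 5 = 0 \<and> A 6 5 = 0 \<and> A 7 6 = 0 \<and> A 7 8 = 0 \<and>
     A 6 7 = 0 \<and> A 6 8 = 0 \<and> A 5 6 = 0 \<and> A 5 7 = 0 \<and> A 5 8 = 0"
    using H[of 1 1 3] H[of 1 1 4] H[of 1 1 5] H[of 1 1 6] H[of 1 1 7] H[of 1 3 3] H[of 1 4 4]
      H[of 1 5 5] H[of 1 6 6] H[of 1 7 7] H[of 1 8 8] H[of 2 2 3] H[of 2 2 4] H[of 2 2 5]
      H[of 2 2 6] H[of 2 2 7] H[of 2 3 3] H[of 2 4 4] H[of 2 5 5] H[of 2 6 6] H[of 2 7 7]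
      H[of 2 8 8] H[of 3 3 5] H[of 3 3 6] H[of 3 3 7] H[of 3 5 5] H[of 3 6 6] H[of 3 7 7]
      H[of 3 8 8] H[of 4 4 5] H[of 4 4 6] H[of 4 4 7] H[of 4 5 5] H[of 4 6 6] H[of 4 7 7]
      H[of 4 8 8] H[of 5 5 6] H[of 5 5 7] H[of 5 6 6] H[of 5 6 8] H[of 5 7 7] H[of 5 7 8]
      H[of 6 6 7] H[of 6 7 7] H[of 6 7 8]
    by (simp add: sum_8 fc_minor minor_def)
  have off2: "A 7 1 = 0 \<and> A 7 2 = 0 \<and> A 7 3 = 0 \<and> A 7 4 = 0 \<and> A 8 3 = 0 \<and>
     A 8 4 = 0 \<and> A 8 5 = 0 \<and> A 8 6 = 0 \<and> A 8 1 = 0 \<and> A 8 2 = 0"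
    using H[of 5 1 6] H[of 5 2 6] H[of 5 3 6] H[of 5 4 6] H[of 1 2 3] H[of 1 2 4] H[of 1 2 5]
      H[of 1 2 6] H[of 3 1 4] H[of 3 2 4]
    by (simp add: sum_8 fc_minor minor_def off1)
  have diag: "A 1 1 = A 8 8 \<and> A 2 2 = A 8 8 \<and> A 3 3 = A 8 8 \<and> A 4 4 = A 8 8 \<and> A 5 5 = A 8 8
      \<and> A 6 6 = A 8 8 \<and> A 7 7 = A 8 8 \<and> A 8 7 = 0"
    using H[of 1 3 6] H[of 1 4 5] H[of 2 3 5] H[of 3 1 6] H[of 3 2 5] H[of 5 6 7] H[of 1 2 8]
      H[of 1 2 7]
    by (simp add: sum_8 fc_minor minor_def off1 off2)
  show ?thesis
    by (cases i rule: exhaust_8; cases j rule: exhaust_8; simp add: off1 off2 diag)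
qed

lemma alternating_3_eq_0:
  fixes t :: "8 \<Rightarrow> 8 \<Rightarrow> 8 \<Rightarrow> real"
  assumes t12: "\<And>i j k. t i j k = - t j i k" and t23: "\<And>i j k. t i j k = - t i k j"
    and H: "\<And>i c. (\<Sum>a\<in>UNIV. \<Sum>b\<in>UNIV. fc i a b * t a b c) = 0"
  shows "t i j k = 0"
proof -
  have same: "t i i k = 0" "t i j j = 0" for i j k
    using t12[of i i k] t23[of i j j] by simp_all
  have sort: "pos j < pos i \<Longrightarrow> t i j k = - t j i k" "pos k < pos j \<Longrightarrow> t i j k = - t i k j" for i j k
    using t12[of i j k] t23[of i j k] by simp_all
  have e1: "t 2 7 c - t 4 5 c - t 3 6 c + sqrt 3 * t 2 8 c = 0"
    and e2: "t 4 6 c - t 3 5 c - t 1 7 c - sqrt 3 * t 1 8 c = 0"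
    and e3: "t 2 5 c + t 1 6 c + t 4 7 c - sqrt 3 * t 4 8 c = 0"
    and e4: "t 1 5 c - t 2 6 c - t 3 7 c + sqrt 3 * t 3 8 c = 0"
    and e5: "t 2 3 c + t 1 4 c + 2 * t 6 7 c = 0"
    and e6: "t 2 4 c - t 1 3 c + 2 * t 5 7 c = 0"
    and e7: "t 1 2 c + t 3 4 c - 2 * t 5 6 c = 0"
    and e8: "t 1 2 c = t 3 4 c" for c
  proof -
    have m: "t a b c - t b a c = 2 * t a b c" for a b
      using t12[of b a c] by simp
    show "t 2 7 c - t 4 5 c - t 3 6 c + sqrt 3 * t 2 8 c = 0"
      using H[of 1 c] unfolding sum_fc m by simp
    show "t 4 6 c - t 3 5 c - t 1 7 c - sqrt 3 * t 1 8 c = 0"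
      using H[of 2 c] unfolding sum_fc m by simp
    show "t 2 5 c + t 1 6 c + t 4 7 c - sqrt 3 * t 4 8 c = 0"
      using H[of 3 c] unfolding sum_fc m by simp
    show "t 1 5 c - t 2 6 c - t 3 7 c + sqrt 3 * t 3 8 c = 0"
      using H[of 4 c] unfolding sum_fc m by simp
    show "t 2 3 c + t 1 4 c + 2 * t 6 7 c = 0"
      using H[of 5 c] unfolding sum_fc m by simp
    show "t 2 4 c - t 1 3 c + 2 * t 5 7 c = 0"
      using H[of 6 c] unfolding sum_fc m by simp
    show "t 1 2 c + t 3 4 c - 2 * t 5 6 c = 0"
      using H[of 7 c] unfolding sum_fc m by simp
    show "t 1 2 c = t 3 4 c"
      using H[of 8 c] unfolding sum_fc m by simp
  qed
  have t1: "t 1 3 4 = 0 \<and> t 2 3 4 = 0 \<and> t 1 2 3 = 0 \<and> t 1 2 4 = 0"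
    using e8[of 1] e8[of 2] e8[of 3] e8[of 4]
    by (simp add: sort same)
  have t2: "t 1 6 7 = 0 \<and> t 2 6 7 = 0 \<and> t 3 6 7 = 0 \<and> t 4 6 7 = 0 \<and>
     t 1 5 7 = 0 \<and> t 2 5 7 = 0 \<and> t 3 5 7 = 0 \<and> t 4 5 7 = 0 \<and>
     t 1 5 6 = 0 \<and> t 2 5 6 = 0 \<and> t 3 5 6 = 0 \<and> t 4 5 6 = 0"
    using e5[of 1] e5[of 2] e5[of 3] e5[of 4] e6[of 1] e6[of 2] e6[of 3] e6[of 4] e7[of 1]
      e7[of 2] e7[of 3] e7[of 4]
    by (simp add: sort same t1)
  have t3: "t 2 5 8 = 0 \<and> t 2 6 8 = 0 \<and> t 2 7 8 = 0 \<and> t 1 5 8 = 0 \<and>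
     t 1 6 8 = 0 \<and> t 1 7 8 = 0 \<and> t 4 5 8 = 0 \<and> t 4 6 8 = 0 \<and>
     t 4 7 8 = 0 \<and> t 3 5 8 = 0 \<and> t 3 6 8 = 0 \<and> t 3 7 8 = 0"
    using e1[of 5] e1[of 6] e1[of 7] e2[of 5] e2[of 6] e2[of 7] e3[of 5] e3[of 6] e3[of 7]
      e4[of 5] e4[of 6] e4[of 7]
    by (
      simp add: sort same t1 t2)
  have t4: "t 1 2 5 = 0" "t 3 4 5 = 0" "t 1 2 6 = 0" "t 3 4 6 = 0"
    using e7[of 5] e8[of 5] e7[of 6] e8[of 6]
    by (simp_all add: sort same t1 t2 t3)
  have t5: "t 2 3 6 = 0" "t 2 4 5 = 0" "t 1 3 5 = 0" "t 1 4 6 = 0"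
    using e1[of 2] e2[of 1] e3[of 4] e5[of 6]
    by (simp_all add: sort same t1 t2 t3 t4, linarith?)
  have t6: "t 1 4 7 = 0" "t 2 3 7 = 0" "t 2 3 8 = 0" "t 1 4 8 = 0"
    using e5[of 7] e1[of 3] e4[of 2] e2[of 4]
    by (simp_all add: sort same t1 t2 t3 t4 t5, linarith?)
  have t7: "t 1 3 7 = 0" "t 2 4 7 = 0" "t 2 4 8 = 0" "t 1 3 8 = 0"
    using e6[of 7] e1[of 4] e3[of 2] e4[of 1]
    by (simp_all add: sort same t1 t2 t3 t4 t5 t6, linarith?)
  have t8: "t 6 7 8 = 0" "t 5 7 8 = 0"
    using e5[of 8] e6[of 8]
    by (simp_all add: sort same t1 t2 t3 t4 t5 t6 t7, linarith?)
  have "t 1 2 7 = t 5 6 7" "t 3 4 7 = t 5 6 7" "t 1 2 8 = t 5 6 8" "t 3 4 8 = t 5 6 8"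
    using e7[of 7] e8[of 7] e7[of 8] e8[of 8] by simp_all
  moreover from this have "t 5 6 7 - t 1 4 5 - t 1 3 6 + sqrt 3 * t 5 6 8 = 0"
      "t 2 4 6 - t 2 3 5 + t 5 6 7 + sqrt 3 * t 5 6 8 = 0"
      "t 5 6 7 - t 2 3 5 - t 1 3 6 - sqrt 3 * t 5 6 8 = 0"
      "t 2 4 6 - t 1 4 5 + t 5 6 7 - sqrt 3 * t 5 6 8 = 0"
      "t 2 3 5 + t 1 4 5 + 2 * t 5 6 7 = 0" "t 2 4 6 - t 1 3 6 - 2 * t 5 6 7 = 0"
    using e1[of 1] e2[of 2] e3[of 3] e4[of 4] e5[of 5] e6[of 6] by (simp_all add: sort same)
  moreover from this have "sqrt 3 * t 5 6 8 = 0" "t 5 6 7 = 0"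
      "t 1 4 5 = 0" "t 2 3 5 = 0" "t 1 3 6 = 0" "t 2 4 6 = 0"
    by - linarith+
  ultimately have t9: "t 1 2 7 = 0" "t 3 4 7 = 0" "t 5 6 7 = 0" "t 1 2 8 = 0" "t 3 4 8 = 0"
    "t 5 6 8 = 0" "t 1 4 5 = 0" "t 2 3 5 = 0" "t 1 3 6 = 0" "t 2 4 6 = 0"
    by simp_all
  show ?thesis
    by (cases i rule: exhaust_8; cases j rule: exhaust_8; cases k rule: exhaust_8;
      simp add: sort same t1 t2 t3 t4 t5 t6 t7 t8 t9)
qed

lemma sum_rotate3:
  fixes h :: "8 \<Rightarrow> 8 \<Rightarrow> 8 \<Rightarrow> 'a::comm_monoid_add"
  shows "(\<Sum>a\<in>UNIV. \<Sum>b\<in>UNIV. \<Sum>c\<in>UNIV. h a b c) = (\<Sum>a\<in>UNIV. \<Sum>b\<in>UNIV. \<Sum>c\<in>UNIV. h b c a)"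
proof -
  have "(\<Sum>b\<in>UNIV. \<Sum>c\<in>UNIV. \<Sum>a\<in>UNIV. h b c a) = (\<Sum>b\<in>UNIV. \<Sum>a\<in>UNIV. \<Sum>c\<in>UNIV. h b c a)"
    by (rule sum.cong[OF refl], rule sum.swap)
  also have "\<dots> = (\<Sum>a\<in>UNIV. \<Sum>b\<in>UNIV. \<Sum>c\<in>UNIV. h b c a)"
    by (rule sum.swap)
  finally show ?thesis .
qed

lemma sum_swap_pairs:
  fixes h :: "8 \<Rightarrow> 8 \<Rightarrow> 8 \<Rightarrow> 8 \<Rightarrow> real"
  shows "(\<Sum>a\<in>UNIV. \<Sum>b\<in>UNIV. \<Sum>c\<in>UNIV. \<Sum>d\<in>UNIV. h a b c d)
    = (\<Sum>c\<in>UNIV. \<Sum>d\<in>UNIV. \<Sum>a\<in>UNIV. \<Sum>b\<in>UNIV. h a b c d)"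
proof -
  have "(\<Sum>a\<in>UNIV. \<Sum>b\<in>UNIV. \<Sum>c\<in>UNIV. \<Sum>d\<in>UNIV. h a b c d)
      = (\<Sum>a\<in>UNIV. \<Sum>c\<in>UNIV. \<Sum>b\<in>UNIV. \<Sum>d\<in>UNIV. h a b c d)"
    by (rule sum.cong[OF refl], rule sum.swap)
  also have "\<dots> = (\<Sum>c\<in>UNIV. \<Sum>a\<in>UNIV. \<Sum>b\<in>UNIV. \<Sum>d\<in>UNIV. h a b c d)"
    by (rule sum.swap)
  also have "\<dots> = (\<Sum>c\<in>UNIV. \<Sum>a\<in>UNIV. \<Sum>d\<in>UNIV. \<Sum>b\<in>UNIV. h a b c d)"
    by (rule sum.cong[OF refl], rule sum.cong[OF refl], rule sum.swap)
  also have "\<dots> = (\<Sum>c\<in>UNIV. \<Sum>d\<in>UNIV. \<Sum>a\<in>UNIV. \<Sum>b\<in>UNIV. h a b c d)"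
    by (rule sum.cong[OF refl], rule sum.swap)
  finally show ?thesis .
qed

lemma fc_sandwich:
  "(\<Sum>b\<in>UNIV. \<Sum>k\<in>UNIV. (\<Sum>a\<in>UNIV. fc b k a * x a) * (\<Sum>a\<in>UNIV. fc b k a * x a))
    = 12 * (\<Sum>a\<in>UNIV. x a * x a)"
proof -
  have "(\<Sum>b\<in>UNIV. \<Sum>k\<in>UNIV. (\<Sum>a\<in>UNIV. fc b k a * x a) * (\<Sum>a\<in>UNIV. fc b k a * x a))
      = (\<Sum>b\<in>UNIV. \<Sum>k\<in>UNIV. \<Sum>a\<in>UNIV. \<Sum>c\<in>UNIV. fc b k a * x a * (fc b k c * x c))"
    by (simp only: sum_product)
  also have "\<dots> = (\<Sum>a\<in>UNIV. \<Sum>c\<in>UNIV. \<Sum>b\<in>UNIV. \<Sum>k\<in>UNIV. fc b k a * x a * (fc b k c * x c))"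
    by (rule sum_swap_pairs)
  also have "\<dots> = (\<Sum>a\<in>UNIV. \<Sum>c\<in>UNIV. x a * x c * (\<Sum>b\<in>UNIV. \<Sum>k\<in>UNIV. fc a b k * fc c b k))"
    unfolding sum_distrib_left
  proof (intro sum.cong refl)
    fix a c b k
    show "fc b k a * x a * (fc b k c * x c) = x a * x c * (fc a b k * fc c b k)"
      using fc_rotate[of a b k] fc_rotate[of c b k] by simp
  qed
  also have "\<dots> = (\<Sum>a\<in>UNIV. \<Sum>c\<in>UNIV. if c = a then x a * x a * 12 else 0)"
    unfolding fc_killing by (intro sum.cong refl) auto
  also have "\<dots> = 12 * (\<Sum>a\<in>UNIV. x a * x a)"
    by (simp add: sum_distrib_left mult.commute)
  finally show ?thesis .
qed

lemma sum_eq_0_imp_eq: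
  fixes X Y :: "8 \<Rightarrow> 8 \<Rightarrow> 8 \<Rightarrow> real"
  assumes "(\<Sum>i\<in>UNIV. \<Sum>j\<in>UNIV. \<Sum>k\<in>UNIV. (X i j k - Y i j k)\<^sup>2) = 0"
  shows "X i j k = Y i j k"
proof -
  have "(\<Sum>j\<in>UNIV. \<Sum>k\<in>UNIV. (X i j k - Y i j k)\<^sup>2) = 0"
    using assms by (subst (asm) sum_nonneg_eq_0_iff) (simp_all add: sum_nonneg)
  then have "(\<Sum>k\<in>UNIV. (X i j k - Y i j k)\<^sup>2) = 0"
    by (subst (asm) sum_nonneg_eq_0_iff) (simp_all add: sum_nonneg)
  then have "(X i j k - Y i j k)\<^sup>2 = 0"
    by (subst (asm) sum_nonneg_eq_0_iff) simp_all
  then show ?thesis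
    by simp
qed

lemma sum_antisym_swap:
  fixes f g :: "8 \<Rightarrow> 8 \<Rightarrow> real"
  assumes "\<And>a b. f a b = - f b a" "\<And>a b. g a b = - h b a"
  shows "(\<Sum>a\<in>UNIV. \<Sum>b\<in>UNIV. f a b * g a b) = (\<Sum>a\<in>UNIV. \<Sum>b\<in>UNIV. f a b * h a b)"
proof -
  have "(\<Sum>a\<in>UNIV. \<Sum>b\<in>UNIV. f a b * g a b) = (\<Sum>a\<in>UNIV. \<Sum>b\<in>UNIV. f b a * h b a)"
    by (intro sum.cong refl) (subst assms(1), subst assms(2), simp)
  also have "\<dots> = (\<Sum>a\<in>UNIV. \<Sum>b\<in>UNIV. f a b * h a b)"
    by (rule sum.swap)
  finally show ?thesis .
qed

text \<open>
  The contraction of the cyclic identity for \<open>B\<close> with the structure constants vanishes by the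
  Jacobi identity, which makes the matrix \<open>A\<close> an eigenvector, for the largest eigenvalue,
  of $A \mapsto \sum_b \mathrm{ad}_b A\, \mathrm{ad}_b^{\top}$.
\<close>

lemma structure_tensor_unique:
  fixes t :: "8 \<Rightarrow> 8 \<Rightarrow> 8 \<Rightarrow> real" and F :: "8 \<Rightarrow> 8 \<Rightarrow> 8 \<Rightarrow> 8 \<Rightarrow> real"
    and A :: "8 \<Rightarrow> 8 \<Rightarrow> real"
  defines "B i a b \<equiv> \<Sum>c\<in>UNIV. \<Sum>d\<in>UNIV. fc i c d * F c d a b"
  assumes t12: "\<And>i j k. t i j k = - t j i k" and t23: "\<And>i j k. t i j k = - t i k j"
    and F12: "\<And>i j k l. F i j k l = - F j i k l" and F23: "\<And>i j k l. F i j k l = - F i k j l"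
    and F34: "\<And>i j k l. F i j k l = - F i j l k"
    and cyc: "\<And>a b c. B a b c + B b c a + B c a b = 0"
    and eq: "\<And>i a b. t i a b + B i a b = 2 * (\<Sum>j\<in>UNIV. A i j * fc j a b)"
    and orth: "(\<Sum>i\<in>UNIV. \<Sum>a\<in>UNIV. \<Sum>b\<in>UNIV. fc i a b * t i a b) = 0"
  shows "t i j k = 0" "F i j k l = 0"
proof -
  define M where "M i a b = (\<Sum>j\<in>UNIV. A i j * fc j a b)" for i a b
  have M_swap: "M i a b = - M i b a" for i a b
    unfolding M_def by (subst fc_swap(2)) (simp add: sum_negf)
  have B_swap: "B i a b = - B i b a" for i a b
    unfolding B_def by (subst F34) (simp add: sum_negf)
  have t_rotate: "t i a b = t a b i" for i a b
    using t12[of i a b] t23[of a i b] by simp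
  have t_eq: "t i a b = 2 / 3 * (M i a b + M a b i + M b i a)" for i a b
    using eq[of i a b] eq[of a b i] eq[of b i a] cyc[of i a b] t_rotate[of i a b] t_rotate[of a b i]
    by (simp add: M_def)
  have fB: "(\<Sum>a\<in>UNIV. \<Sum>b\<in>UNIV. fc k a b * B i a b) = 0" for k i
  proof -
    define g where "g b c d = (\<Sum>a\<in>UNIV. fc a b k * fc a c d)" for b c d
    have g: "g b c d + g c d b + g d b c = 0" for b c d
      using fc_jacobi[of b c d k] unfolding g_def by (simp add: mult.commute)
    have F_rotate: "F b c d i = F c d b i" for b c d
      using F12[of b c d i] F23[of c b d i] by simp
    have S: "(\<Sum>a\<in>UNIV. \<Sum>b\<in>UNIV. fc k a b * B a b i)
        = (\<Sum>b\<in>UNIV. \<Sum>c\<in>UNIV. \<Sum>d\<in>UNIV. g b c d * F b c d i)" (is "?S = _")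
    proof -
      have "?S = (\<Sum>b\<in>UNIV. \<Sum>a\<in>UNIV. \<Sum>c\<in>UNIV. \<Sum>d\<in>UNIV. fc k a b * (fc a c d * F c d b i))"
        unfolding B_def sum_distrib_left by (rule sum.swap)
      also have "\<dots> = (\<Sum>b\<in>UNIV. \<Sum>c\<in>UNIV. \<Sum>a\<in>UNIV. \<Sum>d\<in>UNIV. fc k a b * (fc a c d * F c d b i))"
        by (rule sum.cong[OF refl], rule sum.swap)
      also have "\<dots> = (\<Sum>b\<in>UNIV. \<Sum>c\<in>UNIV. \<Sum>d\<in>UNIV. \<Sum>a\<in>UNIV. fc k a b * (fc a c d * F c d b i))"
        by (rule sum.cong[OF refl], rule sum.cong[OF refl], rule sum.swap)
      also have "\<dots> = (\<Sum>b\<in>UNIV. \<Sum>c\<in>UNIV. \<Sum>d\<in>UNIV. g b c d * F b c d i)"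
        unfolding g_def sum_distrib_right
      proof (intro sum.cong refl)
        fix a b c d
        show "fc k a b * (fc a c d * F c d b i) = fc a b k * fc a c d * F b c d i"
          using F_rotate[of b c d] fc_rotate[of k a b] by simp
      qed
      finally show ?thesis .
    qed
    have "(\<Sum>b\<in>UNIV. \<Sum>c\<in>UNIV. \<Sum>d\<in>UNIV. (g b c d + g c d b + g d b c) * F b c d i) = 0"
      unfolding g by simp
    moreover have "(\<Sum>b\<in>UNIV. \<Sum>c\<in>UNIV. \<Sum>d\<in>UNIV. g c d b * F b c d i) = ?S"
      unfolding S by (subst F_rotate, rule sum_rotate3[symmetric])
    moreover have "(\<Sum>b\<in>UNIV. \<Sum>c\<in>UNIV. \<Sum>d\<in>UNIV. g d b c * F b c d i) = ?S"
      unfolding S by (subst F_rotate[symmetric], rule sum_rotate3)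
    ultimately have "?S = 0"
      unfolding S by (simp add: distrib_right sum.distrib)
    moreover have "(\<Sum>a\<in>UNIV. \<Sum>b\<in>UNIV. fc k a b * B b i a) = ?S"
      by (rule sum_antisym_swap) (rule fc_swap(2) B_swap)+
    moreover have "(\<Sum>a\<in>UNIV. \<Sum>b\<in>UNIV. fc k a b * (B i a b + B a b i + B b i a)) = 0"
      unfolding cyc by simp
    ultimately show ?thesis
      by (simp add: distrib_left sum.distrib)
  qed
  define N where "N i k = (\<Sum>a\<in>UNIV. \<Sum>b\<in>UNIV. fc k a b * M a b i)" for i k
  have fM: "(\<Sum>a\<in>UNIV. \<Sum>b\<in>UNIV. fc k a b * M i a b) = 12 * A i k" for i k
  proof -
    have "(\<Sum>a\<in>UNIV. \<Sum>b\<in>UNIV. fc k a b * M i a b)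
        = (\<Sum>j\<in>UNIV. A i j * (\<Sum>a\<in>UNIV. \<Sum>b\<in>UNIV. fc k a b * fc j a b))"
      unfolding M_def sum_distrib_left
      by (subst sum_rotate3, subst sum_rotate3, intro sum.cong refl) simp
    also have "\<dots> = (\<Sum>j\<in>UNIV. if j = k then 12 * A i k else 0)"
      unfolding fc_killing by (intro sum.cong refl) auto
    finally show ?thesis
      by simp
  qed
  have ft: "(\<Sum>a\<in>UNIV. \<Sum>b\<in>UNIV. fc k a b * t i a b) = 8 * A i k + 4 / 3 * N i k" for i k
  proof -
    have "(\<Sum>a\<in>UNIV. \<Sum>b\<in>UNIV. fc k a b * M b i a) = N i k"
      unfolding N_def by (rule sum_antisym_swap) (rule fc_swap(2) M_swap)+
    moreover have "(\<Sum>a\<in>UNIV. \<Sum>b\<in>UNIV. fc k a b * t i a b)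
        = 2 / 3 * (\<Sum>a\<in>UNIV. \<Sum>b\<in>UNIV. fc k a b * M i a b + fc k a b * M a b i + fc k a b * M b i a)"
      unfolding sum_distrib_left t_eq by (intro sum.cong refl) (simp add: algebra_simps)
    ultimately show ?thesis
      unfolding sum.distrib fM by (simp add: N_def)
  qed
  have N: "N i k = 12 * A i k" for i k
  proof -
    have "(\<Sum>a\<in>UNIV. \<Sum>b\<in>UNIV. fc k a b * (t i a b + B i a b))
        = 2 * (\<Sum>a\<in>UNIV. \<Sum>b\<in>UNIV. fc k a b * M i a b)"
      unfolding eq sum_distrib_left M_def by (intro sum.cong refl) (simp add: algebra_simps)
    then show ?thesis
      unfolding distrib_left sum.distrib fB ft fM by simp
  qed
  define X where "X b k j = (\<Sum>a\<in>UNIV. fc b k a * A a j)" for b k j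
  define Y where "Y b k j = (\<Sum>a\<in>UNIV. A a k * fc b a j)" for b k j
  define S where "S = (\<Sum>k\<in>UNIV. \<Sum>a\<in>UNIV. A a k * A a k)"
  have XX: "(\<Sum>j\<in>UNIV. \<Sum>b\<in>UNIV. \<Sum>k\<in>UNIV. X b k j * X b k j) = 12 * S"
    unfolding X_def S_def fc_sandwich by (rule sum_distrib_left[symmetric])
  have X2: "(\<Sum>b\<in>UNIV. \<Sum>k\<in>UNIV. \<Sum>j\<in>UNIV. X b k j * X b k j) = 12 * S"
    using XX by (subst sum_rotate3)
  have Y: "Y b k j = - X b j k" for b k j
    unfolding X_def Y_def by (subst fc_swap(2)) (simp add: sum_negf mult.commute)
  have Y2: "(\<Sum>b\<in>UNIV. \<Sum>k\<in>UNIV. \<Sum>j\<in>UNIV. Y b k j * Y b k j) = 12 * S"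
    unfolding Y using X2 by (subst sum.swap[of _ UNIV UNIV]) simp
  have XY: "(\<Sum>b\<in>UNIV. \<Sum>k\<in>UNIV. \<Sum>j\<in>UNIV. X b k j * Y b k j) = 12 * S"
  proof -
    have NX: "N c k = (\<Sum>b\<in>UNIV. \<Sum>j\<in>UNIV. X b k j * fc b c j)" for c k
    proof -
      have "N c k = (\<Sum>a\<in>UNIV. \<Sum>b\<in>UNIV. \<Sum>j\<in>UNIV. fc b k a * A a j * fc b c j)"
        unfolding N_def M_def sum_distrib_left
      proof (intro sum.cong refl)
        fix a b j
        show "fc k a b * (A a j * fc j b c) = fc b k a * A a j * fc b c j"
          using fc_rotate[of b k a] fc_rotate[of j b c] by simp
      qed
      also have "\<dots> = (\<Sum>b\<in>UNIV. \<Sum>j\<in>UNIV. \<Sum>a\<in>UNIV. fc b k a * A a j * fc b c j)"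
        by (rule sum_rotate3[symmetric])
      finally show ?thesis
        by (simp add: X_def sum_distrib_right)
    qed
    have "(\<Sum>k\<in>UNIV. \<Sum>b\<in>UNIV. \<Sum>j\<in>UNIV. X b k j * Y b k j) = 12 * S"
      unfolding S_def sum_distrib_left
    proof (rule sum.cong[OF refl])
      fix k
      have "(\<Sum>b\<in>UNIV. \<Sum>j\<in>UNIV. X b k j * Y b k j)
          = (\<Sum>b\<in>UNIV. \<Sum>j\<in>UNIV. \<Sum>c\<in>UNIV. A c k * (X b k j * fc b c j))"
        unfolding Y_def sum_distrib_left by (intro sum.cong refl) simp
      also have "\<dots> = (\<Sum>c\<in>UNIV. A c k * N c k)"
        unfolding NX sum_distrib_left by (rule sum_rotate3)
      finally show "(\<Sum>b\<in>UNIV. \<Sum>j\<in>UNIV. X b k j * Y b k j) = (\<Sum>c\<in>UNIV. 12 * (A c k * A c k))"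
        by (simp add: N mult.left_commute)
    qed
    then show ?thesis
      by (subst sum.swap)
  qed
  have "(\<Sum>b\<in>UNIV. \<Sum>k\<in>UNIV. \<Sum>j\<in>UNIV. (X b k j - Y b k j)\<^sup>2)
      = (\<Sum>b\<in>UNIV. \<Sum>k\<in>UNIV. \<Sum>j\<in>UNIV. X b k j * X b k j)
        - 2 * (\<Sum>b\<in>UNIV. \<Sum>k\<in>UNIV. \<Sum>j\<in>UNIV. X b k j * Y b k j)
        + (\<Sum>b\<in>UNIV. \<Sum>k\<in>UNIV. \<Sum>j\<in>UNIV. Y b k j * Y b k j)"
    unfolding sum_distrib_left sum_subtractf[symmetric] sum.distrib[symmetric]
    by (intro sum.cong refl) (simp add: power2_eq_square algebra_simps)
  also have "\<dots> = 0"
    unfolding X2 Y2 XY by simp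
  finally have "X b k j = Y b k j" for b k j
    by (rule sum_eq_0_imp_eq)
  then have scalar: "A i j = (if i = j then A 8 8 else 0)" for i j
    by (intro commutant_scalar) (simp add: X_def Y_def)
  have "(\<Sum>i\<in>(UNIV :: 8 set). 24 * A 8 8) = 0"
  proof -
    have "(\<Sum>i\<in>UNIV. 8 * A i i + 4 / 3 * (12 * A i i)) = 0"
      using orth unfolding ft N .
    moreover have "8 * A i i + 4 / 3 * (12 * A i i) = 24 * A 8 8" for i
      using scalar[of i i] by simp
    ultimately show ?thesis
      by (simp only:)
  qed
  then have "A i j = 0" for i j
    using scalar[of i j] by simp
  then have M0: "M i a b = 0" for i a b
    by (simp add: M_def)
  then show t0: "t i j k = 0" for i j k
    by (simp add: t_eq)
  then have B0: "B i a b = 0" for i a b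
    using eq[of i a b] M0[of i a b] by (simp add: M_def)
  show "F i j k l = 0"
  proof (rule alternating_3_eq_0[where t = "\<lambda>a b c. F a b c l"])
    show "(\<Sum>a\<in>UNIV. \<Sum>b\<in>UNIV. fc i a b * F a b c l) = 0" for i c
      using B0[of i c l] by (simp add: B_def)
  qed (rule F12 F23)+
qed

lemma shuffle_sign_commute:
  assumes "I \<inter> J = {}"
  shows "shuffle_sign J I = (- 1) ^ (card I * card J) * shuffle_sign I J"
proof -
  have "finite I"
    by simp
  then show ?thesis
    using assms
  proof (induction I)
    case (insert i I)
    then have "i \<notin> J"
      by auto
    then show ?case
      using insert shuffle_sign_insert_left[of i I J] shuffle_sign_insert_right[of i I J]
      by (simp add: shuffle_sign_swap power_add mult_ac)
  qed simp
qed

lemma inner_star_left: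
  assumes "\<beta> \<in> Lam k"
  shows "inner (star \<alpha>) \<beta> = (- 1) ^ (k * (8 - k)) * inner \<alpha> (star \<beta>)"
proof -
  have "inner (star \<alpha>) \<beta> = (\<Sum>K\<in>UNIV. shuffle_sign (- K) K * \<alpha> $ (- K) * \<beta> $ K)"
    by (simp add: inner_vec_def star_nth)
  also have "\<dots> = (\<Sum>K\<in>UNIV. (- 1) ^ (k * (8 - k)) * (\<alpha> $ (- K) * (shuffle_sign K (- K) * \<beta> $ K)))"
  proof (intro sum.cong refl)
    fix K :: "8 set"
    have "card (- K) = 8 - card K"
      by (simp add: Compl_eq_Diff_UNIV card_Diff_subset)
    moreover have "\<beta> $ K = 0 \<or> card K = k"
      using assms by (auto simp: Lam_def)
    ultimately show "shuffle_sign (- K) K * \<alpha> $ (- K) * \<beta> $ K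
        = (- 1) ^ (k * (8 - k)) * (\<alpha> $ (- K) * (shuffle_sign K (- K) * \<beta> $ K))"
      using shuffle_sign_commute[of K "- K"] by auto
  qed
  also have "\<dots> = (- 1) ^ (k * (8 - k)) * (\<Sum>K\<in>UNIV. \<alpha> $ (- K) * (shuffle_sign K (- K) * \<beta> $ K))"
    by (simp add: sum_distrib_left)
  also have "(\<Sum>K\<in>UNIV. \<alpha> $ (- K) * (shuffle_sign K (- K) * \<beta> $ K))
      = (\<Sum>K\<in>UNIV. \<alpha> $ K * (shuffle_sign (- K) K * \<beta> $ (- K)))"
    by (rule sum.reindex_bij_witness[of _ uminus uminus]) auto
  finally show ?thesis
    by (simp add: inner_vec_def star_nth)
qed

lemma ee_single: "ee [i] = axis {i} 1"
  by (simp add: vec_eq_iff ee_def ext_nth) (auto simp: axis_def)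

lemma ext_nth_empty [simp]: "ext i \<alpha> $ {} = 0"
  by (simp add: ext_nth)

lemma inner_ext: "inner (ext i \<alpha>) \<beta> = inner \<alpha> (hook i \<beta>)"
  by (metis inner_commute inner_hook)

lemma inner_contract_2:
  assumes "\<omega> \<in> Lam 2"
  shows "inner \<alpha> (contract 2 \<omega> \<beta>) = inner (wedge \<omega> \<alpha>) \<beta>"
  using assms by (simp add: contract_2 wedge_2 inner_sum_left inner_sum_right inner_ext)

lemma wedge_2_Lam:
  assumes "\<omega> \<in> Lam 2" "\<alpha> \<in> Lam k"
  shows "wedge \<omega> \<alpha> \<in> Lam (Suc (Suc k))"
  unfolding wedge_2[OF assms(1)]
  by (intro subspace_scale subspace_sum subspace_Lam ext_Lam assms(2))

lemma contract_2_Lam: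
  assumes "\<omega> \<in> Lam 2" "\<alpha> \<in> Lam (Suc (Suc k))"
  shows "contract 2 \<omega> \<alpha> \<in> Lam k"
  unfolding contract_2[OF assms(1)]
  by (intro subspace_scale subspace_sum subspace_Lam hook_Lam assms(2))

lemma comps_contract_2:
  assumes "\<omega> \<in> Lam 2"
  shows "comps (contract 2 \<omega> \<alpha>) is
    = 1 / 2 * (\<Sum>i\<in>UNIV. \<Sum>j\<in>UNIV. comps \<omega> [i, j] * comps \<alpha> (i # j # is))"
  by (simp add: contract_2[OF assms] comps_linear comps_Cons)

lemma linear_contract: "linear (contract k \<omega>)"
proof -
  have "linear (foldr hook is)" for "is"
    by (induction "is") (simp_all add: linear_id[unfolded id_def] linear_compose[OF _ linear_hook, unfolded o_def]
        fun_eq_iff linear_hook o_def linear_compose)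
  then have "linear (\<lambda>\<beta>. wedge (foldr hook is \<omega>) (foldr hook is \<beta>))" for "is"
    using linear_compose[OF _ linear_wedge] unfolding o_def by blast
  then show ?thesis
    unfolding sigma_def by (intro linear_compose_sum) auto
qed

lemma rho0_Lam: "rho0 \<in> Lam 3"
proof -
  have "ee [i, j, k] \<in> Lam 3" for i j k
    using ee_Lam[of "[i, j, k]"] by (simp add: numeral_3_eq_3)
  then show ?thesis
    unfolding rho0_ee by (intro subspace_add subspace_diff subspace_scale subspace_Lam)
qed

lemma hook_rho0_Lam: "hook i rho0 \<in> Lam 2"
  using hook_Lam[of rho0 2] rho0_Lam by (simp add: numeral_2_eq_2 numeral_3_eq_3)

lemma fc_outer_same [simp]: "fc i j i = 0"
  using fc_rotate[of i j i] fc_rotate[of j i i] by simp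

lemma comps_hook_rho0: "comps (hook i rho0) [j, k] = fc i j k"
  by (simp add: fc_hook)

lemma sigma_plus_sum: "sigma_plus \<alpha> = (\<Sum>i\<in>UNIV. wedge (hook i rho0) (hook i \<alpha>))"
  unfolding sigma_plus_def by (rule sigma_1)

lemma sigma_plus_Lam: "\<alpha> \<in> Lam (Suc k) \<Longrightarrow> sigma_plus \<alpha> \<in> Lam (Suc (Suc k))"
  unfolding sigma_plus_sum by (intro subspace_sum subspace_Lam wedge_2_Lam hook_rho0_Lam hook_Lam)

lemma inner_hook_rho0: "inner (hook i rho0) (hook j rho0) = (if i = j then 6 else 0)"
  by (simp add: inner_2 hook_rho0_Lam comps_hook_rho0 fc_killing)


section \<open>The differential\<close>

text \<open>
  \<open>sigma_plus\<close> is the Chevalley--Eilenberg differential of $\mathfrak{su}(3)$, so its square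
  vanishes; the operator \<open>delta\<close> below is its adjoint.
\<close>

lemma sum_cyclic_eq_0:
  fixes e :: "8 \<Rightarrow> 8 \<Rightarrow> 8 \<Rightarrow> 'a::real_vector"
  assumes g: "\<And>a b c. g a b c + g b c a + g c a b = 0" and e: "\<And>a b c. e a b c = e b c a"
  shows "(\<Sum>a\<in>UNIV. \<Sum>b\<in>UNIV. \<Sum>c\<in>UNIV. g a b c *\<^sub>R e a b c) = 0"
proof -
  define S where "S = (\<Sum>a\<in>UNIV. \<Sum>b\<in>UNIV. \<Sum>c\<in>UNIV. g a b c *\<^sub>R e a b c)"
  have 1: "S = (\<Sum>a\<in>UNIV. \<Sum>b\<in>UNIV. \<Sum>c\<in>UNIV. g b c a *\<^sub>R e a b c)"
    unfolding S_def by (subst (2) e, rule sum_rotate3)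
  also have "\<dots> = (\<Sum>a\<in>UNIV. \<Sum>b\<in>UNIV. \<Sum>c\<in>UNIV. g c a b *\<^sub>R e a b c)"
    by (subst (2) e, rule sum_rotate3)
  finally have 2: "S = (\<Sum>a\<in>UNIV. \<Sum>b\<in>UNIV. \<Sum>c\<in>UNIV. g c a b *\<^sub>R e a b c)" .
  have "(\<Sum>a\<in>UNIV. \<Sum>b\<in>UNIV. \<Sum>c\<in>UNIV. (g a b c + g b c a + g c a b) *\<^sub>R e a b c) = S + S + S"
    unfolding scaleR_add_left sum.distrib by (simp only: S_def[symmetric] 1[symmetric] 2[symmetric])
  then have "(1 + 1 + 1) *\<^sub>R S = 0"
    unfolding g scaleR_add_left by simp
  then show ?thesis
    by (simp add: S_def)
qed

lemma sigma_plus_sigma_plus: "sigma_plus (sigma_plus \<alpha>) = 0"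
proof -
  define E where "E k = wedge (hook k rho0)" for k
  have E: "E k \<beta> = (1 / 2) *\<^sub>R (\<Sum>c\<in>UNIV. \<Sum>d\<in>UNIV. fc k c d *\<^sub>R ext c (ext d \<beta>))" for k \<beta>
    unfolding E_def by (simp add: wedge_2[OF hook_rho0_Lam] comps_hook_rho0)
  have E_linear: "linear (E k)" for k
    unfolding E_def by (rule linear_wedge)
  have E_ext: "E k (ext a \<beta>) = ext a (E k \<beta>)" for k a \<beta>
  proof -
    have "ext c (ext d (ext a \<beta>)) = ext a (ext c (ext d \<beta>))" for c d
      using ext_ext[of d a] ext_ext[of c a] by (simp add: form_linear)
    then show ?thesis
      by (simp add: E form_linear)
  qed
  have E_E: "E k (E j \<beta>) = E j (E k \<beta>)" for k j \<beta>
    by (subst (2 3) E) (simp add: linear_sum[OF E_linear] linear_cmul[OF E_linear] E_ext)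
  have hook_E: "hook i (E k \<beta>) = (\<Sum>b\<in>UNIV. fc k i b *\<^sub>R ext b \<beta>) + E k (hook i \<beta>)" for i k \<beta>
  proof -
    have "hook i (ext c (ext d \<beta>)) = (if c = i then ext d \<beta> else 0) - (if d = i then ext c \<beta> else 0)
        + ext c (ext d (hook i \<beta>))" for c d
      by (simp add: hook_ext form_linear)
    then have "hook i (E k \<beta>) = (1 / 2) *\<^sub>R (\<Sum>c\<in>UNIV. \<Sum>d\<in>UNIV.
        fc k c d *\<^sub>R (if c = i then ext d \<beta> else 0) - fc k c d *\<^sub>R (if d = i then ext c \<beta> else 0)
        + fc k c d *\<^sub>R ext c (ext d (hook i \<beta>)))"
      by (simp add: E form_linear scaleR_add_right scaleR_diff_right)
    also have "\<dots> = (1 / 2) *\<^sub>R ((\<Sum>d\<in>UNIV. fc k i d *\<^sub>R ext d \<beta>)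
        - (\<Sum>c\<in>UNIV. fc k c i *\<^sub>R ext c \<beta>)) + E k (hook i \<beta>)"
    proof -
      have delta1: "(\<Sum>c\<in>UNIV. fc k c d *\<^sub>R (if c = i then ext d \<beta> else 0)) = fc k i d *\<^sub>R ext d \<beta>"
        and delta2: "(\<Sum>c\<in>UNIV. fc k d c *\<^sub>R (if c = i then ext d \<beta> else 0)) = fc k d i *\<^sub>R ext d \<beta>" for d
        by (simp_all add: if_distrib[of "\<lambda>x. _ *\<^sub>R x"] cong: if_cong)
      show ?thesis
        unfolding sum.distrib sum_subtractf scaleR_add_right E delta2
        by (subst sum.swap) (simp add: delta1)
    qed
    also have "\<dots> = (1 / 2) *\<^sub>R ((\<Sum>d\<in>UNIV. fc k i d *\<^sub>R ext d \<beta>)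
        - (\<Sum>c\<in>UNIV. - (fc k i c *\<^sub>R ext c \<beta>))) + E k (hook i \<beta>)"
      using fc_swap(2)[of k _ i] by simp
    also have "\<dots> = (\<Sum>b\<in>UNIV. fc k i b *\<^sub>R ext b \<beta>) + E k (hook i \<beta>)"
      by (simp add: sum_negf flip: scaleR_2)
    finally show ?thesis .
  qed
  have Z: "(\<Sum>k\<in>UNIV. \<Sum>b\<in>UNIV. fc j k b *\<^sub>R E k (ext b \<beta>)) = 0" for j \<beta>
  proof -
    define G where "G b c d = (\<Sum>k\<in>UNIV. fc k c d * fc k b j)" for b c d
    define e where "e b c d = ext c (ext d (ext b \<beta>))" for b c d
    have "(\<Sum>k\<in>UNIV. \<Sum>b\<in>UNIV. fc j k b *\<^sub>R E k (ext b \<beta>))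
        = (1 / 2) *\<^sub>R (\<Sum>k\<in>UNIV. \<Sum>b\<in>UNIV. \<Sum>c\<in>UNIV. \<Sum>d\<in>UNIV. (fc j k b * fc k c d) *\<^sub>R e b c d)"
      by (simp add: E e_def scaleR_sum_right)
    also have "(\<Sum>k\<in>UNIV. \<Sum>b\<in>UNIV. \<Sum>c\<in>UNIV. \<Sum>d\<in>UNIV. (fc j k b * fc k c d) *\<^sub>R e b c d)
        = (\<Sum>b\<in>UNIV. \<Sum>k\<in>UNIV. \<Sum>c\<in>UNIV. \<Sum>d\<in>UNIV. (fc j k b * fc k c d) *\<^sub>R e b c d)"
      by (rule sum.swap)
    also have "\<dots> = (\<Sum>b\<in>UNIV. \<Sum>c\<in>UNIV. \<Sum>d\<in>UNIV. \<Sum>k\<in>UNIV. (fc j k b * fc k c d) *\<^sub>R e b c d)"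
      by (rule sum.cong[OF refl], rule sum_rotate3[symmetric])
    also have "\<dots> = (\<Sum>b\<in>UNIV. \<Sum>c\<in>UNIV. \<Sum>d\<in>UNIV. G b c d *\<^sub>R e b c d)"
      unfolding G_def scaleR_sum_left
    proof (intro sum.cong refl)
      fix b c d k
      show "(fc j k b * fc k c d) *\<^sub>R e b c d = (fc k c d * fc k b j) *\<^sub>R e b c d"
        using fc_rotate[of j k b] by simp
    qed
    also have "\<dots> = 0"
    proof (rule sum_cyclic_eq_0)
      show "G b c d + G c d b + G d b c = 0" for b c d
        using fc_jacobi[of b c d j] unfolding G_def by (simp add: mult.commute)
      show "e b c d = e c d b" for b c d
        unfolding e_def using ext_ext[of c d "ext b \<beta>"] ext_ext[of c b \<beta>] by (simp add: form_linear)
    qed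
    finally show ?thesis
      by simp
  qed
  have "sigma_plus (sigma_plus \<alpha>) = (\<Sum>k\<in>UNIV. \<Sum>j\<in>UNIV. E k (hook k (E j (hook j \<alpha>))))"
    by (simp add: sigma_plus_sum E_def form_linear)
  also have "\<dots> = (\<Sum>k\<in>UNIV. \<Sum>j\<in>UNIV. \<Sum>b\<in>UNIV. fc j k b *\<^sub>R E k (ext b (hook j \<alpha>)))
      + (\<Sum>k\<in>UNIV. \<Sum>j\<in>UNIV. E k (E j (hook k (hook j \<alpha>))))"
    by (simp add: hook_E linear_add[OF E_linear] linear_sum[OF E_linear] linear_cmul[OF E_linear] sum.distrib)
  also have "(\<Sum>k\<in>UNIV. \<Sum>j\<in>UNIV. \<Sum>b\<in>UNIV. fc j k b *\<^sub>R E k (ext b (hook j \<alpha>))) = 0"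
    by (subst sum.swap) (simp add: Z)
  also have "(\<Sum>k\<in>UNIV. \<Sum>j\<in>UNIV. E k (E j (hook k (hook j \<alpha>)))) = 0" (is "?S = 0")
  proof -
    have "?S = (\<Sum>k\<in>UNIV. \<Sum>j\<in>UNIV. E j (E k (hook j (hook k \<alpha>))))"
      by (rule sum.swap)
    also have "\<dots> = - ?S"
      unfolding sum_negf[symmetric]
      by (intro sum.cong refl, subst E_E, subst hook_hook) (simp add: linear_neg[OF E_linear])
    finally have "2 *\<^sub>R ?S = 0"
      unfolding scaleR_2 eq_neg_iff_add_eq_0 .
    then show ?thesis
      by (simp only: scaleR_eq_0_iff) simp
  qed
  finally show ?thesis
    by simp
qed

definition delta :: "form \<Rightarrow> form" where
  "delta \<alpha> = (\<Sum>i\<in>UNIV. ext i (contract 2 (hook i rho0) \<alpha>))"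

lemma linear_delta: "linear delta"
  unfolding delta_def
  by (intro linear_compose_sum ballI linear_compose[OF linear_contract linear_wedge, unfolded o_def])

lemma delta_star:
  assumes "\<alpha> \<in> Lam 4"
  shows "delta (star \<alpha>) = - star (sigma_plus \<alpha>)"
proof -
  have "ext i (hook b (hook a (star \<alpha>))) = star (hook i (ext b (ext a \<alpha>)))" for i a b
  proof -
    have "\<alpha> \<in> Lam (Suc 3)" and 5: "ext a \<alpha> \<in> Lam 5" and 6: "ext b (ext a \<alpha>) \<in> Lam (Suc 5)"
      using assms ext_Lam[of \<alpha> 4 a] ext_Lam[of "ext a \<alpha>" 5 b] by (simp_all add: eval_nat_numeral)
    then show ?thesis
      using hook_star[OF assms, of a] hook_star[OF 5, of b] ext_star[OF 6, of i]
      by (simp add: form_linear)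
  qed
  then have "delta (star \<alpha>) = star ((1 / 2) *\<^sub>R (\<Sum>i\<in>UNIV. \<Sum>a\<in>UNIV. \<Sum>b\<in>UNIV.
      fc i a b *\<^sub>R hook i (ext b (ext a \<alpha>))))"
    by (simp add: delta_def contract_2 hook_rho0_Lam comps_hook_rho0 form_linear scaleR_sum_right)
  also have "(\<Sum>i\<in>UNIV. \<Sum>a\<in>UNIV. \<Sum>b\<in>UNIV. fc i a b *\<^sub>R hook i (ext b (ext a \<alpha>)))
      = - (\<Sum>i\<in>UNIV. \<Sum>a\<in>UNIV. \<Sum>b\<in>UNIV. fc i a b *\<^sub>R ext a (ext b (hook i \<alpha>)))"
    unfolding sum_negf[symmetric]
  proof (intro sum.cong refl)
    fix i a b
    show "fc i a b *\<^sub>R hook i (ext b (ext a \<alpha>)) = - (fc i a b *\<^sub>R ext a (ext b (hook i \<alpha>)))"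
      using ext_ext[of a b "hook i \<alpha>"]
      by (cases "fc i a b = 0") (auto simp: hook_ext form_linear)
  qed
  finally show ?thesis
    by (simp add: sigma_plus_sum wedge_2 hook_rho0_Lam comps_hook_rho0 form_linear scaleR_sum_right)
qed


section \<open>The projection onto m and the torsion modules\<close>

lemma inner_hook_rho0_Lam_2: "\<omega> \<in> Lam 2 \<Longrightarrow> inner (hook i rho0) \<omega>
    = 1 / 2 * (\<Sum>a\<in>UNIV. \<Sum>b\<in>UNIV. fc i a b * comps \<omega> [a, b])"
  by (simp add: inner_2 hook_rho0_Lam comps_hook_rho0)

lemma Lam2_20_iff: "\<omega> \<in> Lam2_20 \<longleftrightarrow> \<omega> \<in> Lam 2 \<and> (\<forall>i. inner (hook i rho0) \<omega> = 0)"
proof (cases "\<omega> \<in> Lam 2")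
  case True
  have "ext a (ext b (star rho0)) = star (hook b (hook a rho0))" for a b
  proof -
    have "rho0 \<in> Lam (Suc 2)" "hook b rho0 \<in> Lam (Suc 1)"
      using rho0_Lam hook_rho0_Lam[of b] by (simp_all add: eval_nat_numeral)
    then show ?thesis
      using hook_hook[of a b rho0] ext_star[of rho0 2 b] ext_star[of "hook b rho0" 1 a]
      by (simp add: form_linear)
  qed
  then have "wedge \<omega> (star rho0) = star (contract 2 \<omega> rho0)"
    using True by (simp add: wedge_2 contract_2 form_linear)
  then have "\<omega> \<in> Lam2_20 \<longleftrightarrow> contract 2 \<omega> rho0 = 0"
    using True by (simp add: Lam2_20_def)
  also have "\<dots> \<longleftrightarrow> (\<forall>i. comps (contract 2 \<omega> rho0) [i] = 0)"
  proof
    assume *: "\<forall>i. comps (contract 2 \<omega> rho0) [i] = 0"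
    have "contract 2 \<omega> rho0 \<in> Lam 1"
      using contract_2_Lam[of \<omega> rho0 1] True rho0_Lam by (simp add: eval_nat_numeral)
    then show "contract 2 \<omega> rho0 = 0"
      using * by (intro form_eqI[of _ 1]) (auto simp: subspace_0 subspace_Lam length_Suc_conv comps_linear)
  qed (simp add: comps_linear)
  also have "\<dots> \<longleftrightarrow> (\<forall>i. inner (hook i rho0) \<omega> = 0)"
  proof -
    have "comps (contract 2 \<omega> rho0) [i] = inner (hook i rho0) \<omega>" for i
      unfolding comps_contract_2[OF True] inner_hook_rho0_Lam_2[OF True] fc_def[symmetric]
      by (simp add: fc_rotate[of i] mult.commute)
    then show ?thesis
      by simp
  qed
  finally show ?thesis
    using True by simp
qed (simp add: Lam2_20_def)

lemma subspace_Lam2_20: "subspace Lam2_20"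
  using subspace_Lam[of 2] by (auto simp: subspace_def Lam2_20_iff inner_add_right)

lemma pr_m_eq:
  assumes "\<omega> \<in> Lam 2"
  shows "pr_m \<omega> = \<omega> - (1 / 6) *\<^sub>R (\<Sum>i\<in>UNIV. inner (hook i rho0) \<omega> *\<^sub>R hook i rho0)" (is "_ = ?P")
  unfolding pr_m_def
proof (rule the_equality)
  have "?P \<in> Lam 2"
    by (intro subspace_diff subspace_scale subspace_sum subspace_Lam hook_rho0_Lam assms)
  moreover have "inner (hook i rho0) ?P = 0" for i
  proof -
    have "(\<Sum>j\<in>UNIV. inner (hook j rho0) \<omega> * inner (hook i rho0) (hook j rho0))
        = (\<Sum>j\<in>UNIV. if j = i then 6 * inner (hook i rho0) \<omega> else 0)"
      by (intro sum.cong refl) (auto simp: inner_hook_rho0)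
    then show ?thesis
      by (simp add: inner_diff_right inner_sum_right)
  qed
  ultimately have P: "?P \<in> Lam2_20"
    by (simp add: Lam2_20_iff)
  have orth: "orthogonal (\<omega> - ?P) \<zeta>" if "\<zeta> \<in> Lam2_20" for \<zeta>
    using that by (simp add: orthogonal_def inner_sum_left Lam2_20_iff)
  show "?P \<in> Lam2_20 \<and> (\<forall>\<zeta>\<in>Lam2_20. orthogonal (\<omega> - ?P) \<zeta>)"
    using P orth by blast
  fix \<eta>
  assume \<eta>: "\<eta> \<in> Lam2_20 \<and> (\<forall>\<zeta>\<in>Lam2_20. orthogonal (\<omega> - \<eta>) \<zeta>)"
  obtain \<eta>' where \<eta>': "?P = \<eta>'"
    by blast
  have "\<eta> - \<eta>' \<in> Lam2_20"
    using \<eta> P unfolding \<eta>' by (intro subspace_diff subspace_Lam2_20) auto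
  with \<eta> orth have "inner (\<omega> - \<eta>) (\<eta> - \<eta>') = 0" "inner (\<omega> - \<eta>') (\<eta> - \<eta>') = 0"
    unfolding \<eta>' orthogonal_def by blast+
  then have "inner (\<eta> - \<eta>') (\<eta> - \<eta>') = 0"
    unfolding inner_diff_left by simp
  then show "\<eta> = ?P"
    unfolding \<eta>' by simp
qed

lemma pr_m_add: "\<omega> \<in> Lam 2 \<Longrightarrow> \<eta> \<in> Lam 2 \<Longrightarrow> pr_m (\<omega> + \<eta>) = pr_m \<omega> + pr_m \<eta>"
  by (simp add: pr_m_eq subspace_add subspace_Lam inner_add_right scaleR_add_left sum.distrib
      scaleR_add_right)

lemma pr_m_scale: "\<omega> \<in> Lam 2 \<Longrightarrow> pr_m (c *\<^sub>R \<omega>) = c *\<^sub>R pr_m \<omega>"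
  by (simp add: pr_m_eq subspace_scale subspace_Lam scaleR_diff_right scaleR_sum_right mult_ac)

lemma pr_m_diff: "\<omega> \<in> Lam 2 \<Longrightarrow> \<eta> \<in> Lam 2 \<Longrightarrow> pr_m (\<omega> - \<eta>) = pr_m \<omega> - pr_m \<eta>"
  using pr_m_add[of \<omega> "(- 1) *\<^sub>R \<eta>"] pr_m_scale[of \<eta> "- 1"]
  by (simp add: subspace_scale[OF subspace_Lam, of _ 2 "- 1", simplified])

lemma inner_pr_m:
  assumes "\<omega> \<in> Lam 2" "\<zeta> \<in> Lam2_20"
  shows "inner \<zeta> (pr_m \<omega>) = inner \<zeta> \<omega>"
  using assms by (simp add: pr_m_eq inner_diff_right inner_sum_right Lam2_20_iff inner_commute[of \<zeta>])

lemma pr_m_Lam2_20: "\<omega> \<in> Lam 2 \<Longrightarrow> pr_m \<omega> \<in> Lam2_20"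
proof -
  assume \<omega>: "\<omega> \<in> Lam 2"
  have "(\<Sum>j\<in>UNIV. inner (hook j rho0) \<omega> * inner (hook i rho0) (hook j rho0))
      = (\<Sum>j\<in>UNIV. if j = i then 6 * inner (hook i rho0) \<omega> else 0)" for i
    by (intro sum.cong refl) (auto simp: inner_hook_rho0)
  moreover have "pr_m \<omega> \<in> Lam 2"
    unfolding pr_m_eq[OF \<omega>]
    by (intro subspace_diff subspace_scale subspace_sum subspace_Lam hook_rho0_Lam \<omega>)
  ultimately show ?thesis
    by (simp add: Lam2_20_iff pr_m_eq \<omega> inner_diff_right inner_sum_right)
qed

definition torsion_3 :: "form set" where
  "torsion_3 = {T \<in> Lam 3. inner T rho0 = 0}"

definition torsion_4 :: "form set" where
  "torsion_4 = {F \<in> Lam 4. delta F = 0}"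

lemma subspace_torsion_3: "subspace torsion_3"
  using subspace_Lam[of 3] by (auto simp: subspace_def torsion_3_def inner_add_left)

lemma subspace_torsion_4: "subspace torsion_4"
  using subspace_Lam[of 4]
  by (auto simp: subspace_def torsion_4_def linear_add[OF linear_delta] linear_cmul[OF linear_delta]
      linear_0[OF linear_delta])

lemma Lam2_8_Lam: "\<omega> \<in> Lam2_8 \<Longrightarrow> \<omega> \<in> Lam 2"
  using sigma_plus_Lam[of _ 0] by (auto simp: Lam2_8_def eval_nat_numeral)

lemma Lam3_8_torsion: "Lam3_8 \<subseteq> torsion_3"
proof
  fix T
  assume "T \<in> Lam3_8"
  then obtain \<omega> where \<omega>: "\<omega> \<in> Lam 2" and T: "T = star (wedge \<omega> rho0)"
    using Lam2_8_Lam by (auto simp: Lam3_8_def)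
  have "wedge \<omega> rho0 \<in> Lam 5"
    using wedge_2_Lam[OF \<omega> rho0_Lam] by (simp add: eval_nat_numeral)
  then have "T \<in> Lam 3"
    unfolding T by (rule star_Lam) simp
  moreover have "inner T rho0 = 0"
  proof -
    have "inner (star (ext a (ext b rho0))) rho0 = inner (star rho0) (ext a (ext b rho0))" for a b
    proof -
      have "ext b rho0 \<in> Lam 4"
        using ext_Lam[OF rho0_Lam] by (simp add: eval_nat_numeral)
      then have "star (ext a (ext b rho0)) = - hook a (hook b (star rho0))"
        using hook_star[of "ext b rho0" 4 a] hook_star[OF rho0_Lam, of b] by (simp add: form_linear)
      then show ?thesis
        using ext_ext[of b a rho0] by (simp add: inner_hook)
    qed
    then have "inner T rho0 = inner (star rho0) (wedge \<omega> rho0)"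
      unfolding T wedge_2[OF \<omega>] by (simp add: form_linear inner_sum_left inner_sum_right)
    moreover have "inner T rho0 = - inner (wedge \<omega> rho0) (star rho0)"
      unfolding T inner_star_left[OF rho0_Lam] by simp
    ultimately show ?thesis
      by (simp add: inner_commute)
  qed
  ultimately show "T \<in> torsion_3"
    by (simp add: torsion_3_def)
qed

lemma contract_hook_rho0: "contract 2 (hook i rho0) rho0 = 6 *\<^sub>R ee [i]"
proof (rule form_eqI[of _ 1])
  show "contract 2 (hook i rho0) rho0 \<in> Lam 1"
    using contract_2_Lam[OF hook_rho0_Lam, of rho0 1] rho0_Lam by (simp add: eval_nat_numeral)
  show "6 *\<^sub>R ee [i] \<in> Lam 1"
    using ee_Lam[of "[i]"] by (intro subspace_scale subspace_Lam) simp
  fix js :: "8 list"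
  assume "length js = 1"
  then obtain j where "js = [j]"
    by (auto simp: length_Suc_conv)
  moreover have "comps (contract 2 (hook i rho0) rho0) [j]
      = 1 / 2 * (\<Sum>a\<in>UNIV. \<Sum>b\<in>UNIV. fc i a b * fc j a b)"
    unfolding comps_contract_2[OF hook_rho0_Lam] comps_hook_rho0 fc_def[symmetric]
    by (simp add: fc_rotate[of j])
  moreover have "comps (6 *\<^sub>R ee [i]) [j] = (if i = j then 6 else 0)"
    by (auto simp: comps_linear comps_Cons ee_single hook_nth axis_def)
  ultimately show "comps (contract 2 (hook i rho0) rho0) js = comps (6 *\<^sub>R ee [i]) js"
    unfolding fc_killing by (cases "i = j") simp_all
qed

lemma Lam3_20_torsion: "Lam3_20 \<subseteq> torsion_3"
proof
  fix T
  assume "T \<in> Lam3_20"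
  then obtain \<omega> where \<omega>: "\<omega> \<in> Lam 2" and T: "T = sigma_plus \<omega>"
    by (auto simp: Lam3_20_def Lam2_20_def)
  have "T \<in> Lam 3"
    using sigma_plus_Lam[of \<omega> 1] \<omega> unfolding T by (simp add: eval_nat_numeral)
  moreover have "inner T rho0 = 0"
    unfolding T sigma_plus_sum inner_sum_left inner_contract_2[OF hook_rho0_Lam, symmetric]
      contract_hook_rho0
    by (simp add: inner_hook ee_def)
  ultimately show "T \<in> torsion_3"
    by (simp add: torsion_3_def)
qed

lemma Lam3_27_torsion: "Lam3_27 \<subseteq> torsion_3"
proof
  fix T
  assume "T \<in> Lam3_27"
  with wedge_star_UNIV[of T rho0] show "T \<in> torsion_3"
    by (simp add: Lam3_27_def torsion_3_def)
qed

lemma star_sigma_plus_torsion: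
  assumes "S \<in> torsion_3"
  shows "star (sigma_plus S) \<in> torsion_4"
proof -
  have "sigma_plus S \<in> Lam 4"
    using sigma_plus_Lam[of S 2] assms by (simp add: torsion_3_def eval_nat_numeral)
  then show ?thesis
    by (simp add: torsion_4_def delta_star sigma_plus_sigma_plus form_linear star_Lam)
qed

lemma Lam3_sum_torsion: "Lam3_8 + Lam3_20 + Lam3_27 \<subseteq> torsion_3"
  using Lam3_8_torsion Lam3_20_torsion Lam3_27_torsion
  by (auto elim!: set_plus_elim intro!: subspace_add[OF subspace_torsion_3])

lemma Lam4_sum_torsion: "star ` Lam4_8 + star ` Lam4_27 \<subseteq> torsion_4"
  using Lam3_8_torsion Lam3_27_torsion
  by (auto elim!: set_plus_elim simp: Lam4_8_def Lam4_27_def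
      intro!: subspace_add[OF subspace_torsion_4] star_sigma_plus_torsion)

lemma hook_Lam_2: "T \<in> Lam 3 \<Longrightarrow> hook i T \<in> Lam 2"
  using hook_Lam[of T 2 i] by (simp add: eval_nat_numeral)

lemma contract_Lam_2: "F \<in> Lam 4 \<Longrightarrow> contract 2 (hook i rho0) F \<in> Lam 2"
  using contract_2_Lam[OF hook_rho0_Lam, of F 2 i] by (simp add: eval_nat_numeral)

lemma Theta1_diff: "T \<in> Lam 3 \<Longrightarrow> T' \<in> Lam 3 \<Longrightarrow> Theta1 (T - T') = Theta1 T - Theta1 T'"
  by (simp add: Theta1_def vec_eq_iff form_linear pr_m_diff hook_Lam_2 algebra_simps)

lemma Theta2_diff: "F \<in> Lam 4 \<Longrightarrow> F' \<in> Lam 4 \<Longrightarrow> Theta2 (F - F') = Theta2 F - Theta2 F'"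
  by (simp add: Theta2_def vec_eq_iff linear_diff[OF linear_contract] pr_m_diff contract_Lam_2)

lemma Theta1_add: "T \<in> Lam 3 \<Longrightarrow> T' \<in> Lam 3 \<Longrightarrow> Theta1 (T + T') = Theta1 T + Theta1 T'"
  by (simp add: Theta1_def vec_eq_iff form_linear pr_m_add hook_Lam_2 algebra_simps)

lemma Theta2_add: "F \<in> Lam 4 \<Longrightarrow> F' \<in> Lam 4 \<Longrightarrow> Theta2 (F + F') = Theta2 F + Theta2 F'"
  by (simp add: Theta2_def vec_eq_iff linear_add[OF linear_contract] pr_m_add contract_Lam_2)

text \<open>Up to scalars, \<open>Theta1\<close> and \<open>Theta2\<close> are the adjoints of \<open>Phi1\<close> and \<open>Phi2\<close>.\<close>

lemma inner_W6_Theta1: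
  assumes "G \<in> W6" "T \<in> Lam 3"
  shows "inner G (Theta1 T) = 0"
proof -
  have "inner (G $ i) (Theta1 T $ i) = - (1 / 2) * inner (ext i (G $ i)) T" for i
    using assms by (simp add: Theta1_def W6_def tensor_m_def inner_pr_m hook_Lam_2 inner_ext)
  then have "inner G (Theta1 T) = - (1 / 2) * inner (Phi1 G) T"
    by (simp add: inner_vec_def[of G] Phi1_def ee_single inner_sum_left sum_distrib_left sum_negf
        sum_divide_distrib)
  then show ?thesis
    using assms by (simp add: W6_def)
qed

lemma inner_W6_Theta2:
  assumes "G \<in> W6" "F \<in> Lam 4"
  shows "inner G (Theta2 F) = 0"
proof -
  have "inner (G $ i) (Theta2 F $ i) = - inner (wedge (hook i rho0) (G $ i)) F" for i
    using assms
    by (simp add: Theta2_def W6_def tensor_m_def inner_pr_m contract_Lam_2 inner_contract_2 hook_rho0_Lam)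
  then have "inner G (Theta2 F) = - inner (Phi2 G) F"
    by (simp add: inner_vec_def[of G] Phi2_def inner_sum_left sum_negf)
  then show ?thesis
    using assms by (simp add: W6_def)
qed

lemma comps_ext_2:
  assumes "X \<in> Lam 2"
  shows "comps (ext i X) [a, b, c] = (if a = i then comps X [b, c] else 0)
    - (if b = i then comps X [a, c] else 0) + (if c = i then comps X [a, b] else 0)"
  by (simp add: comps_Cons hook_ext form_linear if_distrib[of "hook _"] if_distrib[of "\<lambda>X. X $ {}"]
      cong: if_cong)

lemma comps_contract_rho0:
  "comps (contract 2 (hook i rho0) F) [a, b]
    = 1 / 2 * (\<Sum>c\<in>UNIV. \<Sum>d\<in>UNIV. fc i c d * comps F [c, d, a, b])"
  by (simp add: comps_contract_2 hook_rho0_Lam comps_hook_rho0)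

lemma comps_delta:
  assumes "F \<in> Lam 4"
  defines "B i a b \<equiv> comps (contract 2 (hook i rho0) F) [a, b]"
  shows "comps (delta F) [a, b, c] = B a b c + B b c a + B c a b"
proof -
  have "comps (delta F) [a, b, c] = B a b c - B b a c + B c a b"
    unfolding delta_def comps_linear comps_ext_2[OF contract_Lam_2[OF assms(1)]] sum.distrib sum_subtractf
    by (simp add: B_def)
  then show ?thesis
    using comps_2_swap[of "contract 2 (hook b rho0) F" a c] by (simp add: B_def)
qed

theorem Theta_injective:
  assumes T: "T \<in> torsion_3" and F: "F \<in> torsion_4" and eq: "Theta1 T + Theta2 F = 0"
  shows "T = 0" "F = 0"
proof -
  have T3: "T \<in> Lam 3" and F4: "F \<in> Lam 4"
    using T F by (simp_all add: torsion_3_def torsion_4_def)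
  define K where "K i = (1 / 2) *\<^sub>R hook i T + contract 2 (hook i rho0) F" for i
  define A where "A i j = 1 / 6 * inner (hook j rho0) (K i)" for i j
  have K_Lam: "K i \<in> Lam 2" for i
    unfolding K_def by (intro subspace_add subspace_scale subspace_Lam hook_Lam_2 contract_Lam_2 T3 F4)
  have "pr_m (K i) = 0" for i
  proof -
    have "(Theta1 T + Theta2 F) $ i = - pr_m (K i)"
      unfolding K_def using T3 F4
      by (simp add: Theta1_def Theta2_def pr_m_add pr_m_scale hook_Lam_2 contract_Lam_2 subspace_scale
          subspace_Lam)
    then show ?thesis
      by (simp add: eq)
  qed
  then have "K i = (\<Sum>j\<in>UNIV. A i j *\<^sub>R hook j rho0)" for i
    unfolding A_def pr_m_eq[OF K_Lam] by (simp add: scaleR_sum_right)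
  then have K_comps: "comps (K i) [a, b] = (\<Sum>j\<in>UNIV. A i j * fc j a b)" for i a b
    by (simp add: comps_linear comps_hook_rho0)
  have B: "comps (contract 2 (hook i rho0) F) [a, b]
      = 1 / 2 * (\<Sum>c\<in>UNIV. \<Sum>d\<in>UNIV. fc i c d * comps F [c, d, a, b])" for i a b
    by (rule comps_contract_rho0)
  have T_swap: "comps T [i, j, k] = - comps T [j, i, k]" "comps T [i, j, k] = - comps T [i, k, j]" for i j k
    using comps_swap[of T "[]" i j "[k]"] comps_swap[of T "[i]" j k "[]"] by simp_all
  have F_swap: "comps F [i, j, k, l] = - comps F [j, i, k, l]"
    "comps F [i, j, k, l] = - comps F [i, k, j, l]" "comps F [i, j, k, l] = - comps F [i, j, l, k]" for i j k l
    using comps_swap[of F "[]" i j "[k, l]"] comps_swap[of F "[i]" j k "[l]"]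
      comps_swap[of F "[i, j]" k l "[]"] by simp_all
  have cyc: "(\<Sum>c\<in>UNIV. \<Sum>d\<in>UNIV. fc i c d * comps F [c, d, j, k])
      + (\<Sum>c\<in>UNIV. \<Sum>d\<in>UNIV. fc j c d * comps F [c, d, k, i])
      + (\<Sum>c\<in>UNIV. \<Sum>d\<in>UNIV. fc k c d * comps F [c, d, i, j]) = 0" for i j k
  proof -
    have "comps (delta F) [i, j, k] = 0"
      using F by (simp add: torsion_4_def comps_linear)
    then show ?thesis
      unfolding comps_delta[OF F4] B by simp
  qed
  have K': "comps T [i, j, k] + (\<Sum>c\<in>UNIV. \<Sum>d\<in>UNIV. fc i c d * comps F [c, d, j, k])
      = 2 * (\<Sum>l\<in>UNIV. A i l * fc l j k)" for i j k
    unfolding K_comps[symmetric] K_def comps_linear B by (simp add: comps_Cons)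
  have "(\<Sum>i\<in>UNIV. inner (hook i rho0) (hook i T)) = inner rho0 (\<Sum>i\<in>UNIV. ext i (hook i T))"
    unfolding inner_sum_right inner_hook ..
  then have "(\<Sum>i\<in>UNIV. inner (hook i rho0) (hook i T)) = 0"
    using T by (simp add: euler[OF T3] torsion_3_def inner_commute)
  then have orth: "(\<Sum>i\<in>UNIV. \<Sum>a\<in>UNIV. \<Sum>b\<in>UNIV. fc i a b * comps T [i, a, b]) = 0"
    by (simp add: inner_hook_rho0_Lam_2 hook_Lam_2 T3 comps_Cons flip: sum_divide_distrib)
  have "comps T [i, j, k] = 0" "comps F [i, j, k, l] = 0" for i j k l
    using structure_tensor_unique[of "\<lambda>i j k. comps T [i, j, k]" "\<lambda>i j k l. comps F [i, j, k, l]" A,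
        OF T_swap F_swap cyc K' orth] by blast+
  note comps_0 = this
  show "T = 0"
    by (rule form_eqI[OF T3 subspace_0[OF subspace_Lam]])
      (auto simp: comps_0 comps_linear numeral_3_eq_3 length_Suc_conv)
  show "F = 0"
    by (rule form_eqI[OF F4 subspace_0[OF subspace_Lam]])
      (auto simp: comps_0 comps_linear eval_nat_numeral length_Suc_conv)
qed

lemma torsion_unique:
  assumes "T \<in> torsion_3" "F \<in> torsion_4" "G \<in> W6" and G: "Theta1 T + Theta2 F = G"
  shows "T = 0" "F = 0" "G = 0"
proof -
  have "inner G G = 0"
    using inner_W6_Theta1[of G T] inner_W6_Theta2[of G F] assms(1-3)
    by (subst (2) G[symmetric]) (simp add: inner_add_right torsion_3_def torsion_4_def)
  then show "G = 0"
    by simp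
  with assms show "T = 0" "F = 0"
    using Theta_injective by auto
qed


section \<open>The stabilizer of the model form\<close>

definition stabilizes :: "(8 \<Rightarrow> 8 \<Rightarrow> real) \<Rightarrow> bool" where
  "stabilizes w \<longleftrightarrow> (\<forall>a b c. (\<Sum>i\<in>UNIV. w a i * fc i b c + w b i * fc a i c + w c i * fc a b i) = 0)"

lemma stabilizes_fc: "stabilizes (fc j)"
  unfolding stabilizes_def
proof (intro allI)
  fix a b c
  have "fc j a i * fc i b c + fc j b i * fc a i c + fc j c i * fc a b i
      = fc i j a * fc i b c + fc i a b * fc i j c + fc i b j * fc i a c" for i
    using fc_rotate[of i j a] fc_rotate[of i j b] fc_rotate[of i j c] fc_rotate[of i a b]
      fc_swap(1)[of a i c] fc_swap(2)[of i b j] by simp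
  then show "(\<Sum>i\<in>UNIV. fc j a i * fc i b c + fc j b i * fc a i c + fc j c i * fc a b i) = 0"
    using fc_jacobi[of j a b c] by (simp add: sum.distrib)
qed

lemma stabilizes_sum:
  assumes "\<And>j. stabilizes (w j)"
  shows "stabilizes (\<lambda>a i. \<Sum>j\<in>(UNIV :: 8 set). A j * w j a i)"
  unfolding stabilizes_def
proof (intro allI)
  fix a b c
  have "(\<Sum>i\<in>UNIV. (\<Sum>j\<in>UNIV. A j * w j a i) * fc i b c + (\<Sum>j\<in>UNIV. A j * w j b i) * fc a i c
      + (\<Sum>j\<in>UNIV. A j * w j c i) * fc a b i)
    = (\<Sum>i\<in>UNIV. \<Sum>j\<in>UNIV. A j * (w j a i * fc i b c + w j b i * fc a i c + w j c i * fc a b i))"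
    unfolding sum_distrib_right distrib_left sum.distrib by (simp only: mult.assoc)
  also have "\<dots> = (\<Sum>j\<in>UNIV. A j * (\<Sum>i\<in>UNIV. w j a i * fc i b c + w j b i * fc a i c + w j c i * fc a b i))"
    unfolding sum_distrib_left by (rule sum.swap)
  also have "\<dots> = 0"
    using assms by (simp add: stabilizes_def)
  finally show "(\<Sum>i\<in>UNIV. (\<Sum>j\<in>UNIV. A j * w j a i) * fc i b c + (\<Sum>j\<in>UNIV. A j * w j b i) * fc a i c
      + (\<Sum>j\<in>UNIV. A j * w j c i) * fc a b i) = 0" .
qed

lemma stabilizes_diff:
  assumes "stabilizes v" "stabilizes w"
  shows "stabilizes (\<lambda>a i. v a i - w a i)"
  unfolding stabilizes_def
proof (intro allI)
  fix a b c
  have "(\<Sum>i\<in>UNIV. (v a i - w a i) * fc i b c + (v b i - w b i) * fc a i c + (v c i - w c i) * fc a b i)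
    = (\<Sum>i\<in>UNIV. v a i * fc i b c + v b i * fc a i c + v c i * fc a b i)
      - (\<Sum>i\<in>UNIV. w a i * fc i b c + w b i * fc a i c + w c i * fc a b i)"
    unfolding sum_subtractf[symmetric] by (intro sum.cong refl) (simp add: algebra_simps)
  then show "(\<Sum>i\<in>UNIV. (v a i - w a i) * fc i b c + (v b i - w b i) * fc a i c
      + (v c i - w c i) * fc a b i) = 0"
    using assms by (simp add: stabilizes_def)
qed

text \<open>The Killing form argument by which every derivation of a semisimple Lie algebra is inner.\<close>

lemma stabilizes_orthogonal:
  fixes w :: "8 \<Rightarrow> 8 \<Rightarrow> real"
  assumes "stabilizes w" and antisym: "\<And>a b. w a b = - w b a"
    and orth: "\<And>j. (\<Sum>a\<in>UNIV. \<Sum>b\<in>UNIV. fc j a b * w a b) = 0"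
  shows "w a d = 0"
proof -
  define R where "R i b = (\<Sum>c\<in>UNIV. fc a i c * fc d b c)" for i b
  define S where "S = (\<Sum>b\<in>UNIV. \<Sum>i\<in>UNIV. w b i * R i b)"
  have w1: "(\<Sum>b\<in>UNIV. \<Sum>c\<in>UNIV. \<Sum>i\<in>UNIV. fc d b c * (w a i * fc i b c)) = 12 * w a d"
  proof -
    have "(\<Sum>b\<in>UNIV. \<Sum>c\<in>UNIV. \<Sum>i\<in>UNIV. fc d b c * (w a i * fc i b c))
        = (\<Sum>i\<in>UNIV. \<Sum>b\<in>UNIV. \<Sum>c\<in>UNIV. fc d b c * (w a i * fc i b c))"
      by (rule sum_rotate3)
    also have "\<dots> = (\<Sum>i\<in>UNIV. w a i * (\<Sum>b\<in>UNIV. \<Sum>c\<in>UNIV. fc d b c * fc i b c))"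
      unfolding sum_distrib_left by (intro sum.cong refl) simp
    also have "\<dots> = (\<Sum>i\<in>UNIV. if i = d then 12 * w a d else 0)"
      unfolding fc_killing by (intro sum.cong refl) auto
    finally show ?thesis
      by simp
  qed
  have w2: "(\<Sum>b\<in>UNIV. \<Sum>c\<in>UNIV. \<Sum>i\<in>UNIV. fc d b c * (w b i * fc a i c)) = S"
  proof -
    have "(\<Sum>c\<in>UNIV. \<Sum>i\<in>UNIV. fc d b c * (w b i * fc a i c))
        = (\<Sum>i\<in>UNIV. \<Sum>c\<in>UNIV. w b i * (fc a i c * fc d b c))" for b
      by (subst sum.swap) (simp add: mult_ac)
    then show ?thesis
      by (simp add: S_def R_def sum_distrib_left)
  qed
  have w3: "(\<Sum>b\<in>UNIV. \<Sum>c\<in>UNIV. \<Sum>i\<in>UNIV. fc d b c * (w c i * fc a b i)) = S"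
  proof -
    have "(\<Sum>b\<in>UNIV. \<Sum>c\<in>UNIV. \<Sum>i\<in>UNIV. fc d b c * (w c i * fc a b i))
        = (\<Sum>c\<in>UNIV. \<Sum>b\<in>UNIV. \<Sum>i\<in>UNIV. fc d b c * (w c i * fc a b i))"
      by (rule sum.swap)
    also have "\<dots> = (\<Sum>c\<in>UNIV. \<Sum>b\<in>UNIV. \<Sum>i\<in>UNIV. fc d c b * (w c i * fc a i b))"
    proof (intro sum.cong refl)
      fix b c i
      show "fc d b c * (w c i * fc a b i) = fc d c b * (w c i * fc a i b)"
        using fc_swap(2)[of d b c] fc_swap(2)[of a b i] by simp
    qed
    finally show ?thesis
      using w2 by simp
  qed
  have R: "R i b - R b i = - (\<Sum>c\<in>UNIV. fc c d a * fc c i b)" for i b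
  proof -
    have "fc a i c * fc d b c - fc a b c * fc d i c = fc c a i * fc c d b + fc c i d * fc c a b" for c
      using fc_rotate[of c a i] fc_rotate[of c d b] fc_rotate[of c a b] fc_rotate[of c d i]
        fc_swap(2)[of c i d] by simp
    then show ?thesis
      using fc_jacobi[of a i d b] by (simp add: R_def sum.distrib flip: sum_subtractf)
  qed
  have "(\<Sum>b\<in>UNIV. \<Sum>i\<in>UNIV. w b i * R b i) = - S"
  proof -
    have "(\<Sum>b\<in>UNIV. \<Sum>i\<in>UNIV. w b i * R b i) = (\<Sum>i\<in>UNIV. \<Sum>b\<in>UNIV. w b i * R b i)"
      by (rule sum.swap)
    also have "\<dots> = (\<Sum>i\<in>UNIV. \<Sum>b\<in>UNIV. - (w i b * R b i))"
      by (intro sum.cong refl) (subst antisym, simp)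
    finally show ?thesis
      by (simp add: S_def sum_negf)
  qed
  then have "2 * S = (\<Sum>b\<in>UNIV. \<Sum>i\<in>UNIV. w b i * (R i b - R b i))"
    by (simp add: S_def right_diff_distrib sum_subtractf)
  also have "\<dots> = - (\<Sum>b\<in>UNIV. \<Sum>i\<in>UNIV. \<Sum>c\<in>UNIV. fc c d a * (fc c i b * w b i))"
    unfolding R by (simp add: sum_distrib_left sum_negf mult_ac)
  also have "\<dots> = - (\<Sum>c\<in>UNIV. \<Sum>b\<in>UNIV. \<Sum>i\<in>UNIV. fc c d a * (fc c i b * w b i))"
    by (rule arg_cong[of _ _ uminus], rule sum_rotate3)
  also have "\<dots> = (\<Sum>c\<in>UNIV. fc c d a * (\<Sum>b\<in>UNIV. \<Sum>i\<in>UNIV. fc c b i * w b i))"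
    unfolding sum_distrib_left sum_negf[symmetric]
  proof (intro sum.cong refl)
    fix b c i
    show "- (fc c d a * (fc c i b * w b i)) = fc c d a * (fc c b i * w b i)"
      using fc_swap(2)[of c i b] by simp
  qed
  also have "\<dots> = 0"
    unfolding orth by simp
  finally have "S = 0"
    by simp
  moreover have "(\<Sum>b\<in>UNIV. \<Sum>c\<in>UNIV. fc d b c *
      (\<Sum>i\<in>UNIV. w a i * fc i b c + w b i * fc a i c + w c i * fc a b i)) = 0"
    using assms(1) by (simp add: stabilizes_def)
  ultimately show ?thesis
    using w1 w2 w3 by (simp add: sum_distrib_left distrib_left sum.distrib)
qed

lemma stabilizes_iff_pr_m:
  assumes \<omega>: "\<omega> \<in> Lam 2"
  shows "stabilizes (\<lambda>a b. comps \<omega> [a, b]) \<longleftrightarrow> pr_m \<omega> = 0"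
proof -
  define A where "A j = 1 / 6 * inner (hook j rho0) \<omega>" for j
  have "\<omega> = pr_m \<omega> + (\<Sum>j\<in>UNIV. A j *\<^sub>R hook j rho0)"
    unfolding pr_m_eq[OF \<omega>] A_def by (simp add: scaleR_sum_right)
  then have "comps \<omega> [a, b] = comps (pr_m \<omega> + (\<Sum>j\<in>UNIV. A j *\<^sub>R hook j rho0)) [a, b]" for a b
    by simp
  then have eq: "comps \<omega> [a, b] = comps (pr_m \<omega>) [a, b] + (\<Sum>j\<in>UNIV. A j * fc j a b)" for a b
    by (simp add: comps_linear comps_hook_rho0)
  note inner_part = stabilizes_sum[of fc A, OF stabilizes_fc]
  show ?thesis
  proof
    assume "pr_m \<omega> = 0"
    then show "stabilizes (\<lambda>a b. comps \<omega> [a, b])"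
      unfolding eq using inner_part by (simp add: comps_linear)
  next
    assume "stabilizes (\<lambda>a b. comps \<omega> [a, b])"
    from stabilizes_diff[OF this inner_part] have st: "stabilizes (\<lambda>a b. comps (pr_m \<omega>) [a, b])"
      unfolding eq by simp
    have pr: "pr_m \<omega> \<in> Lam 2" "inner (hook j rho0) (pr_m \<omega>) = 0" for j
      using pr_m_Lam2_20[OF \<omega>] by (simp_all add: Lam2_20_iff)
    have "comps (pr_m \<omega>) [a, b] = 0" for a b
      by (rule stabilizes_orthogonal[OF st comps_2_swap])
        (use pr(2) in \<open>simp add: inner_hook_rho0_Lam_2 pr(1)\<close>)
    then show "pr_m \<omega> = 0"
      using pr(1) by (auto intro!: form_eqI[of _ 2] simp: subspace_0 subspace_Lam comps_linear
          eval_nat_numeral length_Suc_conv)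
  qed
qed

section \<open>Smooth functions and tangent vectors\<close>

lemma Ck_on_cong:
  assumes "open S" "\<And>x. x \<in> S \<Longrightarrow> f x = h x" "Ck_on k S f"
  shows "Ck_on k S h"
  using assms(2,3)
proof (induction k arbitrary: f h)
  case 0
  then show ?case
    by (simp cong: continuous_on_cong)
next
  case (Suc k)
  have deriv: "(h has_derivative frechet_derivative f (at x)) (at x)" if "x \<in> S" for x
    using Suc.prems that assms(1)
    by (intro has_derivative_transform_within_open[of f _ x UNIV S h])
      (auto simp flip: frechet_derivative_works)
  then have "frechet_derivative h (at x) = frechet_derivative f (at x)" if "x \<in> S" for x
    using that frechet_derivative_at by metis
  then show ?case
    using Suc.prems deriv by (auto intro: Suc.IH[of "\<lambda>x. frechet_derivative f (at x) v" for v]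
        simp: differentiable_def)
qed

lemma Ck_on_subset: "Ck_on k S f \<Longrightarrow> S' \<subseteq> S \<Longrightarrow> Ck_on k S' f"
  by (induction k arbitrary: f) (auto intro: continuous_on_subset)

lemma Ck_on_const: "Ck_on k S (\<lambda>x. c)"
  by (induction k arbitrary: c) simp_all

lemma Ck_on_add:
  assumes "open S" "Ck_on k S f" "Ck_on k S h"
  shows "Ck_on k S (\<lambda>x. f x + h x)"
  using assms(2,3)
proof (induction k arbitrary: f h)
  case (Suc k)
  have "frechet_derivative (\<lambda>x. f x + h x) (at x) v
      = frechet_derivative f (at x) v + frechet_derivative h (at x) v" if "x \<in> S" for x v
  proof -
    have "((\<lambda>x. f x + h x) has_derivative
        (\<lambda>v. frechet_derivative f (at x) v + frechet_derivative h (at x) v)) (at x)"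
      using Suc.prems that by (intro has_derivative_add) (auto simp flip: frechet_derivative_works)
    from frechet_derivative_at[OF this, symmetric] show ?thesis
      by (rule fun_cong)
  qed
  moreover have "Ck_on k S (\<lambda>x. frechet_derivative f (at x) v + frechet_derivative h (at x) v)" for v
    using Suc.prems by (intro Suc.IH) simp_all
  ultimately have "Ck_on k S (\<lambda>x. frechet_derivative (\<lambda>x. f x + h x) (at x) v)" for v
    by - (rule Ck_on_cong[OF assms(1),
        of "\<lambda>x. frechet_derivative f (at x) v + frechet_derivative h (at x) v"], simp_all)
  then show ?case
    using Suc.prems by simp
qed (auto intro: continuous_intros)

lemma smooth_on_mult:
  fixes f h :: "'a::euclidean_space \<Rightarrow> real"
  assumes "open S" "smooth_on S f" "smooth_on S h"
  shows "smooth_on S (\<lambda>x. f x * h x)"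
proof -
  have "Ck_on k S (\<lambda>x. f x * h x)" for k
    using assms(2,3)
  proof (induction k arbitrary: f h)
    case 0
    then have "Ck_on 0 S f" "Ck_on 0 S h"
      unfolding smooth_on_def by blast+
    then show ?case
      by (auto intro: continuous_intros)
  next
    case (Suc k)
    then have Sf: "Ck_on (Suc l) S f" and Sh: "Ck_on (Suc l) S h" for l
      unfolding smooth_on_def by blast+
    have "frechet_derivative (\<lambda>x. f x * h x) (at x) v
        = f x * frechet_derivative h (at x) v + frechet_derivative f (at x) v * h x" if "x \<in> S" for x v
    proof -
      have "((\<lambda>x. f x * h x) has_derivative (\<lambda>v. f x * frechet_derivative h (at x) v
          + frechet_derivative f (at x) v * h x)) (at x)"
        using Sf[of 0] Sh[of 0] that
        by (intro has_derivative_mult) (auto simp flip: frechet_derivative_works)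
      from frechet_derivative_at[OF this, symmetric] show ?thesis
        by (rule fun_cong)
    qed
    moreover have "Ck_on k S (\<lambda>x. f x * frechet_derivative h (at x) v
        + frechet_derivative f (at x) v * h x)" for v
    proof (rule Ck_on_add[OF assms(1)])
      have "Ck_on l S (\<lambda>x. frechet_derivative f (at x) v)"
        "Ck_on l S (\<lambda>x. frechet_derivative h (at x) v)" for l
        using Sf[of l] Sh[of l] by simp_all
      then have "smooth_on S (\<lambda>x. frechet_derivative f (at x) v)"
        "smooth_on S (\<lambda>x. frechet_derivative h (at x) v)"
        unfolding smooth_on_def by blast+
      then show "Ck_on k S (\<lambda>x. f x * frechet_derivative h (at x) v)"
        "Ck_on k S (\<lambda>x. frechet_derivative f (at x) v * h x)"
        using Suc.prems by (auto intro: Suc.IH)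
    qed
    ultimately have "Ck_on k S (\<lambda>x. frechet_derivative (\<lambda>x. f x * h x) (at x) v)" for v
      by - (rule Ck_on_cong[OF assms(1), of "\<lambda>x. f x * frechet_derivative h (at x) v
          + frechet_derivative f (at x) v * h x"], simp_all)
    then show ?case
      using Sf[of 0] Sh[of 0] by (simp add: differentiable_mult)
  qed
  then show ?thesis
    by (simp add: smooth_on_def)
qed

lemma smooth_on_add:
  "open S \<Longrightarrow> smooth_on S f \<Longrightarrow> smooth_on S h \<Longrightarrow> smooth_on S (\<lambda>x. f x + h x)"
  by (simp add: smooth_on_def Ck_on_add)

lemma smooth_funD:
  "smooth_fun A U f \<Longrightarrow> (W, \<phi>) \<in> A \<Longrightarrow> smooth_on (\<phi> ` (U \<inter> W)) (f \<circ> inv_into W \<phi>)"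
  unfolding smooth_fun_def by blast

lemma smooth_fun_subset:
  assumes "smooth_fun A U f" "open V" "V \<subseteq> U"
  shows "smooth_fun A V f"
  unfolding smooth_fun_def
proof (intro conjI ballI)
  fix c
  assume c: "c \<in> A"
  obtain W \<phi> where W: "c = (W, \<phi>)"
    by force
  with c assms(1) have "smooth_on (\<phi> ` (U \<inter> W)) (f \<circ> inv_into W \<phi>)"
    by (auto simp: smooth_fun_def)
  moreover have "\<phi> ` (V \<inter> W) \<subseteq> \<phi> ` (U \<inter> W)"
    using assms(3) by auto
  ultimately show "case c of (W, \<phi>) \<Rightarrow> smooth_on (\<phi> ` (V \<inter> W)) (f \<circ> inv_into W \<phi>)"
    unfolding W smooth_on_def by (auto intro: Ck_on_subset)
qed (rule assms(2))

lemma smooth_vfield_subset: "smooth_vfield A U X \<Longrightarrow> open V \<Longrightarrow> V \<subseteq> U \<Longrightarrow> smooth_vfield A V X"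
  unfolding smooth_vfield_def by blast

lemma smooth_vfield_tangent: "smooth_vfield A U X \<Longrightarrow> q \<in> U \<Longrightarrow> tangent A q (X q)"
  by (simp add: smooth_vfield_def)

lemma smooth_nearI: "smooth_fun A U f \<Longrightarrow> p \<in> U \<Longrightarrow> smooth_near A p f"
  unfolding smooth_near_def by blast

lemma tangent_comb:
  "tangent A p v \<Longrightarrow> smooth_near A p f \<Longrightarrow> smooth_near A p h
    \<Longrightarrow> v (\<lambda>q. a * f q + b * h q) = a * v f + b * v h"
  unfolding tangent_def by blast

lemma tangent_mult:
  "tangent A p v \<Longrightarrow> smooth_near A p f \<Longrightarrow> smooth_near A p h
    \<Longrightarrow> v (\<lambda>q. f q * h q) = f p * v h + h p * v f"
  unfolding tangent_def by blast

lemma tangent_eventually_eq: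
  "tangent A p v \<Longrightarrow> smooth_near A p f \<Longrightarrow> smooth_near A p h \<Longrightarrow> \<forall>\<^sub>F q in nhds p. f q = h q
    \<Longrightarrow> v f = v h"
  unfolding tangent_def by blast

lemma tangent_not_smooth: "tangent A p v \<Longrightarrow> \<not> smooth_near A p f \<Longrightarrow> v f = 0"
  unfolding tangent_def by blast

lemma tangent_lincomb:
  assumes v: "tangent A p v" and w: "tangent A p w"
  shows "tangent A p (lincomb a v b w)"
  unfolding tangent_def lincomb_def
proof (intro conjI allI impI; (elim conjE)?)
  fix f h c d
  assume fh: "smooth_near A p f" "smooth_near A p h"
  show "a * v (\<lambda>q. c * f q + d * h q) + b * w (\<lambda>q. c * f q + d * h q)
      = c * (a * v f + b * w f) + d * (a * v h + b * w h)"
    unfolding tangent_comb[OF v fh] tangent_comb[OF w fh] by (simp add: algebra_simps)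
  show "a * v (\<lambda>q. f q * h q) + b * w (\<lambda>q. f q * h q)
      = f p * (a * v h + b * w h) + h p * (a * v f + b * w f)"
    unfolding tangent_mult[OF v fh] tangent_mult[OF w fh] by (simp add: algebra_simps)
  assume "\<forall>\<^sub>F q in nhds p. f q = h q"
  then show "a * v f + b * w f = a * v h + b * w h"
    using tangent_eventually_eq[OF v fh] tangent_eventually_eq[OF w fh] by simp
next
  fix f
  assume "\<not> smooth_near A p f"
  then show "a * v f + b * w f = 0"
    using tangent_not_smooth[OF v] tangent_not_smooth[OF w] by simp
qed

locale smooth_manifold =
  fixes A :: "'m::{t2_space, second_countable_topology} atlas"
  assumes atlas: "oriented_smooth_atlas A"
begin

lemma open_chart_image:
  assumes "(V, \<phi>) \<in> A" "open U"
  shows "open (\<phi> ` (U \<inter> V))"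
proof -
  from assms(1) atlas have V: "open V" "open (\<phi> ` V)" "homeomorphism V (\<phi> ` V) \<phi> (inv_into V \<phi>)"
    unfolding oriented_smooth_atlas_def by blast+
  have "openin (top_of_set V) (U \<inter> V)"
    using assms(2) V(1) by (simp add: openin_open_eq open_Int)
  then have "openin (top_of_set (\<phi> ` V)) (\<phi> ` (U \<inter> V))"
    by (rule homeomorphism_imp_open_map[OF V(3)])
  then show ?thesis
    using V(2) by (simp add: openin_open_eq)
qed

lemma smooth_fun_add:
  assumes "smooth_fun A U f" "smooth_fun A U h"
  shows "smooth_fun A U (\<lambda>q. f q + h q)"
  unfolding smooth_fun_def
proof (intro conjI ballI)
  fix c
  assume c: "c \<in> A"
  obtain W \<phi> where W: "c = (W, \<phi>)"
    by force
  have "smooth_on (\<phi> ` (U \<inter> W)) (\<lambda>x. (f \<circ> inv_into W \<phi>) x + (h \<circ> inv_into W \<phi>) x)"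
  proof (rule smooth_on_add)
    show "open (\<phi> ` (U \<inter> W))"
      using c assms(1) unfolding W by (intro open_chart_image) (simp_all add: smooth_fun_def)
    show "smooth_on (\<phi> ` (U \<inter> W)) (f \<circ> inv_into W \<phi>)"
      "smooth_on (\<phi> ` (U \<inter> W)) (h \<circ> inv_into W \<phi>)"
      using c unfolding W by (rule smooth_funD[OF assms(1)] smooth_funD[OF assms(2)])+
  qed
  then show "case c of (W, \<phi>) \<Rightarrow> smooth_on (\<phi> ` (U \<inter> W)) ((\<lambda>q. f q + h q) \<circ> inv_into W \<phi>)"
    unfolding W by (simp add: o_def)
qed (use assms in \<open>simp add: smooth_fun_def\<close>)

lemma smooth_fun_mult:
  assumes "smooth_fun A U f" "smooth_fun A U h"
  shows "smooth_fun A U (\<lambda>q. f q * h q)"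
  unfolding smooth_fun_def
proof (intro conjI ballI)
  fix c
  assume c: "c \<in> A"
  obtain W \<phi> where W: "c = (W, \<phi>)"
    by force
  have "smooth_on (\<phi> ` (U \<inter> W)) (\<lambda>x. (f \<circ> inv_into W \<phi>) x * (h \<circ> inv_into W \<phi>) x)"
  proof (rule smooth_on_mult)
    show "open (\<phi> ` (U \<inter> W))"
      using c assms(1) unfolding W by (intro open_chart_image) (simp_all add: smooth_fun_def)
    show "smooth_on (\<phi> ` (U \<inter> W)) (f \<circ> inv_into W \<phi>)"
      "smooth_on (\<phi> ` (U \<inter> W)) (h \<circ> inv_into W \<phi>)"
      using c unfolding W by (rule smooth_funD[OF assms(1)] smooth_funD[OF assms(2)])+
  qed
  then show "case c of (W, \<phi>) \<Rightarrow> smooth_on (\<phi> ` (U \<inter> W)) ((\<lambda>q. f q * h q) \<circ> inv_into W \<phi>)"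
    unfolding W by (simp add: o_def)
qed (use assms in \<open>simp add: smooth_fun_def\<close>)

lemma smooth_fun_const: "open U \<Longrightarrow> smooth_fun A U (\<lambda>q. c)"
  by (auto simp: smooth_fun_def smooth_on_def o_def Ck_on_const)

lemma smooth_near_const: "smooth_near A p (\<lambda>q. c)"
  using smooth_fun_const[OF open_UNIV] by (auto simp: smooth_near_def)

lemma smooth_near_add:
  assumes "smooth_near A p f" "smooth_near A p h"
  shows "smooth_near A p (\<lambda>q. f q + h q)"
proof -
  obtain U V where "p \<in> U" "smooth_fun A U f" "p \<in> V" "smooth_fun A V h"
    using assms unfolding smooth_near_def by blast
  moreover from this have "open (U \<inter> V)"
    by (simp add: smooth_fun_def open_Int)
  ultimately show ?thesis
    by (intro smooth_nearI[of _ "U \<inter> V"] smooth_fun_add) (auto intro: smooth_fun_subset)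
qed

lemma smooth_near_mult:
  assumes "smooth_near A p f" "smooth_near A p h"
  shows "smooth_near A p (\<lambda>q. f q * h q)"
proof -
  obtain U V where "p \<in> U" "smooth_fun A U f" "p \<in> V" "smooth_fun A V h"
    using assms unfolding smooth_near_def by blast
  moreover from this have "open (U \<inter> V)"
    by (simp add: smooth_fun_def open_Int)
  ultimately show ?thesis
    by (intro smooth_nearI[of _ "U \<inter> V"] smooth_fun_mult) (auto intro: smooth_fun_subset)
qed

lemma smooth_near_sum:
  "finite S \<Longrightarrow> (\<And>i. i \<in> S \<Longrightarrow> smooth_near A p (f i)) \<Longrightarrow> smooth_near A p (\<lambda>q. \<Sum>i\<in>S. f i q)"
  by (induction S rule: finite_induct) (simp_all add: smooth_near_const smooth_near_add)

lemma tangent_add: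
  assumes "tangent A p v" "smooth_near A p f" "smooth_near A p h"
  shows "v (\<lambda>q. f q + h q) = v f + v h"
proof -
  have "v (\<lambda>q. 1 * f q + 1 * h q) = 1 * v f + 1 * v h"
    using assms by (rule tangent_comb)
  then show ?thesis
    by simp
qed

lemma tangent_local:
  assumes "tangent A p v" "smooth_near A p f" "smooth_near A p h"
    "open U" "p \<in> U" "\<And>q. q \<in> U \<Longrightarrow> f q = h q"
  shows "v f = v h"
proof -
  have "\<forall>\<^sub>F q in nhds p. f q = h q"
    using assms(4-6) unfolding eventually_nhds by blast
  with assms(1-3) show ?thesis
    by (rule tangent_eventually_eq)
qed

lemma tangent_const:
  assumes "tangent A p v"
  shows "v (\<lambda>q. c) = 0"
proof -
  have "v (\<lambda>q. c * 1 + 0 * 1) = c * v (\<lambda>q. 1) + 0 * v (\<lambda>q. 1)"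
    by (rule tangent_comb[OF assms smooth_near_const smooth_near_const])
  moreover have "v (\<lambda>q. 1 * 1) = 1 * v (\<lambda>q. 1) + 1 * v (\<lambda>q. 1)"
    by (rule tangent_mult[OF assms smooth_near_const smooth_near_const])
  ultimately show ?thesis
    by simp
qed

lemma tangent_locally_const:
  assumes "tangent A p v" "smooth_near A p f" "open U" "p \<in> U" "\<And>q. q \<in> U \<Longrightarrow> f q = c"
  shows "v f = 0"
  using tangent_local[OF assms(1,2) smooth_near_const assms(3,4), of c] assms(5) tangent_const[OF assms(1)]
  by simp

lemma tangent_sum:
  assumes "tangent A p v" "finite S" "\<And>i. i \<in> S \<Longrightarrow> smooth_near A p (f i)"
  shows "v (\<lambda>q. \<Sum>i\<in>S. f i q) = (\<Sum>i\<in>S. v (f i))"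
  using assms(2,3)
proof (induction S rule: finite_induct)
  case (insert i S)
  then have "v (\<lambda>q. f i q + (\<Sum>i\<in>S. f i q)) = v (f i) + v (\<lambda>q. \<Sum>i\<in>S. f i q)"
    by (intro tangent_add[OF assms(1)] smooth_near_sum) auto
  with insert show ?case
    by simp
qed (simp add: tangent_const[OF assms(1)])

end

lemma tangent_zero: "tangent A p (\<lambda>f. 0)"
  by (simp add: tangent_def)

definition tangent_linear :: "'m::topological_space atlas \<Rightarrow> 'm \<Rightarrow> ('m tvec \<Rightarrow> real) \<Rightarrow> bool" where
  "tangent_linear A p \<phi> \<longleftrightarrow> (\<forall>v w a b. tangent A p v \<and> tangent A p w \<longrightarrow>
     \<phi> (lincomb a v b w) = a * \<phi> v + b * \<phi> w)"

lemma tangent_linearD: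
  "tangent_linear A p \<phi> \<Longrightarrow> tangent A p v \<Longrightarrow> tangent A p w \<Longrightarrow> \<phi> (lincomb a v b w) = a * \<phi> v + b * \<phi> w"
  by (simp add: tangent_linear_def)

lemma tangent_linear_sum:
  assumes "tangent_linear A p \<phi>" "finite S" "\<And>i. i \<in> S \<Longrightarrow> tangent A p (v i)"
  shows "tangent A p (\<lambda>f. \<Sum>i\<in>S. c i * v i f) \<and> \<phi> (\<lambda>f. \<Sum>i\<in>S. c i * v i f) = (\<Sum>i\<in>S. c i * \<phi> (v i))"
  using assms(2,3)
proof (induction S rule: finite_induct)
  case empty
  have "\<phi> (lincomb 0 (\<lambda>f. 0) 0 (\<lambda>f. 0)) = 0 * \<phi> (\<lambda>f. 0) + 0 * \<phi> (\<lambda>f. 0)"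
    by (rule tangent_linearD[OF assms(1) tangent_zero tangent_zero])
  then show ?case
    by (simp add: tangent_zero lincomb_def)
next
  case (insert i S)
  have "(\<lambda>f. \<Sum>i\<in>insert i S. c i * v i f) = lincomb (c i) (v i) 1 (\<lambda>f. \<Sum>i\<in>S. c i * v i f)"
    using insert by (simp add: lincomb_def)
  then show ?case
    using insert by (simp add: tangent_lincomb tangent_linearD[OF assms(1)])
qed

section \<open>Tensors in a frame\<close>

lemma differential_form_linear:
  assumes "differential_form A k \<alpha>" "length xs = k" "\<forall>u\<in>set xs. tangent A p u" "i < k"
  shows "tangent_linear A p (\<lambda>v. \<alpha> p (xs[i := v]))"
  unfolding tangent_linear_def
  using assms(1)[unfolded differential_form_def, THEN conjunct2, THEN conjunct1, rule_format, of xs p i]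
    assms(2-4) by simp

lemma differential_form_zero:
  "differential_form A k \<alpha> \<Longrightarrow> \<not> (length xs = k \<and> (\<forall>v\<in>set xs. tangent A p v)) \<Longrightarrow> \<alpha> p xs = 0"
  unfolding differential_form_def by (elim conjE) simp

lemma differential_form_alternating:
  assumes "differential_form A k \<alpha>"
    and "length xs = k" "i < k" "j < k" "i \<noteq> j" "xs ! i = xs ! j"
  shows "\<alpha> p xs = 0"
  using assms(1)[unfolded differential_form_def, THEN conjunct2, THEN conjunct2, THEN conjunct1,
      rule_format, of xs i j p] assms(2-6) by simp

lemma differential_form_smooth:
  assumes "differential_form A k \<alpha>"
    and "open U" "length Xs = k" "\<forall>X\<in>set Xs. smooth_vfield A U X"
  shows "smooth_fun A U (\<lambda>q. \<alpha> q (map (\<lambda>X. X q) Xs))"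
  using assms(1)[unfolded differential_form_def, THEN conjunct2, THEN conjunct2, THEN conjunct2,
      rule_format, of U Xs] assms(2-4) by simp

lemma differential_form_swap:
  assumes \<alpha>: "differential_form A k \<alpha>" and len: "length (xs @ u # w # ys) = k"
    and tan: "\<forall>x\<in>set (xs @ u # w # ys). tangent A p x"
  shows "\<alpha> p (xs @ u # w # ys) = - \<alpha> p (xs @ w # u # ys)"
proof -
  define B where "B x y = \<alpha> p (xs @ x # y # ys)" for x y
  have lin1: "tangent_linear A p (\<lambda>x. B x y)" and lin2: "tangent_linear A p (\<lambda>x. B y x)"
    if "tangent A p y" for y
    using differential_form_linear[OF \<alpha>, of "xs @ y # y # ys" p "length xs"]
      differential_form_linear[OF \<alpha>, of "xs @ y # y # ys" p "Suc (length xs)"] len tan that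
    by (auto simp: B_def list_update_append)
  have same: "B x x = 0" for x
    using differential_form_alternating[OF \<alpha>, of "xs @ x # x # ys" "length xs" "Suc (length xs)" p] len
    by (simp add: B_def nth_append)
  have uw: "tangent A p u" "tangent A p w"
    using tan by auto
  define s where "s = lincomb 1 u 1 w"
  have s: "tangent A p s"
    unfolding s_def by (intro tangent_lincomb uw)
  have "B s s = B u s + B w s"
    using tangent_linearD[OF lin1[OF s] uw, of 1 1] by (simp add: s_def)
  moreover have "B u s = B u u + B u w" "B w s = B w u + B w w"
    using tangent_linearD[OF lin2[OF uw(1)] uw, of 1 1] tangent_linearD[OF lin2[OF uw(2)] uw, of 1 1]
    by (simp_all add: s_def)
  ultimately show ?thesis
    using same[of s] same[of u] same[of w] by (simp add: B_def)
qed

lemma metric_linear: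
  "riemannian_metric A g \<Longrightarrow> tangent A p w \<Longrightarrow> tangent_linear A p (\<lambda>v. g p v w)"
  unfolding riemannian_metric_def tangent_linear_def by blast

lemma metric_commute:
  "riemannian_metric A g \<Longrightarrow> tangent A p v \<Longrightarrow> tangent A p w \<Longrightarrow> g p v w = g p w v"
  unfolding riemannian_metric_def by blast

lemma metric_smooth:
  "riemannian_metric A g \<Longrightarrow> smooth_vfield A U X \<Longrightarrow> smooth_vfield A U Y
    \<Longrightarrow> smooth_fun A U (\<lambda>q. g q (X q) (Y q))"
  unfolding riemannian_metric_def by blast

lemma connection_tangent:
  assumes "connection A D" "p \<in> U" "tangent A p v" "smooth_vfield A U Y"
  shows "tangent A p (D p v Y)"
  using assms(1)[unfolded connection_def, THEN conjunct1, rule_format, of p U v Y] assms(2-4) by simp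

lemma connection_lincomb:
  assumes "connection A D" "p \<in> U" "tangent A p v" "tangent A p w" "smooth_vfield A U Y"
  shows "D p (lincomb a v b w) Y = lincomb a (D p v Y) b (D p w Y)"
  using assms(1)[unfolded connection_def, THEN conjunct2, THEN conjunct1, rule_format, of p U v w Y a b]
    assms(2-5) by simp

lemma metric_connection_compatible:
  assumes "metric_connection A g D"
    and "p \<in> U" "tangent A p v" "smooth_vfield A U Y" "smooth_vfield A U Z"
  shows "v (\<lambda>q. g q (Y q) (Z q)) = g p (D p v Y) (Z p) + g p (Y p) (D p v Z)"
  using assms(1)[unfolded metric_connection_def, THEN conjunct2, rule_format, of p U v Y Z]
    assms(2-5) by simp

lemma metric_connection_connection: "metric_connection A g D \<Longrightarrow> connection A D"
  unfolding metric_connection_def by blast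

locale psu3_manifold =
  fixes A :: "'m::{t2_space, second_countable_topology} atlas" and g :: "'m metric" and rho :: "'m mform"
  assumes psu3: "psu3_structure A g rho"
begin

sublocale smooth_manifold A
  using psu3 by unfold_locales (simp add: psu3_structure_def)

lemma metric: "riemannian_metric A g" and rho_form: "differential_form A 3 rho"
  and ex_adapted_frame: "\<exists>U e. p \<in> U \<and> adapted_frame A g rho U e"
  using psu3 by (auto simp: psu3_structure_def)

end

locale psu3_frame = psu3_manifold +
  fixes U e
  assumes frame: "adapted_frame A g rho U e"
begin

lemma open_U: "open U"
  and frame_smooth: "smooth_vfield A U (e i)"
  and frame_rho: "q \<in> U \<Longrightarrow> frame_form e q rho = rho0"
  and frame_orthonormal: "q \<in> U \<Longrightarrow> g q (e i q) (e j q) = (if i = j then 1 else 0)"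
  and frame_span: "q \<in> U \<Longrightarrow> tangent A q v \<Longrightarrow> \<exists>c. v = (\<lambda>f. \<Sum>i\<in>UNIV. c i * e i q f)"
  using frame unfolding adapted_frame_def oriented_orthonormal_frame_def by blast+

lemma frame_tangent: "p \<in> U \<Longrightarrow> tangent A p (e i p)"
  using smooth_vfield_tangent[OF frame_smooth] .

lemma frame_linear:
  assumes p: "p \<in> U" and v: "tangent A p v" and \<phi>: "tangent_linear A p \<phi>"
  shows "\<phi> v = (\<Sum>i\<in>UNIV. g p v (e i p) * \<phi> (e i p))"
proof -
  obtain c where c: "v = (\<lambda>f. \<Sum>i\<in>UNIV. c i * e i p f)"
    using frame_span[OF p v] by blast
  have sum: "\<psi> v = (\<Sum>i\<in>UNIV. c i * \<psi> (e i p))" if "tangent_linear A p \<psi>" for \<psi>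
    unfolding c using tangent_linear_sum[OF that finite, of UNIV "\<lambda>i. e i p" c] frame_tangent[OF p] by blast
  have "g p v (e j p) = c j" for j
  proof -
    have "g p v (e j p) = (\<Sum>i\<in>UNIV. c i * g p (e i p) (e j p))"
      by (rule sum[OF metric_linear[OF metric frame_tangent[OF p]]])
    also have "\<dots> = (\<Sum>i\<in>UNIV. if i = j then c i else 0)"
      by (intro sum.cong refl) (simp add: frame_orthonormal[OF p])
    finally show ?thesis
      by simp
  qed
  then show ?thesis
    using sum[OF \<phi>] by simp
qed

lemma metric_expand:
  assumes "p \<in> U" "tangent A p v" "tangent A p w"
  shows "g p v w = (\<Sum>i\<in>UNIV. g p v (e i p) * g p w (e i p))"
  using frame_linear[OF assms(1,2) metric_linear[OF metric assms(3)]]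
    metric_commute[OF metric assms(3) frame_tangent[OF assms(1)]] by simp

lemma comps_frame_form:
  assumes \<alpha>: "differential_form A k \<alpha>" and p: "p \<in> U" and "length is = k"
  shows "comps (frame_form e p \<alpha>) is = \<alpha> p (map (\<lambda>i. e i p) is)"
proof (rule alternating_eq[where k = k])
  fix "is" js :: "8 list" and i j
  assume "length is + length js + 2 = k"
  then show "\<alpha> p (map (\<lambda>i. e i p) (is @ i # j # js)) = - \<alpha> p (map (\<lambda>i. e i p) (is @ j # i # js))"
    using differential_form_swap[OF \<alpha>, of "map (\<lambda>i. e i p) is" "e i p" "e j p" "map (\<lambda>i. e i p) js" p]
      frame_tangent[OF p] by auto
  show "comps (frame_form e p \<alpha>) (is @ i # j # js) = - comps (frame_form e p \<alpha>) (is @ j # i # js)"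
    by (rule comps_swap)
qed (simp_all add: comps_ilist frame_form_def assms(3))

lemma form_eq_on_frame:
  assumes \<alpha>: "differential_form A k \<alpha>" and \<beta>: "differential_form A k \<beta>" and p: "p \<in> U"
    and eq: "frame_form e p \<alpha> = frame_form e p \<beta>"
  shows "\<alpha> p = \<beta> p"
proof
  fix xs
  show "\<alpha> p xs = \<beta> p xs"
  proof (cases "length xs = k \<and> (\<forall>v\<in>set xs. tangent A p v)")
    case True
    have "\<alpha> p xs = \<beta> p xs"
      if "length xs = k" "\<forall>v\<in>set xs. tangent A p v" "\<forall>i. n \<le> i \<and> i < k \<longrightarrow> xs ! i \<in> range (\<lambda>j. e j p)"
        "n \<le> k" for n xs
      using that
    proof (induction n arbitrary: xs)
      case 0
      then have "\<forall>v\<in>set xs. v \<in> range (\<lambda>j. e j p)"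
        by (auto simp: in_set_conv_nth)
      then have "xs \<in> lists (range (\<lambda>j. e j p))"
        by auto
      then obtain "is" where "xs = map (\<lambda>j. e j p) is"
        unfolding lists_image by auto
      then show ?case
        using comps_frame_form[OF \<alpha> p, of "is"] comps_frame_form[OF \<beta> p, of "is"] eq 0 by simp
    next
      case (Suc n)
      have "\<alpha> p (xs[n := e j p]) = \<beta> p (xs[n := e j p])" for j
        using Suc.prems frame_tangent[OF p, of j] set_update_subset_insert[of xs n "e j p"]
        by (intro Suc.IH) (auto simp: nth_list_update)
      then have "\<alpha> p (xs[n := xs ! n]) = \<beta> p (xs[n := xs ! n])"
        using frame_linear[OF p _ differential_form_linear[OF \<alpha>, of xs p n], of "xs ! n"]
          frame_linear[OF p _ differential_form_linear[OF \<beta>, of xs p n], of "xs ! n"] Suc.prems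
        by simp
      then show ?case
        by simp
    qed
    note eq_if = this
    show ?thesis
      by (rule eq_if[of xs k]) (use True in auto)
  next
    case False
    then show ?thesis
      using differential_form_zero[OF \<alpha> False] differential_form_zero[OF \<beta> False] by simp
  qed
qed

definition conn_coeff :: "'a conn \<Rightarrow> 'a \<Rightarrow> 'a tvec \<Rightarrow> 8 \<Rightarrow> 8 \<Rightarrow> real" where
  "conn_coeff D p v a b = g p (D p v (e a)) (e b p)"

lemma conn_coeff_linear:
  assumes "connection A D" and p: "p \<in> U"
  shows "tangent_linear A p (\<lambda>v. conn_coeff D p v a b)"
  unfolding tangent_linear_def conn_coeff_def
proof (intro allI impI, elim conjE)
  fix v w c d
  assume vw: "tangent A p v" "tangent A p w"
  have "tangent A p (D p v (e a))" "tangent A p (D p w (e a))"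
    by (intro connection_tangent[OF assms] frame_smooth vw)+
  then show "g p (D p (lincomb c v d w) (e a)) (e b p)
      = c * g p (D p v (e a)) (e b p) + d * g p (D p w (e a)) (e b p)"
    unfolding connection_lincomb[OF assms vw frame_smooth]
    by (intro tangent_linearD[OF metric_linear[OF metric frame_tangent[OF p]]])
qed

lemma conn_coeff_antisym:
  assumes D: "metric_connection A g D" and p: "p \<in> U" and v: "tangent A p v"
  shows "conn_coeff D p v a b = - conn_coeff D p v b a"
proof -
  have "v (\<lambda>q. g q (e a q) (e b q)) = 0"
    by (rule tangent_locally_const[OF v smooth_nearI[OF metric_smooth[OF metric frame_smooth frame_smooth] p]
        open_U p frame_orthonormal])
  then have "g p (D p v (e a)) (e b p) + g p (e a p) (D p v (e b)) = 0"
    using metric_connection_compatible[OF D p v frame_smooth[of a] frame_smooth[of b]] by simp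
  moreover have "g p (e a p) (D p v (e b)) = g p (D p v (e b)) (e a p)"
    by (intro metric_commute[OF metric] frame_tangent[OF p] connection_tangent[OF _ p v frame_smooth]
        metric_connection_connection[OF D])
  ultimately show ?thesis
    by (simp add: conn_coeff_def)
qed

lemma connection_forms_Lam: "connection_forms g D e p $ k \<in> Lam 2"
  unfolding connection_forms_def
  by (simp, intro subspace_sum subspace_Lam) (auto intro: subspace_scale[OF subspace_Lam] ee_2_Lam)

lemma comps_connection_forms:
  assumes D: "metric_connection A g D" and p: "p \<in> U"
  shows "comps (connection_forms g D e p $ k) [a, b] = conn_coeff D p (e k p) a b"
proof -
  let ?c = "conn_coeff D p (e k p)"
  note antisym = conn_coeff_antisym[OF D p frame_tangent[OF p]]
  have "comps (connection_forms g D e p $ k) [a, b]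
      = (\<Sum>(i, j) | pos i < pos j. ?c i j * minor i j a b)"
    unfolding connection_forms_def vec_lambda_beta comps_linear
    by (intro sum.cong refl) (auto simp: comps_linear comps_ee_minor conn_coeff_def)
  also have "\<dots> = 1 / 2 * (\<Sum>i\<in>UNIV. \<Sum>j\<in>UNIV. ?c i j * minor i j a b)"
  proof -
    have "?c i j * minor i j a b = ?c j i * minor j i a b" for i j
      using antisym[of k i j] by (simp add: minor_def)
    moreover have "?c i i * minor i i a b = 0" for i
      by (simp add: minor_def)
    ultimately show ?thesis
      using sum_ordered_pairs[of "\<lambda>i j. ?c i j * minor i j a b"] by simp
  qed
  also have "(\<Sum>i\<in>UNIV. \<Sum>j\<in>UNIV. ?c i j * minor i j a b)
      = (\<Sum>i\<in>UNIV. \<Sum>j\<in>UNIV. minor a b i j * ?c i j)"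
    by (intro sum.cong refl) (auto simp: minor_def of_bool_def)
  also have "\<dots> = 2 * ?c a b"
    using antisym[of k b a] by (simp add: sum_minor)
  finally show ?thesis
    by simp
qed

lemma rho_frame: "q \<in> U \<Longrightarrow> rho q [e a q, e b q, e c q] = fc a b c"
  using comps_frame_form[OF rho_form, of q "[a, b, c]"] by (simp add: frame_rho fc_def)

lemma rho_linear:
  assumes "tangent A p x" "tangent A p y"
  shows "tangent_linear A p (\<lambda>v. rho p [v, x, y])" "tangent_linear A p (\<lambda>v. rho p [x, v, y])"
    "tangent_linear A p (\<lambda>v. rho p [x, y, v])"
  using differential_form_linear[OF rho_form, of "[x, x, y]" p 0]
    differential_form_linear[OF rho_form, of "[x, x, y]" p 1]
    differential_form_linear[OF rho_form, of "[x, y, y]" p 2] assms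
  by (simp_all add: numeral_2_eq_2)

lemma rho_expand:
  assumes q: "q \<in> U" and "tangent A q x" "tangent A q y" "tangent A q z"
  shows "rho q [x, y, z] = (\<Sum>a\<in>UNIV. \<Sum>b\<in>UNIV. \<Sum>c\<in>UNIV.
    g q x (e a q) * (g q y (e b q) * (g q z (e c q) * fc a b c)))"
proof -
  have "rho q [x, y, z] = (\<Sum>a\<in>UNIV. g q x (e a q) * rho q [e a q, y, z])"
    by (rule frame_linear[OF q assms(2) rho_linear(1)[OF assms(3,4)]])
  also have "\<dots> = (\<Sum>a\<in>UNIV. g q x (e a q) * (\<Sum>b\<in>UNIV. g q y (e b q) * rho q [e a q, e b q, z]))"
    by (simp only: frame_linear[OF q assms(3) rho_linear(2)[OF frame_tangent[OF q] assms(4)]])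
  also have "\<dots> = (\<Sum>a\<in>UNIV. g q x (e a q) * (\<Sum>b\<in>UNIV. g q y (e b q)
      * (\<Sum>c\<in>UNIV. g q z (e c q) * rho q [e a q, e b q, e c q])))"
    by (simp only: frame_linear[OF q assms(4) rho_linear(3)[OF frame_tangent[OF q] frame_tangent[OF q]]])
  finally show ?thesis
    by (simp add: rho_frame[OF q] sum_distrib_left)
qed

lemma parallel_imp_stabilizes:
  assumes D: "metric_connection A g D" and par: "parallel_form A D 3 rho" and p: "p \<in> U"
    and v: "tangent A p v"
  shows "stabilizes (conn_coeff D p v)"
  unfolding stabilizes_def
proof (intro allI)
  fix a b c
  have tan: "tangent A p (D p v (e i))" for i
    by (rule connection_tangent[OF metric_connection_connection[OF D] p v frame_smooth])
  have "smooth_fun A U (\<lambda>q. rho q (map (\<lambda>X. X q) [e a, e b, e c]))"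
    by (rule differential_form_smooth[OF rho_form open_U]) (auto simp: frame_smooth)
  then have smooth: "smooth_near A p (\<lambda>q. rho q [e a q, e b q, e c q])"
    using p by (auto intro: smooth_nearI)
  have "v (\<lambda>q. rho q [e a q, e b q, e c q]) = 0"
    by (rule tangent_locally_const[OF v smooth open_U p rho_frame])
  moreover have "v (\<lambda>q. rho q (map (\<lambda>Y. Y q) [e a, e b, e c]))
      - (\<Sum>i<3. rho p ((map (\<lambda>Y. Y p) [e a, e b, e c])[i := D p v ([e a, e b, e c] ! i)])) = 0"
    using par p v frame_smooth unfolding parallel_form_def
    by (elim allE[of _ U] allE[of _ p] allE[of _ v] allE[of _ "[e a, e b, e c]"]) auto
  ultimately have "rho p [D p v (e a), e b p, e c p] + rho p [e a p, D p v (e b), e c p]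
      + rho p [e a p, e b p, D p v (e c)] = 0"
    by (simp add: eval_nat_numeral lessThan_Suc)
  moreover have "rho p [D p v (e a), e b p, e c p] = (\<Sum>i\<in>UNIV. conn_coeff D p v a i * fc i b c)"
    "rho p [e a p, D p v (e b), e c p] = (\<Sum>i\<in>UNIV. conn_coeff D p v b i * fc a i c)"
    "rho p [e a p, e b p, D p v (e c)] = (\<Sum>i\<in>UNIV. conn_coeff D p v c i * fc a b i)"
    using frame_linear[OF p tan rho_linear(1)[OF frame_tangent[OF p] frame_tangent[OF p]]]
      frame_linear[OF p tan rho_linear(2)[OF frame_tangent[OF p] frame_tangent[OF p]]]
      frame_linear[OF p tan rho_linear(3)[OF frame_tangent[OF p] frame_tangent[OF p]]]
    by (simp_all add: conn_coeff_def rho_frame[OF p])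
  ultimately show "(\<Sum>i\<in>UNIV. conn_coeff D p v a i * fc i b c + conn_coeff D p v b i * fc a i c
      + conn_coeff D p v c i * fc a b i) = 0"
    by (simp add: sum.distrib)
qed

end

lemma stabilizes_contraction:
  fixes w :: "8 \<Rightarrow> 8 \<Rightarrow> real"
  assumes st: "stabilizes w" and antisym: "\<And>a b. w a b = - w b a"
  defines "W y a \<equiv> \<Sum>i\<in>UNIV. y i * w a i"
  shows "(\<Sum>a\<in>UNIV. \<Sum>b\<in>UNIV. \<Sum>c\<in>UNIV. (W y0 a * (y1 b * y2 c) + y0 a * (W y1 b * y2 c + y1 b * W y2 c))
    * fc a b c) = 0"
proof -
  have transpose: "(\<Sum>a\<in>UNIV. W y a * F a) = - (\<Sum>a\<in>UNIV. y a * (\<Sum>i\<in>UNIV. w a i * F i))" for y F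
  proof -
    have "(\<Sum>a\<in>UNIV. W y a * F a) = (\<Sum>a\<in>UNIV. \<Sum>i\<in>UNIV. y i * w a i * F a)"
      by (simp add: W_def sum_distrib_right)
    also have "\<dots> = (\<Sum>i\<in>UNIV. \<Sum>a\<in>UNIV. y i * w a i * F a)"
      by (rule sum.swap)
    also have "\<dots> = (\<Sum>i\<in>UNIV. \<Sum>a\<in>UNIV. - (y i * (w i a * F a)))"
      by (intro sum.cong refl) (subst antisym, simp)
    finally show ?thesis
      by (simp add: sum_negf sum_distrib_left)
  qed
  have 0: "(\<Sum>a\<in>UNIV. \<Sum>b\<in>UNIV. \<Sum>c\<in>UNIV. W y0 a * (y1 b * y2 c) * fc a b c)
      = - (\<Sum>a\<in>UNIV. \<Sum>b\<in>UNIV. \<Sum>c\<in>UNIV. y0 a * (y1 b * y2 c) * (\<Sum>i\<in>UNIV. w a i * fc i b c))"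
  proof -
    have "(\<Sum>a\<in>UNIV. \<Sum>b\<in>UNIV. \<Sum>c\<in>UNIV. W y0 a * (y1 b * y2 c) * fc a b c)
        = (\<Sum>a\<in>UNIV. W y0 a * (\<Sum>b\<in>UNIV. \<Sum>c\<in>UNIV. y1 b * y2 c * fc a b c))"
      by (simp add: sum_distrib_left mult_ac)
    also have "\<dots> = - (\<Sum>a\<in>UNIV. y0 a * (\<Sum>i\<in>UNIV. w a i * (\<Sum>b\<in>UNIV. \<Sum>c\<in>UNIV. y1 b * y2 c * fc i b c)))"
      by (rule transpose)
    finally have *: "(\<Sum>a\<in>UNIV. \<Sum>b\<in>UNIV. \<Sum>c\<in>UNIV. W y0 a * (y1 b * y2 c) * fc a b c)
        = - (\<Sum>a\<in>UNIV. y0 a * (\<Sum>i\<in>UNIV. w a i * (\<Sum>b\<in>UNIV. \<Sum>c\<in>UNIV. y1 b * y2 c * fc i b c)))" .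
    have "(\<Sum>i\<in>UNIV. w a i * (\<Sum>b\<in>UNIV. \<Sum>c\<in>UNIV. y1 b * y2 c * fc i b c))
        = (\<Sum>b\<in>UNIV. \<Sum>c\<in>UNIV. y1 b * y2 c * (\<Sum>i\<in>UNIV. w a i * fc i b c))" for a
    proof -
      have "(\<Sum>i\<in>UNIV. \<Sum>b\<in>UNIV. \<Sum>c\<in>UNIV. w a i * (y1 b * y2 c * fc i b c))
          = (\<Sum>b\<in>UNIV. \<Sum>c\<in>UNIV. \<Sum>i\<in>UNIV. w a i * (y1 b * y2 c * fc i b c))"
        by (rule sum_rotate3[symmetric])
      then show ?thesis
        unfolding sum_distrib_left by (simp only: mult.left_commute)
    qed
    then show ?thesis
      unfolding * by (simp add: sum_distrib_left mult.assoc)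
  qed
  have 1: "(\<Sum>a\<in>UNIV. \<Sum>b\<in>UNIV. \<Sum>c\<in>UNIV. y0 a * (W y1 b * y2 c) * fc a b c)
      = - (\<Sum>a\<in>UNIV. \<Sum>b\<in>UNIV. \<Sum>c\<in>UNIV. y0 a * (y1 b * y2 c) * (\<Sum>i\<in>UNIV. w b i * fc a i c))"
    unfolding sum_negf[symmetric]
  proof (rule sum.cong[OF refl])
    fix a
    have "(\<Sum>b\<in>UNIV. \<Sum>c\<in>UNIV. y0 a * (W y1 b * y2 c) * fc a b c)
        = (\<Sum>c\<in>UNIV. y0 a * y2 c * (\<Sum>b\<in>UNIV. W y1 b * fc a b c))"
      by (subst sum.swap) (simp add: sum_distrib_left mult_ac)
    also have "\<dots> = (\<Sum>c\<in>UNIV. \<Sum>b\<in>UNIV. - (y0 a * (y1 b * y2 c) * (\<Sum>i\<in>UNIV. w b i * fc a i c)))"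
      unfolding transpose by (simp add: sum_distrib_left sum_negf mult_ac)
    also have "\<dots> = (\<Sum>b\<in>UNIV. \<Sum>c\<in>UNIV. - (y0 a * (y1 b * y2 c) * (\<Sum>i\<in>UNIV. w b i * fc a i c)))"
      by (rule sum.swap)
    finally show "(\<Sum>b\<in>UNIV. \<Sum>c\<in>UNIV. y0 a * (W y1 b * y2 c) * fc a b c)
        = (\<Sum>b\<in>UNIV. \<Sum>c\<in>UNIV. - (y0 a * (y1 b * y2 c) * (\<Sum>i\<in>UNIV. w b i * fc a i c)))" .
  qed
  have 2: "(\<Sum>a\<in>UNIV. \<Sum>b\<in>UNIV. \<Sum>c\<in>UNIV. y0 a * (y1 b * W y2 c) * fc a b c)
      = - (\<Sum>a\<in>UNIV. \<Sum>b\<in>UNIV. \<Sum>c\<in>UNIV. y0 a * (y1 b * y2 c) * (\<Sum>i\<in>UNIV. w c i * fc a b i))"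
    unfolding sum_negf[symmetric]
  proof (rule sum.cong[OF refl], rule sum.cong[OF refl])
    fix a b
    have "(\<Sum>c\<in>UNIV. y0 a * (y1 b * W y2 c) * fc a b c)
        = y0 a * y1 b * (\<Sum>c\<in>UNIV. W y2 c * fc a b c)"
      by (simp add: sum_distrib_left mult_ac)
    then show "(\<Sum>c\<in>UNIV. y0 a * (y1 b * W y2 c) * fc a b c)
        = (\<Sum>c\<in>UNIV. - (y0 a * (y1 b * y2 c) * (\<Sum>i\<in>UNIV. w c i * fc a b i)))"
      unfolding transpose by (simp add: sum_distrib_left sum_negf mult_ac)
  qed
  have "(\<Sum>a\<in>UNIV. \<Sum>b\<in>UNIV. \<Sum>c\<in>UNIV. y0 a * (y1 b * y2 c) *
      (\<Sum>i\<in>UNIV. w a i * fc i b c + w b i * fc a i c + w c i * fc a b i)) = 0"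
    using st by (simp add: stabilizes_def)
  then show ?thesis
    using 0 1 2 by (simp add: distrib_left distrib_right sum.distrib)
qed

context psu3_frame
begin

lemma stabilizes_imp_parallel:
  assumes D: "metric_connection A g D" and st: "stabilizes (conn_coeff D p v)" and p: "p \<in> U"
    and v: "tangent A p v" and V: "p \<in> V" and Y: "\<And>Y. Y \<in> set [Y0, Y1, Y2] \<Longrightarrow> smooth_vfield A V Y"
  shows "v (\<lambda>q. rho q [Y0 q, Y1 q, Y2 q]) = rho p [D p v Y0, Y1 p, Y2 p]
    + rho p [Y0 p, D p v Y1, Y2 p] + rho p [Y0 p, Y1 p, D p v Y2]"
proof -
  define w where "w = conn_coeff D p v"
  define y where "y Y a q = g q (Y q) (e a q)" for Y a q
  define z where "z Y a = g p (D p v Y) (e a p)" for Y a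
  have "open V"
    using Y[of Y0] by (simp add: smooth_vfield_def)
  then have UV: "open (U \<inter> V)" "p \<in> U \<inter> V"
    using open_U p V by auto
  have YUV: "smooth_vfield A (U \<inter> V) Y" if "Y \<in> set [Y0, Y1, Y2]" for Y
    using smooth_vfield_subset[OF Y[OF that] UV(1)] by simp
  have eUV: "smooth_vfield A (U \<inter> V) (e a)" for a
    using smooth_vfield_subset[OF frame_smooth UV(1)] by simp
  have tan: "tangent A q (Y q)" if "Y \<in> set [Y0, Y1, Y2]" "q \<in> U \<inter> V" for Y q
    using smooth_vfield_tangent[OF YUV[OF that(1)] that(2)] .
  note conn = metric_connection_connection[OF D]
  have tanD: "tangent A p (D p v Y)" if "Y \<in> set [Y0, Y1, Y2]" for Y
    by (rule connection_tangent[OF conn V v Y[OF that]])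
  have smooth: "smooth_near A p (y Y a)" if "Y \<in> set [Y0, Y1, Y2]" for Y a
    unfolding y_def by (rule smooth_nearI[OF metric_smooth[OF metric YUV[OF that] eUV] UV(2)])
  have vy: "v (y Y a) = z Y a + (\<Sum>i\<in>UNIV. y Y i p * w a i)" if "Y \<in> set [Y0, Y1, Y2]" for Y a
  proof -
    have "v (y Y a) = z Y a + g p (Y p) (D p v (e a))"
      unfolding y_def z_def using metric_connection_compatible[OF D UV(2) v YUV[OF that] eUV] .
    also have "g p (Y p) (D p v (e a)) = (\<Sum>i\<in>UNIV. y Y i p * w a i)"
      unfolding y_def w_def conn_coeff_def
      by (rule metric_expand[OF p tan[OF that UV(2)] connection_tangent[OF conn p v frame_smooth]])
    finally show ?thesis .
  qed
  have expand: "rho q [Y0 q, Y1 q, Y2 q] = (\<Sum>a\<in>UNIV. \<Sum>b\<in>UNIV. \<Sum>c\<in>UNIV.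
      y Y0 a q * (y Y1 b q * (y Y2 c q * fc a b c)))" if "q \<in> U \<inter> V" for q
    unfolding y_def using that by (intro rho_expand tan) auto
  have sm: "smooth_near A p (\<lambda>q. y Y0 a q * (y Y1 b q * (y Y2 c q * fc a b c)))"
    "smooth_near A p (\<lambda>q. y Y1 b q * (y Y2 c q * fc a b c))"
    "smooth_near A p (\<lambda>q. y Y2 c q * fc a b c)" for a b c
    by (intro smooth_near_mult[OF smooth] smooth_near_const list.set_intros)+
  have smooth_rho: "smooth_near A p (\<lambda>q. rho q [Y0 q, Y1 q, Y2 q])"
    using differential_form_smooth[OF rho_form UV(1), of "[Y0, Y1, Y2]"] YUV UV(2)
    by (auto intro: smooth_nearI)
  have "v (\<lambda>q. rho q [Y0 q, Y1 q, Y2 q]) = v (\<lambda>q. \<Sum>a\<in>UNIV. \<Sum>b\<in>UNIV. \<Sum>c\<in>UNIV.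
      y Y0 a q * (y Y1 b q * (y Y2 c q * fc a b c)))"
    by (rule tangent_local[OF v smooth_rho _ UV expand]) (intro smooth_near_sum finite sm)
  also have "\<dots> = (\<Sum>a\<in>UNIV. \<Sum>b\<in>UNIV. \<Sum>c\<in>UNIV.
      v (\<lambda>q. y Y0 a q * (y Y1 b q * (y Y2 c q * fc a b c))))"
    by (simp add: tangent_sum[OF v] smooth_near_sum sm)
  also have "\<dots> = (\<Sum>a\<in>UNIV. \<Sum>b\<in>UNIV. \<Sum>c\<in>UNIV.
      (v (y Y0 a) * (y Y1 b p * y Y2 c p) + y Y0 a p * (v (y Y1 b) * y Y2 c p + y Y1 b p * v (y Y2 c)))
        * fc a b c)"
  proof (intro sum.cong refl)
    fix a b c
    have "v (\<lambda>q. y Y2 c q * fc a b c) = fc a b c * v (y Y2 c)"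
      using tangent_mult[OF v smooth[of Y2 c] smooth_near_const[of p "fc a b c"]] tangent_const[OF v]
      by simp
    then show "v (\<lambda>q. y Y0 a q * (y Y1 b q * (y Y2 c q * fc a b c)))
        = (v (y Y0 a) * (y Y1 b p * y Y2 c p) + y Y0 a p * (v (y Y1 b) * y Y2 c p + y Y1 b p * v (y Y2 c)))
          * fc a b c"
      using tangent_mult[OF v smooth[of Y0 a] sm(2)[of b c a]] tangent_mult[OF v smooth[of Y1 b] sm(3)[of c a b]]
      by (simp add: algebra_simps)
  qed
  also have "\<dots> = (\<Sum>a\<in>UNIV. \<Sum>b\<in>UNIV. \<Sum>c\<in>UNIV. z Y0 a * (y Y1 b p * (y Y2 c p * fc a b c)))
      + (\<Sum>a\<in>UNIV. \<Sum>b\<in>UNIV. \<Sum>c\<in>UNIV. y Y0 a p * (z Y1 b * (y Y2 c p * fc a b c)))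
      + (\<Sum>a\<in>UNIV. \<Sum>b\<in>UNIV. \<Sum>c\<in>UNIV. y Y0 a p * (y Y1 b p * (z Y2 c * fc a b c)))
      + (\<Sum>a\<in>UNIV. \<Sum>b\<in>UNIV. \<Sum>c\<in>UNIV. ((\<Sum>i\<in>UNIV. y Y0 i p * w a i) * (y Y1 b p * y Y2 c p)
        + y Y0 a p * ((\<Sum>i\<in>UNIV. y Y1 i p * w b i) * y Y2 c p
        + y Y1 b p * (\<Sum>i\<in>UNIV. y Y2 i p * w c i))) * fc a b c)"
    unfolding sum.distrib[symmetric]
    by (intro sum.cong refl) (simp add: vy distrib_left distrib_right mult_ac)
  also have "(\<Sum>a\<in>UNIV. \<Sum>b\<in>UNIV. \<Sum>c\<in>UNIV. ((\<Sum>i\<in>UNIV. y Y0 i p * w a i) * (y Y1 b p * y Y2 c p)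
        + y Y0 a p * ((\<Sum>i\<in>UNIV. y Y1 i p * w b i) * y Y2 c p
        + y Y1 b p * (\<Sum>i\<in>UNIV. y Y2 i p * w c i))) * fc a b c) = 0"
    unfolding w_def by (rule stabilizes_contraction[OF st conn_coeff_antisym[OF D p v]])
  also have "(\<Sum>a\<in>UNIV. \<Sum>b\<in>UNIV. \<Sum>c\<in>UNIV. z Y0 a * (y Y1 b p * (y Y2 c p * fc a b c)))
      = rho p [D p v Y0, Y1 p, Y2 p]"
    unfolding z_def y_def using tan UV(2) tanD by (intro rho_expand[OF p, symmetric]) auto
  also have "(\<Sum>a\<in>UNIV. \<Sum>b\<in>UNIV. \<Sum>c\<in>UNIV. y Y0 a p * (z Y1 b * (y Y2 c p * fc a b c)))
      = rho p [Y0 p, D p v Y1, Y2 p]"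
    unfolding z_def y_def using tan UV(2) tanD by (intro rho_expand[OF p, symmetric]) auto
  also have "(\<Sum>a\<in>UNIV. \<Sum>b\<in>UNIV. \<Sum>c\<in>UNIV. y Y0 a p * (y Y1 b p * (z Y2 c * fc a b c)))
      = rho p [Y0 p, Y1 p, D p v Y2]"
    unfolding z_def y_def using tan UV(2) tanD by (intro rho_expand[OF p, symmetric]) auto
  finally show ?thesis
    by simp
qed

lemma stabilizes_conn_coeff:
  assumes D: "metric_connection A g D" and p: "p \<in> U" and v: "tangent A p v"
    and "\<And>k. stabilizes (conn_coeff D p (e k p))"
  shows "stabilizes (conn_coeff D p v)"
proof -
  have "conn_coeff D p v = (\<lambda>a b. \<Sum>k\<in>UNIV. g p v (e k p) * conn_coeff D p (e k p) a b)"
    by (intro ext frame_linear[OF p v] conn_coeff_linear[OF metric_connection_connection[OF D] p])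
  then show ?thesis
    using stabilizes_sum[of "\<lambda>k. conn_coeff D p (e k p)" "\<lambda>k. g p v (e k p)"] assms(4) by simp
qed

lemma stabilizes_iff_connection_forms:
  assumes "metric_connection A g D" "p \<in> U"
  shows "stabilizes (conn_coeff D p (e k p)) \<longleftrightarrow> pr_m (connection_forms g D e p $ k) = 0"
  using stabilizes_iff_pr_m[OF connection_forms_Lam, of D p k] comps_connection_forms[OF assms] by simp

end

lemma W1_to_W5_subset: "W1 + W2 + W3 + W4 + W5 \<subseteq> {Theta1 T + Theta2 F | T F. T \<in> torsion_3 \<and> F \<in> torsion_4}"
proof
  fix G
  assume "G \<in> W1 + W2 + W3 + W4 + W5"
  then obtain T1 T2 T3 F1 F2 where G: "G = Theta1 T1 + Theta1 T2 + Theta1 T3 + Theta2 F1 + Theta2 F2"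
    and T: "T1 \<in> Lam3_8" "T2 \<in> Lam3_20" "T3 \<in> Lam3_27" and F: "F1 \<in> star ` Lam4_8" "F2 \<in> star ` Lam4_27"
    unfolding W1_def W2_def W3_def W4_def W5_def by (auto elim!: set_plus_elim)
  have T': "T1 \<in> torsion_3" "T2 \<in> torsion_3" "T3 \<in> torsion_3"
    using T Lam3_8_torsion Lam3_20_torsion Lam3_27_torsion by blast+
  have F': "F1 \<in> torsion_4" "F2 \<in> torsion_4"
    using F Lam3_8_torsion Lam3_27_torsion star_sigma_plus_torsion
    unfolding Lam4_8_def Lam4_27_def by blast+
  have Lam: "T1 \<in> Lam 3" "T2 \<in> Lam 3" "T3 \<in> Lam 3" "F1 \<in> Lam 4" "F2 \<in> Lam 4"
    using T' F' by (simp_all add: torsion_3_def torsion_4_def)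
  have "G = Theta1 (T1 + T2 + T3) + Theta2 (F1 + F2)"
    unfolding G by (simp add: Theta1_add Theta2_add Lam subspace_add[OF subspace_Lam])
  moreover have "T1 + T2 + T3 \<in> torsion_3" "F1 + F2 \<in> torsion_4"
    using T' F' by (auto intro!: subspace_add[OF subspace_torsion_3] subspace_add[OF subspace_torsion_4])
  ultimately show "G \<in> {Theta1 T + Theta2 F | T F. T \<in> torsion_3 \<and> F \<in> torsion_4}"
    by blast
qed

theorem theorem5p1:
  fixes A :: "'m::{t2_space, second_countable_topology} atlas"
    and g :: "'m metric" and rho Tc Fc T F :: "'m mform" and Dg D :: "'m conn"
  assumes "psu3_structure A g rho"
    and "levi_civita A g Dg"
    and "characteristic_forms A g rho Dg Tc Fc"
    and "differential_form A 3 T"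
    and "section_of A g rho (Lam3_8 + Lam3_20 + Lam3_27) T"
    and "differential_form A 4 F"
    and "section_of A g rho (star ` Lam4_8 + star ` Lam4_27) F"
    and "metric_connection A g D"
    and "\<And>U e p X Y Z. adapted_frame A g rho U e \<Longrightarrow> p \<in> U \<Longrightarrow> smooth_vfield A U X \<Longrightarrow>
           smooth_vfield A U Y \<Longrightarrow> smooth_vfield A U Z \<Longrightarrow>
           g p (D p (X p) Y) (Z p) = g p (Dg p (X p) Y) (Z p) + 1 / 2 * T p [X p, Y p, Z p]
             + form_app (contract 2 (interior_prod (frame_vec g e p (X p)) (frame_form e p rho))
                                    (frame_form e p F))
                        [frame_vec g e p (Y p), frame_vec g e p (Z p)]"
  shows "parallel_form A D 3 rho \<longleftrightarrow>
           of_type A g rho Dg (W1 + W2 + W3 + W4 + W5) \<and> T = Tc \<and> F = Fc"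
proof -
  interpret psu3_manifold A g rho
    by unfold_locales (rule assms(1))
  have Dg: "metric_connection A g Dg"
    using assms(2) by (simp add: levi_civita_def)
  have Tc: "differential_form A 3 Tc" "section_of A g rho (Lam3_8 + Lam3_20 + Lam3_27) Tc"
    and Fc: "differential_form A 4 Fc" "section_of A g rho (star ` Lam4_8 + star ` Lam4_27) Fc"
    using assms(3) by (simp_all add: characteristic_forms_def)
  have sections: "frame_form e p T \<in> torsion_3" "frame_form e p Tc \<in> torsion_3"
      "frame_form e p F \<in> torsion_4" "frame_form e p Fc \<in> torsion_4"
    if "adapted_frame A g rho U e" "p \<in> U" for U e p
    using that assms(5,7) Tc(2) Fc(2) Lam3_sum_torsion Lam4_sum_torsion unfolding section_of_def by blast+
  have torsion: "pr_m (connection_forms g D e p $ k)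
      = (intrinsic_torsion g Dg e p - Theta1 (frame_form e p T) - Theta2 (frame_form e p F)) $ k"
    if fr: "adapted_frame A g rho U e" and p: "p \<in> U" for U e p k
  proof -
    interpret psu3_frame A g rho U e
      by unfold_locales (rule fr)
    define K where "K = (1 / 2) *\<^sub>R hook k (frame_form e p T) + contract 2 (hook k rho0) (frame_form e p F)"
    have Lam: "frame_form e p T \<in> Lam 3" "frame_form e p F \<in> Lam 4"
      using sections[OF fr p] by (simp_all add: torsion_3_def torsion_4_def)
    have K: "K \<in> Lam 2"
      unfolding K_def
      by (intro subspace_add subspace_scale subspace_Lam hook_Lam_2 contract_Lam_2 Lam)
    have vec: "frame_vec g e p (e i p) = axis i 1" for i
      by (simp add: frame_vec_def frame_orthonormal[OF p] axis_def vec_eq_iff)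
    have interior: "interior_prod (axis i 1) \<alpha> = hook i \<alpha>" for i \<alpha>
    proof -
      have "interior_prod (axis i 1) \<alpha> = (\<Sum>j\<in>UNIV. if j = i then hook i \<alpha> else 0)"
        unfolding interior_prod_def by (intro sum.cong refl) (auto simp: axis_def)
      then show ?thesis
        by simp
    qed
    have "conn_coeff D p (e k p) a b = conn_coeff Dg p (e k p) a b + comps K [a, b]" for a b
    proof -
      have "form_app (contract 2 (hook k rho0) (frame_form e p F)) [axis a 1, axis b 1]
          = comps (contract 2 (hook k rho0) (frame_form e p F)) [a, b]"
        by (simp add: form_app_def comps_def interior)
      moreover have "T p [e k p, e a p, e b p] = comps (hook k (frame_form e p T)) [a, b]"
        using comps_frame_form[OF assms(4) p, of "[k, a, b]"] by (simp add: comps_Cons)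
      ultimately show ?thesis
        using assms(9)[OF fr p frame_smooth[of k] frame_smooth[of a] frame_smooth[of b]]
        by (simp add: conn_coeff_def K_def comps_linear vec interior frame_rho[OF p])
    qed
    then have "connection_forms g D e p $ k = connection_forms g Dg e p $ k + K"
      by (intro form_eqI[of _ 2] subspace_add[OF subspace_Lam] connection_forms_Lam K)
        (auto simp: comps_linear comps_connection_forms[OF assms(8) p] comps_connection_forms[OF Dg p]
          eval_nat_numeral length_Suc_conv)
    then have "pr_m (connection_forms g D e p $ k) = pr_m (connection_forms g Dg e p $ k) + pr_m K"
      by (simp add: pr_m_add connection_forms_Lam K)
    moreover have "pr_m K = - Theta1 (frame_form e p T) $ k - Theta2 (frame_form e p F) $ k"
      using Lam by (simp add: K_def Theta1_def Theta2_def pr_m_add pr_m_scale hook_Lam_2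
          contract_Lam_2 subspace_scale[OF subspace_Lam])
    ultimately show ?thesis
      by (simp add: intrinsic_torsion_def)
  qed
  define balanced where "balanced \<longleftrightarrow> (\<forall>U e p. adapted_frame A g rho U e \<and> p \<in> U \<longrightarrow>
    intrinsic_torsion g Dg e p = Theta1 (frame_form e p T) + Theta2 (frame_form e p F))"
  have "parallel_form A D 3 rho \<longleftrightarrow> balanced"
  proof
    assume par: "parallel_form A D 3 rho"
    show balanced
      unfolding balanced_def
    proof (intro allI impI, elim conjE)
      fix U e p
      assume fr: "adapted_frame A g rho U e" and p: "p \<in> U"
      interpret psu3_frame A g rho U e
        by unfold_locales (rule fr)
      have "pr_m (connection_forms g D e p $ k) = 0" for k
        using parallel_imp_stabilizes[OF assms(8) par p frame_tangent[OF p]]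
          stabilizes_iff_connection_forms[OF assms(8) p] by blast
      then have "intrinsic_torsion g Dg e p - Theta1 (frame_form e p T) - Theta2 (frame_form e p F) = 0"
        unfolding torsion[OF fr p] by (subst vec_eq_iff) simp
      then show "intrinsic_torsion g Dg e p = Theta1 (frame_form e p T) + Theta2 (frame_form e p F)"
        by (simp add: diff_diff_eq)
    qed
  next
    assume bal: balanced
    show "parallel_form A D 3 rho"
      unfolding parallel_form_def
    proof (intro allI impI, elim conjE)
      fix V p v and Ys :: "'m vfield list"
      assume V: "p \<in> V" and v: "tangent A p v" and len: "length Ys = 3"
        and Ys: "\<forall>Y\<in>set Ys. smooth_vfield A V Y"
      obtain U e where p: "p \<in> U" and fr: "adapted_frame A g rho U e"
        using ex_adapted_frame by blast
      interpret psu3_frame A g rho U e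
        by unfold_locales (rule fr)
      have "pr_m (connection_forms g D e p $ k) = 0" for k
        using bal fr p unfolding torsion[OF fr p] balanced_def by simp
      then have st: "stabilizes (conn_coeff D p v)"
        by (intro stabilizes_conn_coeff[OF assms(8) p v])
          (simp add: stabilizes_iff_connection_forms[OF assms(8) p])
      obtain Y0 Y1 Y2 where Y: "Ys = [Y0, Y1, Y2]"
        using len by (auto simp: numeral_3_eq_3 length_Suc_conv)
      show "v (\<lambda>q. rho q (map (\<lambda>Y. Y q) Ys))
          - (\<Sum>i<3. rho p ((map (\<lambda>Y. Y p) Ys)[i := D p v (Ys ! i)])) = 0"
        using stabilizes_imp_parallel[OF assms(8) st p v V, of Y0 Y1 Y2] Ys
        by (simp add: Y eval_nat_numeral lessThan_Suc)
    qed
  qed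
  also have "balanced \<longleftrightarrow> of_type A g rho Dg (W1 + W2 + W3 + W4 + W5) \<and> T = Tc \<and> F = Fc"
  proof -
    have char: "\<exists>G6\<in>W6. intrinsic_torsion g Dg e p
        = Theta1 (frame_form e p Tc) + Theta2 (frame_form e p Fc) + G6 \<and>
        (G6 = 0 \<longrightarrow> intrinsic_torsion g Dg e p \<in> W1 + W2 + W3 + W4 + W5)"
      if fr: "adapted_frame A g rho U e" and p: "p \<in> U" for U e p
    proof -
      obtain G1 G2 G3 G4 G5 G6 where G: "G1 \<in> W1" "G2 \<in> W2" "G3 \<in> W3" "G4 \<in> W4" "G5 \<in> W5" "G6 \<in> W6"
        "intrinsic_torsion g Dg e p = G1 + G2 + G3 + G4 + G5 + G6"
        "Theta1 (frame_form e p Tc) = G1 + G2 + G3" "Theta2 (frame_form e p Fc) = G4 + G5"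
        using assms(3)[unfolded characteristic_forms_def, THEN conjunct2, THEN conjunct2, THEN conjunct2,
            THEN conjunct2, rule_format, OF conjI[OF fr p]] by (elim bexE conjE)
      have "G1 + G2 + G3 + G4 + G5 \<in> W1 + W2 + W3 + W4 + W5"
        by (intro set_plus_intro G)
      moreover have "intrinsic_torsion g Dg e p
          = Theta1 (frame_form e p Tc) + Theta2 (frame_form e p Fc) + G6"
        unfolding G(7-9) by (simp only: add.assoc)
      ultimately show ?thesis
        using G(6,7) by (intro bexI[of _ G6]) simp_all
    qed
    have unique: "T' = frame_form e p Tc \<and> F' = frame_form e p Fc \<and>
        intrinsic_torsion g Dg e p \<in> W1 + W2 + W3 + W4 + W5"
      if fr: "adapted_frame A g rho U e" and p: "p \<in> U" and "T' \<in> torsion_3" "F' \<in> torsion_4"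
        and eq: "intrinsic_torsion g Dg e p = Theta1 T' + Theta2 F'" for U e p T' F'
    proof -
      obtain G6 where G6: "G6 \<in> W6" "intrinsic_torsion g Dg e p
          = Theta1 (frame_form e p Tc) + Theta2 (frame_form e p Fc) + G6"
        "G6 = 0 \<longrightarrow> intrinsic_torsion g Dg e p \<in> W1 + W2 + W3 + W4 + W5"
        using char[OF fr p] by blast
      have t: "T' - frame_form e p Tc \<in> torsion_3" "F' - frame_form e p Fc \<in> torsion_4"
        using that(3,4) sections[OF fr p]
        by (auto intro: subspace_diff[OF subspace_torsion_3] subspace_diff[OF subspace_torsion_4])
      have "Theta1 (T' - frame_form e p Tc) + Theta2 (F' - frame_form e p Fc) = G6"
        using eq G6(2) that(3,4) sections[OF fr p]
        by (simp add: Theta1_diff Theta2_diff torsion_3_def torsion_4_def algebra_simps)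
      from torsion_unique[OF t G6(1) this] G6(3) show ?thesis
        by simp
    qed
    show ?thesis
    proof
      assume bal: balanced
      have *: "frame_form e p T = frame_form e p Tc \<and> frame_form e p F = frame_form e p Fc \<and>
          intrinsic_torsion g Dg e p \<in> W1 + W2 + W3 + W4 + W5"
        if "adapted_frame A g rho U e" "p \<in> U" for U e p
        using bal that unfolding balanced_def by (intro unique[OF that] sections[OF that]) blast
      have "T p = Tc p \<and> F p = Fc p" for p
      proof -
        obtain U e where p: "p \<in> U" and fr: "adapted_frame A g rho U e"
          using ex_adapted_frame by blast
        interpret psu3_frame A g rho U e
          by unfold_locales (rule fr)
        show ?thesis
          using form_eq_on_frame[OF assms(4) Tc(1) p] form_eq_on_frame[OF assms(6) Fc(1) p] *[OF fr p]
          by blast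
      qed
      then have "T = Tc" "F = Fc"
        by (simp_all add: ext)
      moreover have "of_type A g rho Dg (W1 + W2 + W3 + W4 + W5)"
        unfolding of_type_def using * by blast
      ultimately show "of_type A g rho Dg (W1 + W2 + W3 + W4 + W5) \<and> T = Tc \<and> F = Fc"
        by blast
    next
      assume R: "of_type A g rho Dg (W1 + W2 + W3 + W4 + W5) \<and> T = Tc \<and> F = Fc"
      show balanced
        unfolding balanced_def
      proof (intro allI impI, elim conjE)
        fix U e p
        assume fr: "adapted_frame A g rho U e" and p: "p \<in> U"
        with R have "intrinsic_torsion g Dg e p \<in> W1 + W2 + W3 + W4 + W5"
          unfolding of_type_def by blast
        then obtain T' F' where TF: "T' \<in> torsion_3" "F' \<in> torsion_4"
          "intrinsic_torsion g Dg e p = Theta1 T' + Theta2 F'"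
          using W1_to_W5_subset by blast
        with unique[OF fr p TF] R show "intrinsic_torsion g Dg e p
            = Theta1 (frame_form e p T) + Theta2 (frame_form e p F)"
          by simp
      qed
    qed
  qed
  finally show ?thesis .
qed

end
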